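(* Let $U\in C^1(\mathbb{R}^d,\mathbb{R})$ with $\int_{\mathbb{R}^d}\exp(-U(q))\,dq<\infty$, let $\lambda_{\mathrm{ref}}>0$ and $0<\alpha\le1$. Then the Bouncy Particle Sampler with potential $U$ and autoregressive velocity refreshments with rate $\lambda_{\mathrm{ref}}$ and parameter $\alpha$ is Feller, and $C_c^\infty(\mathbb{R}^{2d})$ is a core of its generator.
   Context: Bouncy Particle Sampler: the piecewise-deterministic Markov process $Z_t$ on $\mathbb{R}^{2d}=\mathbb{R}^d\times\mathbb{R}^d\ni z=(q,p)$ with flow $\varphi_t(q,p)=(q+tp,p)$ (vector field $g(q,p)=(p,0)$) and two jump mechanisms: Bounces, with intensity $\lambda(q,p)=\max(\langle\nabla U(q),p\rangle,0)$, given by $(q,p)\mapsto(q,\mathcal{R}(q)p)$ with $$\mathcal{R}(q)p=p-2\frac{\langle\nabla U(q),p\rangle}{\|\nabla U(q)\|^2}\nabla U(q)$$ (with $\mathcal{R}(q)p:=p$ if $\nabla U(q)=0$, where the intensity vanishes). Velocity refreshments, with constant intensity $\lambda_{\mathrm{ref}}$, given by $(q,p)\mapsto(q,\alpha p+\sqrt{1-\alpha^2}\,\xi)$ with a fresh independent $\xi\sim\mathcal{N}(0,I_d)$. Dynamics: started at $z$, let $T^{(1)},T^{(2)}$ be independent with $\mathbb{P}(T^{(1)}\ge t)=\exp(-\int_0^t\lambda(\varphi_s(z))\,ds)$ and $T^{(2)}\sim\mathrm{Exp}(\lambda_{\mathrm{ref}})$. The process follows $\varphi_s(z)$ until $T=\min(T^{(1)},T^{(2)})$,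 when a bounce (if $T=T^{(1)}$) or a velocity refreshment (if $T=T^{(2)}$) is applied to $\varphi_T(z)$; then the procedure restarts independently from the new position. The Markov semigroup is $P_tf(z)=\mathbb{E}_z[f(Z_t)]$. $C_0(\mathbb{R}^{2d})$ is the space of continuous real functions vanishing at infinity, with supremum norm $\|\cdot\|_\infty$; $C_c^\infty(\mathbb{R}^{2d})$ is the space of infinitely differentiable functions with compact support. The process is Feller if $P_tf\in C_0(\mathbb{R}^{2d})$ for all $t\ge0$, $f\in C_0(\mathbb{R}^{2d})$, and $\lim_{t\to0}\|P_tf-f\|_\infty=0$ for all $f\in C_0(\mathbb{R}^{2d})$. The generator is $\mathcal{L}f=\lim_{t\downarrow0}\frac1t(P_tf-f)$ (limit in $\|\cdot\|_\infty$), with domain $\mathrm{dom}(\mathcal{L})$ the set of $f\in C_0(\mathbb{R}^{2d})$ for which the limit exists. A core of $\mathcal{L}$ is a subset $E\subset\mathrm{dom}(\mathcal{L})$ such that for every $f\in\mathrm{dom}(\mathcal{L})$ there is a sequence $f_n\in E$ with $\|f_n-f\|_\infty\to0$ and $\|\mathcal{L}f_n-\mathcal{L}f\|_\infty\to0$. *)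

theory Defs
  imports "HOL-Probability.Probability"
begin

section \<open>Function spaces\<close>

primrec Ck :: "nat \<Rightarrow> ('b::euclidean_space \<Rightarrow> real) \<Rightarrow> bool" where
  "Ck 0 f \<longleftrightarrow> continuous_on UNIV f"
| "Ck (Suc k) f \<longleftrightarrow>
     (\<forall>x. f differentiable (at x)) \<and> (\<forall>v. Ck k (\<lambda>x. frechet_derivative f (at x) v))"

definition Cc_infinity :: "('b::euclidean_space \<Rightarrow> real) set" where
  "Cc_infinity = {f. (\<forall>k. Ck k f) \<and> compact (closure {x. f x \<noteq> 0})}"

definition C0 :: "('b::euclidean_space \<Rightarrow> real) set" where
  "C0 = {f. continuous_on UNIV f \<and> (f \<longlongrightarrow> 0) at_infinity}"


section \<open>Feller semigroups, generators and cores\<close>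

text \<open>Convergence in the supremum norm is \<open>uniform_limit UNIV\<close>.\<close>

definition feller :: "(real \<Rightarrow> ('b::euclidean_space \<Rightarrow> real) \<Rightarrow> 'b \<Rightarrow> real) \<Rightarrow> bool" where
  "feller P \<longleftrightarrow>
     (\<forall>t\<ge>0. \<forall>f\<in>C0. P t f \<in> C0) \<and>
     (\<forall>f\<in>C0. uniform_limit UNIV (\<lambda>t. P t f) f (at_right 0))"

definition has_generator_value ::
    "(real \<Rightarrow> ('b::euclidean_space \<Rightarrow> real) \<Rightarrow> 'b \<Rightarrow> real) \<Rightarrow> ('b \<Rightarrow> real) \<Rightarrow> ('b \<Rightarrow> real) \<Rightarrow> bool" where
  "has_generator_value P f g \<longleftrightarrow>
     uniform_limit UNIV (\<lambda>t z. (P t f z - f z) / t) g (at_right 0)"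

definition generator_dom ::
    "(real \<Rightarrow> ('b::euclidean_space \<Rightarrow> real) \<Rightarrow> 'b \<Rightarrow> real) \<Rightarrow> ('b \<Rightarrow> real) set" where
  "generator_dom P = {f \<in> C0. \<exists>g. has_generator_value P f g}"

definition generator ::
    "(real \<Rightarrow> ('b::euclidean_space \<Rightarrow> real) \<Rightarrow> 'b \<Rightarrow> real) \<Rightarrow> ('b \<Rightarrow> real) \<Rightarrow> 'b \<Rightarrow> real" where
  "generator P f = (THE g. has_generator_value P f g)"

definition is_core ::
    "(real \<Rightarrow> ('b::euclidean_space \<Rightarrow> real) \<Rightarrow> 'b \<Rightarrow> real) \<Rightarrow> ('b \<Rightarrow> real) set \<Rightarrow> bool" where
  "is_core P E \<longleftrightarrow> E \<subseteq> generator_dom P \<and>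
     (\<forall>f\<in>generator_dom P. \<exists>F. (\<forall>n::nat. F n \<in> E) \<and>
        uniform_limit UNIV F f sequentially \<and>
        uniform_limit UNIV (\<lambda>n. generator P (F n)) (generator P f) sequentially)"


section \<open>The Bouncy Particle Sampler\<close>

definition nabla :: "('a::euclidean_space \<Rightarrow> real) \<Rightarrow> 'a \<Rightarrow> 'a" where
  "nabla U q = (THE D. GDERIV U q :> D)"

definition flow :: "real \<Rightarrow> 'a::euclidean_space \<times> 'a \<Rightarrow> 'a \<times> 'a" where
  "flow t = (\<lambda>(q, p). (q + t *\<^sub>R p, p))"

definition bounce_rate :: "('a::euclidean_space \<Rightarrow> real) \<Rightarrow> 'a \<times> 'a \<Rightarrow> real" where
  "bounce_rate U = (\<lambda>(q, p). max (nabla U q \<bullet> p) 0)"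

text \<open>Where the gradient vanishes, division by zero makes this map the identity in \<open>p\<close>.\<close>

definition bounce :: "('a::euclidean_space \<Rightarrow> real) \<Rightarrow> 'a \<times> 'a \<Rightarrow> 'a \<times> 'a" where
  "bounce U = (\<lambda>(q, p). (q, p - (2 * (nabla U q \<bullet> p) / (norm (nabla U q))\<^sup>2) *\<^sub>R nabla U q))"

definition refresh :: "real \<Rightarrow> 'a \<Rightarrow> 'a::euclidean_space \<times> 'a \<Rightarrow> 'a \<times> 'a" where
  "refresh \<alpha> \<xi> = (\<lambda>(q, p). (q, \<alpha> *\<^sub>R p + sqrt (1 - \<alpha>\<^sup>2) *\<^sub>R \<xi>))"

text \<open>
  The randomness driving one inter-jump stage: for each starting state \<open>z\<close> of the stage, the
  possibly infinite bounce time \<open>T1 z\<close>, the refreshment time \<open>T2\<close> and the Gaussian \<open>\<xi>\<close> are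
  independent and have the prescribed laws. Joint measurability of \<open>T1\<close> allows a stage to be
  started at a random state that is independent of it; how the \<open>T1 z\<close> for different \<open>z\<close> are
  coupled is left open, because only their individual laws enter the law of the process.
\<close>

locale bps_stage = prob_space N for N :: "'w measure" +
  fixes U :: "'a::euclidean_space \<Rightarrow> real"
    and r :: real
    and T1 :: "'a \<times> 'a \<Rightarrow> 'w \<Rightarrow> ennreal"
    and T2 :: "'w \<Rightarrow> real"
    and \<xi> :: "'w \<Rightarrow> 'a"
  assumes T1_measurable: "(\<lambda>(z, w). T1 z w) \<in> borel_measurable (borel \<Otimes>\<^sub>M N)"
    and T1_law: "\<And>z t. 0 \<le> t \<Longrightarrow>
          prob {w \<in> space N. ennreal t \<le> T1 z w} =
            exp (- integral {0..t} (\<lambda>s. bounce_rate U (flow s z)))"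
    and T2_law: "distributed N lborel T2 (exponential_density r)"
    and \<xi>_law: "distributed N lborel \<xi> (\<lambda>x. exp (- (norm x)\<^sup>2 / 2) / sqrt (2 * pi) ^ DIM('a))"
    and independent: "\<And>z. distr N (borel \<Otimes>\<^sub>M borel \<Otimes>\<^sub>M borel) (\<lambda>w. (T1 z w, T2 w, \<xi> w)) =
          distr N borel (T1 z) \<Otimes>\<^sub>M distr N borel T2 \<Otimes>\<^sub>M distr N borel \<xi>"

definition stage_length ::
    "('a::euclidean_space \<times> 'a \<Rightarrow> 'w \<Rightarrow> ennreal) \<Rightarrow> ('w \<Rightarrow> real) \<Rightarrow> 'a \<times> 'a \<Rightarrow> 'w \<Rightarrow> real" where
  "stage_length T1 T2 z w = enn2real (min (T1 z w) (ennreal (T2 w)))"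

definition stage_end ::
    "('a::euclidean_space \<Rightarrow> real) \<Rightarrow> real \<Rightarrow> ('a \<times> 'a \<Rightarrow> 'w \<Rightarrow> ennreal) \<Rightarrow> ('w \<Rightarrow> real) \<Rightarrow> ('w \<Rightarrow> 'a)
      \<Rightarrow> 'a \<times> 'a \<Rightarrow> 'w \<Rightarrow> 'a \<times> 'a" where
  "stage_end U \<alpha> T1 T2 \<xi> z w =
     (let y = flow (stage_length T1 T2 z w) z
      in if T1 z w \<le> ennreal (T2 w) then bounce U y else refresh \<alpha> (\<xi> w) y)"

text \<open>
  The \<open>n\<close>-th jump time together with the state right after that jump, for the process started
  at \<open>z\<close>. Stage \<open>n\<close> consumes the \<open>n\<close>-th entry of the stream \<open>\<omega>\<close>; under \<open>stream_space N\<close> these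
  entries are independent copies of \<open>N\<close>.
\<close>

primrec jump_chain ::
    "('a::euclidean_space \<Rightarrow> real) \<Rightarrow> real \<Rightarrow> ('a \<times> 'a \<Rightarrow> 'w \<Rightarrow> ennreal) \<Rightarrow> ('w \<Rightarrow> real) \<Rightarrow> ('w \<Rightarrow> 'a)
      \<Rightarrow> 'a \<times> 'a \<Rightarrow> 'w stream \<Rightarrow> nat \<Rightarrow> real \<times> ('a \<times> 'a)" where
  "jump_chain U \<alpha> T1 T2 \<xi> z \<omega> 0 = (0, z)"
| "jump_chain U \<alpha> T1 T2 \<xi> z \<omega> (Suc n) =
     (let (s, y) = jump_chain U \<alpha> T1 T2 \<xi> z \<omega> n
      in (s + stage_length T1 T2 y (\<omega> !! n), stage_end U \<alpha> T1 T2 \<xi> y (\<omega> !! n)))"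

text \<open>
  If the jump times accumulate before \<open>t\<close>, no stage covers \<open>t\<close> and the path is given the value
  \<open>z\<close>. For \<open>U\<close> of class \<open>C\<^sup>1\<close> this has probability zero: a bounce preserves the norm of the
  velocity, so the bounce rate stays bounded between two refreshments.
\<close>

definition bps ::
    "('a::euclidean_space \<Rightarrow> real) \<Rightarrow> real \<Rightarrow> ('a \<times> 'a \<Rightarrow> 'w \<Rightarrow> ennreal) \<Rightarrow> ('w \<Rightarrow> real) \<Rightarrow> ('w \<Rightarrow> 'a)
      \<Rightarrow> real \<Rightarrow> 'a \<times> 'a \<Rightarrow> 'w stream \<Rightarrow> 'a \<times> 'a" where
  "bps U \<alpha> T1 T2 \<xi> t z \<omega> =
     (if \<exists>n. t < fst (jump_chain U \<alpha> T1 T2 \<xi> z \<omega> (Suc n))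
      then let n = (LEAST n. t < fst (jump_chain U \<alpha> T1 T2 \<xi> z \<omega> (Suc n)));
               (s, y) = jump_chain U \<alpha> T1 T2 \<xi> z \<omega> n
           in flow (t - s) y
      else z)"

definition bps_semigroup ::
    "('a::euclidean_space \<Rightarrow> real) \<Rightarrow> real \<Rightarrow> 'w measure
      \<Rightarrow> ('a \<times> 'a \<Rightarrow> 'w \<Rightarrow> ennreal) \<Rightarrow> ('w \<Rightarrow> real) \<Rightarrow> ('w \<Rightarrow> 'a)
      \<Rightarrow> real \<Rightarrow> ('a \<times> 'a \<Rightarrow> real) \<Rightarrow> 'a \<times> 'a \<Rightarrow> real" where
  "bps_semigroup U \<alpha> N T1 T2 \<xi> t f z = (\<integral>\<omega>. f (bps U \<alpha> T1 T2 \<xi> t z \<omega>) \<partial>stream_space N)"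


section \<open>Existence of the driving randomness\<close>

text \<open>
  The assumptions of \<open>bps_stage\<close> can be met for every \<open>U\<close> of class \<open>C\<^sup>1\<close>: take \<open>T1 z\<close> to be the
  first time at which the integrated bounce rate along the flow from \<open>z\<close> exceeds a standard
  exponential variable.
\<close>

lemma GDERIV_nabla:
  assumes "U differentiable (at q)"
  shows "GDERIV U q :> nabla U q"
proof -
  let ?D = "frechet_derivative U (at q)"
  let ?g = "\<Sum>b\<in>Basis. ?D b *\<^sub>R b"
  have d: "(U has_derivative ?D) (at q)" using assms frechet_derivative_works by blast
  then interpret linear ?D using has_derivative_linear by blast
  have "?D h = h \<bullet> ?g" for h
  proof -
    have "?D h = ?D (\<Sum>b\<in>Basis. (h \<bullet> b) *\<^sub>R b)" by (simp add: euclidean_representation)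
    also have "\<dots> = (\<Sum>b\<in>Basis. (h \<bullet> b) * ?D b)" by (simp add: sum scale)
    finally show ?thesis by (simp add: inner_sum_right mult.commute)
  qed
  then have "?D = (\<lambda>h. h \<bullet> ?g)" by blast
  then have g: "GDERIV U q :> ?g" using d unfolding gderiv_def by argo
  have "D = ?g" if "GDERIV U q :> D" for D
  proof -
    have "(\<lambda>h. h \<bullet> D) = (\<lambda>h. h \<bullet> ?g)"
      using that g unfolding gderiv_def by (rule has_derivative_unique)
    then have "\<forall>h. h \<bullet> D = h \<bullet> ?g" by meson
    then have "b \<bullet> D = b \<bullet> ?g" for b by blast
    then have "D \<bullet> b = ?g \<bullet> b" for b by (subst (1 2) inner_commute)
    then show ?thesis by (rule euclidean_eqI)
  qed
  with g show ?thesis unfolding nabla_def by (rule theI)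
qed

lemma frechet_derivative_eq_nabla:
  assumes "U differentiable (at q)"
  shows "frechet_derivative U (at q) v = v \<bullet> nabla U q"
  using frechet_derivative_at[OF GDERIV_nabla[OF assms, unfolded gderiv_def]] by (metis (full_types))

lemma continuous_on_nabla:
  assumes "Ck 1 U" shows "continuous_on UNIV (nabla U)"
proof -
  have e: "nabla U = (\<lambda>q. \<Sum>b\<in>Basis. frechet_derivative U (at q) b *\<^sub>R b)"
  proof
    fix q
    have "U differentiable (at q)" using assms by simp
    then show "nabla U q = (\<Sum>b\<in>Basis. frechet_derivative U (at q) b *\<^sub>R b)"
      using euclidean_representation[of "nabla U q"]
      by (simp add: frechet_derivative_eq_nabla inner_commute[of _ "nabla U q"])
  qed
  show ?thesis unfolding e using assms by (intro continuous_intros) auto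
qed

lemma continuous_on_bounce_rate:
  assumes "Ck 1 U" shows "continuous_on UNIV (\<lambda>(z,s). bounce_rate U (flow s z))"
proof -
  have [continuous_intros]: "continuous_on S (\<lambda>x. nabla U (g x))" if "continuous_on S g" for S and g :: "('a\<times>'a)\<times>real \<Rightarrow> 'a"
    using continuous_on_compose2[OF continuous_on_nabla[OF assms] that] by auto
  show ?thesis unfolding bounce_rate_def flow_def split_def
    by (simp) (intro continuous_intros)
qed

lemma bps_stage_exists:
  fixes U :: "'a::euclidean_space \<Rightarrow> real"
  assumes U: "Ck 1 U" and r: "r > 0"
  shows "\<exists>(N :: (real \<times> real \<times> 'a) measure) T1 T2 \<xi>. bps_stage N U r T1 T2 \<xi>"
proof -
  define L where "L = (\<lambda>t z. \<integral>s. indicator {0..t} s * bounce_rate U (flow s z) \<partial>lborel)"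
  have c: "continuous_on S (\<lambda>s. bounce_rate U (flow s z))" for S z
  proof -
    have "continuous_on S (\<lambda>s. (\<lambda>(z,s). bounce_rate U (flow s z)) (z,s))"
      by (rule continuous_on_compose2[OF continuous_on_bounce_rate[OF U]]) (auto intro!: continuous_intros)
    then show ?thesis by simp
  qed
  have L: "L t z = integral {0..t} (\<lambda>s. bounce_rate U (flow s z))" for t z
    unfolding L_def
    using set_borel_integral_eq_integral(2)[OF borel_integrable_atLeastAtMost'[OF c, of 0 t z]]
    by (simp add: set_lebesgue_integral_def)
  have [measurable]: "(\<lambda>(z,s). bounce_rate U (flow s z)) \<in> borel_measurable (borel \<Otimes>\<^sub>M borel)"
    using borel_measurable_continuous_onI[OF continuous_on_bounce_rate[OF U]] by (simp add: borel_prod)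
  have Lm[measurable]: "L t \<in> borel_measurable borel" for t
    unfolding L_def by measurable
  have rate0: "0 \<le> bounce_rate U y" for y by (auto simp: bounce_rate_def split: prod.split)
  have L0: "0 \<le> L t z" for t z unfolding L
    by (intro Henstock_Kurzweil_Integration.integral_nonneg integrable_continuous_interval c rate0)
  have Lmono: "L s z \<le> L t z" if "s \<le> t" for s t z
    unfolding L using that by (intro integral_subset_le integrable_continuous_interval c) (auto intro: rate0)
  have Lcont: "continuous_on {0..t} (\<lambda>s. L s z)" for t z
    unfolding L by (intro indefinite_integral_continuous_1 integrable_continuous_interval c)
  define T1 where "T1 = (\<lambda>z (w::real \<times> real \<times> 'a). INF s\<in>{s\<in>\<rat>. 0 \<le> s}. if fst w < L s z then ennreal s else \<top>)"
  have key: "ennreal t \<le> T1 z (e,x) \<longleftrightarrow> L t z \<le> e" if t: "0 < t" for t z e x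
  proof
    assume h: "L t z \<le> e"
    show "ennreal t \<le> T1 z (e,x)" unfolding T1_def
    proof (intro INF_greatest)
      fix s :: real assume "s \<in> {s \<in> \<rat>. 0 \<le> s}"
      have "t \<le> s" if "e < L s z"
        using h that Lmono[of s t z] by (rule_tac ccontr) simp
      then show "ennreal t \<le> (if fst (e,x) < L s z then ennreal s else \<top>)"
        by (auto intro: ennreal_leI)
    qed
  next
    assume h: "ennreal t \<le> T1 z (e,x)"
    have "L s z \<le> e" if "s \<in> \<rat>" "0 \<le> s" "s < t" for s
    proof (rule ccontr)
      assume "\<not> L s z \<le> e"
      then have "T1 z (e,x) \<le> ennreal s" unfolding T1_def using that
        by (intro INF_lower2[of s]) auto
      then show False using h that by (meson ennreal_le_iff leD order_trans)
    qed note rat = this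
    have ub: "L s z \<le> e" if "0 \<le> s" "s < t" for s
      using Rats_dense_in_real[OF that(2)] rat Lmono[of s _ z] that order_trans less_imp_le by (smt (verit))
    show "L t z \<le> e"
    proof (rule continuous_le_on_closure[where S="{0..<t}" and f="\<lambda>s. L s z"])
      show "continuous_on (closure {0..<t}) (\<lambda>s. L s z)" using Lcont[of t z] t by simp
      show "t \<in> closure {0..<t}" using t by simp
      show "L s z \<le> e" if "s \<in> {0..<t}" for s using ub that by simp
    qed
  qed
  define E where "E = density lborel (\<lambda>x. ennreal (exponential_density 1 x))"
  define X where "X = density lborel (\<lambda>x. ennreal (exponential_density r x))"
  define G where "G = density lborel (\<lambda>x::'a. ennreal (exp (- (norm x)\<^sup>2 / 2) / sqrt (2 * pi) ^ DIM('a)))"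
  interpret E: prob_space E unfolding E_def by (rule prob_space_exponential_density) simp
  interpret X: prob_space X unfolding X_def by (rule prob_space_exponential_density) fact
  have dens: "exp (- (norm x)\<^sup>2 / 2) / sqrt (2 * pi) ^ DIM('a) = (\<Prod>b\<in>Basis. std_normal_density (x \<bullet> b))" for x :: 'a
  proof -
    have "(norm x)\<^sup>2 = (\<Sum>b\<in>Basis. (x \<bullet> b)\<^sup>2)"
      unfolding power2_norm_eq_inner by (subst euclidean_inner) (simp add: power2_eq_square)
    then show ?thesis
      by (simp add: std_normal_density_def prod_dividef exp_sum[symmetric] sum_divide_distrib sum_negf)
  qed
  interpret G: prob_space G
  proof
    have "emeasure G (space G) = (\<integral>\<^sup>+(x::'a). (\<Prod>b\<in>Basis. ennreal (std_normal_density (x \<bullet> b))) \<partial>lborel)"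
      unfolding G_def dens by (subst emeasure_density) (auto simp: prod_ennreal)
    also have "\<dots> = (\<Prod>b\<in>(Basis::'a set). (\<integral>\<^sup>+x. std_normal_density x \<partial>lborel))"
      by (rule nn_integral_lborel_prod) auto
    also have "\<dots> = 1"
      by (simp add: nn_integral_eq_integral)
    finally show "emeasure G (space G) = 1" .
  qed
  interpret XG: pair_prob_space X G ..
  interpret EXG: pair_prob_space E "X \<Otimes>\<^sub>M G" ..
  define N where "N = E \<Otimes>\<^sub>M X \<Otimes>\<^sub>M G"
  interpret N: prob_space N unfolding N_def by unfold_locales
  have [simp, measurable_cong]: "sets E = sets borel" "sets X = sets borel" "sets G = sets borel"
    by (simp_all add: E_def X_def G_def)
  have sp[simp]: "space E = UNIV" "space X = UNIV" "space G = UNIV"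
    by (simp_all add: E_def X_def G_def)
  have T1m: "(\<lambda>(z, w). T1 z w) \<in> borel_measurable (borel \<Otimes>\<^sub>M N)"
  proof -
    have "countable {s::real. s \<in> \<rat> \<and> 0 \<le> s}"
      by (rule countable_subset[OF _ countable_rat]) auto
    moreover have [measurable]: "fst \<in> borel_measurable N" unfolding N_def by simp
    ultimately show ?thesis unfolding T1_def split_def
      by (intro borel_measurable_INF) measurable
  qed
  have fstN: "distr N E fst = E"
    unfolding N_def by (rule XG.P.distr_pair_fst)
  have sndN: "distr N (X \<Otimes>\<^sub>M G) snd = X \<Otimes>\<^sub>M G"
  proof (rule measure_eqI)
    fix A assume "A \<in> sets (distr N (X \<Otimes>\<^sub>M G) snd)"
    then have A: "A \<in> sets (X \<Otimes>\<^sub>M G)" by simp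
    have "snd -` A \<inter> space N = space E \<times> A"
      using sets.sets_into_space[OF A] by (auto simp: N_def space_pair_measure)
    then show "emeasure (distr N (X \<Otimes>\<^sub>M G) snd) A = emeasure (X \<Otimes>\<^sub>M G) A"
      using A XG.P.emeasure_pair_measure_Times[of "space E" E A] E.emeasure_space_1
      by (simp add: emeasure_distr N_def)
  qed simp
  have fstS: "distr (X \<Otimes>\<^sub>M G) X fst = X"
    by (rule G.distr_pair_fst)
  have sndS: "distr (X \<Otimes>\<^sub>M G) G snd = G"
  proof (rule measure_eqI)
    fix A assume "A \<in> sets (distr (X \<Otimes>\<^sub>M G) G snd)"
    then have A: "A \<in> sets G" by simp
    have "snd -` A \<inter> space (X \<Otimes>\<^sub>M G) = space X \<times> A"
      by (auto simp: space_pair_measure)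
    then show "emeasure (distr (X \<Otimes>\<^sub>M G) G snd) A = emeasure G A"
      using A G.emeasure_pair_measure_Times[of "space X" X A] X.emeasure_space_1
      by (simp add: emeasure_distr)
  qed simp
  have N1[measurable]: "fst \<in> measurable N E" "snd \<in> measurable N (X \<Otimes>\<^sub>M G)" unfolding N_def by simp_all
  have T2d: "distr N X (\<lambda>w. fst (snd w)) = X"
    using distr_distr[OF measurable_fst N1(2)] unfolding sndN fstS by (simp add: comp_def)
  have T3d: "distr N G (\<lambda>w. snd (snd w)) = G"
    using distr_distr[OF measurable_snd N1(2)] unfolding sndN sndS by (simp add: comp_def)
  have Em: "E.prob {e\<in>space E. c \<le> e} = exp (- c)" if "0 \<le> c" for c
  proof -
    have "distributed E lborel (\<lambda>x. x) (exponential_density 1)"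
      unfolding distributed_def by (auto simp: E_def intro!: distr_id2)
    from E.exponential_distributedD_gt[OF this that] have "E.prob {e\<in>space E. c < e} = exp (- c)" by simp
    moreover have "E.prob {e\<in>space E. c \<le> e} = E.prob {e\<in>space E. c < e}"
    proof (rule E.finite_measure_eq_AE)
      show "AE x in E. (x \<in> {e \<in> space E. c \<le> e}) = (x \<in> {e \<in> space E. c < e})"
        unfolding E_def using AE_lborel_singleton[of c]
        by (subst AE_density) auto
    qed auto
    ultimately show ?thesis by simp
  qed
  have law: "N.prob {w \<in> space N. ennreal t \<le> T1 z w} = exp (- integral {0..t} (\<lambda>s. bounce_rate U (flow s z)))"
    if t: "0 \<le> t" for z t
  proof (cases "t = 0")
    case True then show ?thesis by (simp add: N.prob_space)
  next
    case False
    then have "0 < t" using t by simp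
    have "N.prob {w \<in> space N. ennreal t \<le> T1 z w} = N.prob {w\<in>space N. L t z \<le> fst w}"
      using key[OF \<open>0 < t\<close>, of z] by (intro arg_cong[where f=N.prob]) auto
    also have "\<dots> = measure (distr N E fst) {e. L t z \<le> e}"
      by (subst measure_distr) (auto intro!: arg_cong[where f=N.prob])
    also have "\<dots> = E.prob {e\<in>space E. L t z \<le> e}" by (simp add: fstN)
    also have "\<dots> = exp (- L t z)"
      by (rule Em[OF L0])
    finally show ?thesis by (simp add: L)
  qed
  have "bps_stage N U r T1 (\<lambda>w. fst (snd w)) (\<lambda>w. snd (snd w))"
  proof (unfold_locales)
    fix z
    let ?\<tau> = "\<lambda>e. T1 z (e, undefined)"
    have e: "T1 z w = ?\<tau> (fst w)" for w by (simp add: T1_def)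
    have tm: "?\<tau> \<in> borel_measurable E"
    proof -
      have "countable {s::real. s \<in> \<rat> \<and> 0 \<le> s}"
        by (rule countable_subset[OF _ countable_rat]) auto
      then show ?thesis unfolding T1_def fst_conv
        by (intro borel_measurable_INF measurable_If) (auto simp: pred_def)
    qed
    have 1: "distr N borel (T1 z) = distr E borel ?\<tau>"
      using distr_distr[OF tm N1(1)] unfolding fstN e[abs_def, symmetric] by (simp add: comp_def e[symmetric])
    have 2: "distr N borel (\<lambda>w. fst (snd w)) = X" using T2d by (simp cong: distr_cong)
    have 3: "distr N borel (\<lambda>w. snd (snd w)) = G" using T3d by (simp cong: distr_cong)
    have "distr E borel ?\<tau> \<Otimes>\<^sub>M distr (X \<Otimes>\<^sub>M G) (borel \<Otimes>\<^sub>M borel) (\<lambda>x. x) = distr N (borel \<Otimes>\<^sub>M borel \<Otimes>\<^sub>M borel) (\<lambda>(a,b). (?\<tau> a, b))"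
      unfolding N_def
      by (intro pair_measure_distr tm prob_space_imp_sigma_finite XG.P.prob_space_distr) measurable
    then show "distr N (borel \<Otimes>\<^sub>M borel \<Otimes>\<^sub>M borel) (\<lambda>w. (T1 z w, fst (snd w), snd (snd w))) =
          distr N borel (T1 z) \<Otimes>\<^sub>M distr N borel (\<lambda>w. fst (snd w)) \<Otimes>\<^sub>M distr N borel (\<lambda>w. snd (snd w))"
      unfolding 1 2 3 by (simp add: split_def e[symmetric] distr_id2)
  next
    show "distributed N lborel (\<lambda>w. fst (snd w)) (\<lambda>x. ennreal (exponential_density r x))"
      using T2d unfolding distributed_def X_def by (auto simp: N_def cong: distr_cong)
    show "distributed N lborel (\<lambda>w. snd (snd w)) (\<lambda>x. ennreal (exp (- (norm x)\<^sup>2 / 2) / sqrt (2 * pi) ^ DIM('a)))"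
      using T3d unfolding distributed_def G_def by (auto simp: N_def cong: distr_cong)
  qed (fact T1m law)+
  then show ?thesis by blast
qed

end

theory Submission
  imports Defs
begin

text \<open>
  Let \<open>\<phi>\<close> be the flow, \<open>S\<^sub>t z\<close> the probability that neither clock rings before \<open>t\<close>, and
  \<open>J g = \<lambda> \<cdot> (g \<circ> bounce) + r \<cdot> (mean of g over a refreshment)\<close>. Conditioning on the first stage gives
  the renewal equation
    \<open>P\<^sub>t f z = S\<^sub>t z \<cdot> f (\<phi>\<^sub>t z) + \<integral>\<^sub>0\<^sup>t S\<^sub>s z \<cdot> (J (P\<^sub>t\<^sub>-\<^sub>s f)) (\<phi>\<^sub>s z) ds\<close>,
  and iterating it from zero produces the contributions of the paths with fewer than \<open>n\<close> jumps
  (\<open>expectation_few_jumps\<close>). The function \<open>1 + \<bar>q\<bar> + \<bar>p\<bar>\<close> is invariant under bounces, and the flow and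
  the refreshments change it by controlled factors. As a Lyapunov function it excludes explosion
  (\<open>tail_tendsto_0\<close>), because the rates are bounded where it is bounded; its inverse, which is also
  preserved up to a factor since \<open>\<alpha> > 0\<close>, dominates \<open>P\<^sub>t f\<close> at infinity for \<open>f\<close> of compact support
  (\<open>iter_decay\<close>). The iterates are
  continuous although bounces are not, because the bounce rate vanishes where the reflection is
  discontinuous. Hence \<open>P\<^sub>t\<close> preserves \<open>C\<^sub>0\<close>, and \<open>P\<^sub>t f\<close> is the only bounded continuous solution of
  the renewal equation (\<open>subsolution_zero\<close>).

  For a test function \<open>f\<close> and the explicit operator \<open>gen f = p \<cdot> \<nabla>\<^sub>q f + J f - (\<lambda> + r) f\<close>, the function
  \<open>f + \<integral>\<^sub>0\<^sup>t P\<^sub>s (gen f) ds\<close> solves the same renewal equation as \<open>P\<^sub>t f\<close>. This is Dynkin's formula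
  (\<open>dynkin\<close>); it gives strong continuity and identifies the generator on test functions.

  Since \<open>P\<^sub>t\<close> is a contraction, the generator is dissipative (\<open>dissipative\<close>), so test functions form
  a core as soon as \<open>(1 - gen) f\<close>, for \<open>f\<close> a test function, ranges over a dense subset of \<open>C\<^sub>0\<close>
  (\<open>gen_range_dense\<close>). As \<open>U\<close> is only of class \<open>C\<^sup>1\<close>, the semigroup need not preserve smoothness,
  and density is obtained by perturbation instead. Free transport has a resolvent that
  preserves test functions up to a truncation. Bounded perturbations preserve density of the
  range (\<open>dense_range_perturbation\<close>), which allows bounces with a cut-off rate. The cutoff is then
  removed with functions of \<open>\<bar>q\<bar>\<close> and \<open>\<bar>p\<bar>\<close> that commute with bounces and vary slowly along the flow
  (\<open>bounce_range_dense\<close>). Refreshments are one more bounded perturbation.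
\<close>

section \<open>Calculus of smooth functions\<close>

lemma Ck_SucI:
  assumes "\<And>x. (f has_derivative f' x) (at x)" and "\<And>v. Ck k (\<lambda>x. f' x v)"
  shows "Ck (Suc k) f"
proof -
  have "frechet_derivative f (at x) = f' x" for x
    using frechet_derivative_at[OF assms(1)] by simp
  then show ?thesis using assms by (auto simp: differentiable_def)
qed

lemma Ck_SucD:
  assumes "Ck (Suc k) f"
  shows "(f has_derivative frechet_derivative f (at x)) (at x)"
    and "Ck k (\<lambda>x. frechet_derivative f (at x) v)"
  using assms by (auto simp: frechet_derivative_works)

lemma Ck_lower: "Ck (Suc k) f \<Longrightarrow> Ck k f"
proof (induction k arbitrary: f)
  case 0
  then show ?case
    by (auto intro!: continuous_at_imp_continuous_on differentiable_imp_continuous_within)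
qed auto

lemma Ck_continuous: "Ck k f \<Longrightarrow> continuous_on UNIV f"
proof (induction k)
  case (Suc k)
  then show ?case using Ck_lower by blast
qed simp

lemma Ck_const: "Ck k (\<lambda>x. c)"
proof (induction k arbitrary: c)
  case (Suc k)
  show ?case by (rule Ck_SucI[where f'="\<lambda>_ _. 0"]) (auto intro: Suc)
qed simp

lemma Ck_bounded_linear:
  assumes "bounded_linear f" shows "Ck k f"
proof (cases k)
  case 0
  then show ?thesis using assms by (simp add: linear_continuous_on)
next
  case (Suc j)
  show ?thesis unfolding Suc
    by (rule Ck_SucI[where f'="\<lambda>_. f"])
      (auto intro: Ck_const bounded_linear_imp_has_derivative assms)
qed

lemma Ck_add: "Ck k f \<Longrightarrow> Ck k g \<Longrightarrow> Ck k (\<lambda>x. f x + g x)"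
proof (induction k arbitrary: f g)
  case 0
  then show ?case by (auto intro: continuous_intros)
next
  case (Suc k)
  show ?case
    by (rule Ck_SucI[OF has_derivative_add[OF Ck_SucD(1)[OF Suc.prems(1)] Ck_SucD(1)[OF Suc.prems(2)]]])
      (intro Suc.IH Ck_SucD(2) Suc.prems)
qed

lemma Ck_mult: "Ck k f \<Longrightarrow> Ck k g \<Longrightarrow> Ck k (\<lambda>x. f x * g x)"
proof (induction k arbitrary: f g)
  case 0
  then show ?case by (auto intro: continuous_intros)
next
  case (Suc k)
  show ?case
    by (rule Ck_SucI[OF has_derivative_mult[OF Ck_SucD(1)[OF Suc.prems(1)] Ck_SucD(1)[OF Suc.prems(2)]]])
      (intro Ck_add Suc.IH Ck_SucD(2)[OF Suc.prems(1)] Ck_SucD(2)[OF Suc.prems(2)]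
        Ck_lower[OF Suc.prems(1)] Ck_lower[OF Suc.prems(2)])
qed

lemma Ck_cmult: "Ck k f \<Longrightarrow> Ck k (\<lambda>x. c * f x)"
  by (rule Ck_mult[OF Ck_const])

lemma Ck_diff: "Ck k f \<Longrightarrow> Ck k g \<Longrightarrow> Ck k (\<lambda>x. f x - g x)"
  using Ck_add[of k f "\<lambda>x. (-1) * g x"] Ck_cmult[of k g "-1"] by simp

lemma Ck_sum: "(\<And>i. i \<in> I \<Longrightarrow> Ck k (f i)) \<Longrightarrow> Ck k (\<lambda>x. \<Sum>i\<in>I. f i x)"
  by (induction I rule: infinite_finite_induct) (auto intro: Ck_const Ck_add)

lemma Ck_real_polynomial_function: "real_polynomial_function f \<Longrightarrow> Ck k f"
  by (induction rule: real_polynomial_function.induct)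
    (auto intro: Ck_bounded_linear Ck_const Ck_add Ck_mult)

lemma Ck_norm_square:
  fixes g :: "'b::euclidean_space \<Rightarrow> 'c::euclidean_space"
  assumes "bounded_linear g"
  shows "Ck k (\<lambda>x. (norm (g x))\<^sup>2)"
proof -
  have "(\<lambda>x. (norm (g x))\<^sup>2) = (\<lambda>x. \<Sum>b\<in>Basis. (g x \<bullet> b) * (g x \<bullet> b))"
    by (auto simp: power2_norm_eq_inner euclidean_inner[of "g _" "g _"])
  moreover have "Ck k (\<lambda>x. g x \<bullet> b)" for b
    by (rule Ck_bounded_linear)
      (rule bounded_linear_compose[OF bounded_linear_inner_left assms])
  ultimately show ?thesis by (simp add: Ck_sum Ck_mult)
qed

text \<open>
  The family \<open>x\<^sup>-\<^sup>n exp (-1/x)\<close>, extended by zero, is closed under differentiation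
  up to linear combinations; that makes every member smooth, including at the origin.
\<close>

definition flat_exp :: "nat \<Rightarrow> real \<Rightarrow> real" where
  "flat_exp n x = (if x \<le> 0 then 0 else exp (- inverse x) * inverse x ^ n)"

lemma flat_exp_tendsto_0: "(flat_exp n \<longlongrightarrow> 0) (at_right 0)"
proof -
  have "((\<lambda>x. x ^ n / exp x) \<longlongrightarrow> (0::real)) at_top"
    by (rule tendsto_power_div_exp_0)
  then have "((\<lambda>x. inverse x ^ n / exp (inverse x)) \<longlongrightarrow> (0::real)) (at_right 0)"
    by (rule filterlim_compose[OF _ filterlim_inverse_at_top_right])
  then show ?thesis
    by (rule Lim_transform_eventually)
      (auto simp: flat_exp_def eventually_at_right_less exp_minus field_simps
        intro!: eventually_at_rightI[of 0 1])
qed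

lemma has_derivative_flat_exp:
  "(flat_exp n has_real_derivative (flat_exp (n+2) x - of_nat n * flat_exp (Suc n) x)) (at x)"
proof (cases "x = 0")
  case True
  have "((\<lambda>y. (flat_exp n y - flat_exp n 0) / (y - 0)) \<longlongrightarrow> 0) (at 0)"
  proof (subst filterlim_at_split, intro conjI)
    show "((\<lambda>y. (flat_exp n y - flat_exp n 0) / (y - 0)) \<longlongrightarrow> 0) (at_left 0)"
      by (rule Lim_transform_eventually[OF tendsto_const])
        (auto simp: flat_exp_def intro!: eventually_at_leftI[of "-1"])
    show "((\<lambda>y. (flat_exp n y - flat_exp n 0) / (y - 0)) \<longlongrightarrow> 0) (at_right 0)"
      by (rule Lim_transform_eventually[OF flat_exp_tendsto_0[of "Suc n"]])
        (auto simp: flat_exp_def field_simps intro!: eventually_at_rightI[of 0 1])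
  qed
  then show ?thesis using True
    by (simp add: has_field_derivative_iff flat_exp_def)
next
  case False
  show ?thesis
  proof (cases "x < 0")
    case True
    have "((\<lambda>_. 0) has_real_derivative (flat_exp (n+2) x - of_nat n * flat_exp (Suc n) x)) (at x)"
      using True by (auto simp: flat_exp_def)
    moreover have "\<forall>\<^sub>F y in nhds x. flat_exp n y = 0"
      using True by (auto simp: flat_exp_def eventually_nhds intro!: exI[of _ "{..<0}"])
    ultimately show ?thesis by (subst DERIV_cong_ev[OF refl _ refl])
  next
    case neg: False
    with False have x: "0 < x" by simp
    have "((\<lambda>y. exp (- inverse y) * inverse y ^ n) has_real_derivative
        (flat_exp (n+2) x - of_nat n * flat_exp (Suc n) x)) (at x)"
      using x
      by (auto intro!: derivative_eq_intros simp: flat_exp_def power2_eq_square)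
        (cases n; simp add: field_simps power2_eq_square)
    moreover have "\<forall>\<^sub>F y in nhds x. flat_exp n y = exp (- inverse y) * inverse y ^ n"
      using x by (auto simp: flat_exp_def eventually_nhds intro!: exI[of _ "{0<..}"])
    ultimately show ?thesis by (subst DERIV_cong_ev[OF refl _ refl])
  qed
qed

lemma has_derivative_real_compose:
  assumes "(\<phi> has_real_derivative d) (at (f x))" and "(f has_derivative f') (at x)"
  shows "((\<lambda>x. \<phi> (f x)) has_derivative (\<lambda>v. d * f' v)) (at x)"
  using has_derivative_compose[OF assms(2) assms(1)[unfolded has_field_derivative_def]] .

lemma Ck_flat_exp: "Ck k f \<Longrightarrow> Ck k (\<lambda>x. flat_exp n (f x))"
proof (induction k arbitrary: n)
  case 0
  have "continuous_on UNIV (flat_exp n)"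
    by (rule DERIV_continuous_on[OF has_field_derivative_at_within[OF has_derivative_flat_exp]])
  then show ?case using 0 continuous_on_compose2[of UNIV "flat_exp n" UNIV f] by simp
next
  case (Suc k)
  show ?case
    by (rule Ck_SucI[OF has_derivative_real_compose[where \<phi>="flat_exp n" and f=f, OF has_derivative_flat_exp Ck_SucD(1)[OF Suc.prems]]])
      (intro Ck_mult Ck_diff Ck_const Suc.IH Ck_SucD(2)[OF Suc.prems] Ck_lower[OF Suc.prems])
qed

definition bump :: "real \<Rightarrow> real" where
  "bump x = flat_exp 0 x * flat_exp 0 (1 - x)"

lemma bump_bounds: "0 \<le> bump x" "bump x \<le> 1"
  by (auto simp: bump_def flat_exp_def intro!: mult_le_one)

lemma bump_pos: "0 < x \<Longrightarrow> x < 1 \<Longrightarrow> 0 < bump x"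
  by (simp add: bump_def flat_exp_def)

lemma bump_eq_0: "x \<le> 0 \<or> 1 \<le> x \<Longrightarrow> bump x = 0"
  by (auto simp: bump_def flat_exp_def)

lemma Ck_bump: "Ck k f \<Longrightarrow> Ck k (\<lambda>x. bump (f x))"
  unfolding bump_def by (intro Ck_mult Ck_flat_exp Ck_diff Ck_const)

lemma continuous_on_bump: "continuous_on S bump"
  using Ck_continuous[OF Ck_bump[OF Ck_bounded_linear[OF bounded_linear_ident], of 0]]
    continuous_on_subset by blast

definition bump_mass :: real where
  "bump_mass = integral {0..1} bump"

lemma bump_mass_pos: "0 < bump_mass"
proof -
  have "bump_mass \<noteq> 0"
  proof
    assume "bump_mass = 0"
    then have "\<forall>x\<in>{0..1}. bump x = 0"
      unfolding bump_mass_def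
      by (subst (asm) integral_eq_0_iff) (auto intro: continuous_on_bump bump_bounds)
    then show False using bump_pos[of "1/2"] by force
  qed
  moreover have "0 \<le> bump_mass"
    unfolding bump_mass_def
    by (intro Henstock_Kurzweil_Integration.integral_nonneg integrable_continuous_interval
        continuous_on_bump bump_bounds)
  ultimately show ?thesis by simp
qed

text \<open>
  A smooth step, \<open>0\<close> on the negative half-line and \<open>1\<close> to the right of \<open>1\<close>: the normalized primitive
  of a bump supported in \<open>[0, 1]\<close>, so that its derivatives are those of the bump.
\<close>

definition step :: "real \<Rightarrow> real" where
  "step x = integral {-1..x} bump / bump_mass"

lemma integral_bump_nonpos: "y \<le> 0 \<Longrightarrow> integral {-1..y} bump = 0"
  using integral_cong[of "{-1..y}" bump "\<lambda>_. 0"] by (auto simp: bump_eq_0)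

lemma step_derivative: "(step has_real_derivative (bump x / bump_mass)) (at x)"
proof (cases "x > -1")
  case True
  have "((\<lambda>y. integral {-1..y} bump) has_real_derivative bump x) (at x within {-1..x+1})"
    using True by (intro integral_has_real_derivative continuous_on_bump) auto
  moreover have "at x within {-1..x+1} = at x"
    using True by (intro at_within_interior) auto
  ultimately show ?thesis unfolding step_def
    using DERIV_cdivide[of "\<lambda>y. integral {-1..y} bump" "bump x" x UNIV bump_mass] by simp
next
  case False
  then have x: "x < 0" by simp
  have "((\<lambda>_. 0) has_real_derivative (bump x / bump_mass)) (at x)"
    using x by (simp add: bump_eq_0)
  moreover have "\<forall>\<^sub>F y in nhds x. step y = 0"
    using x integral_bump_nonpos by (auto simp: step_def eventually_nhds intro!: exI[of _ "{..<0}"])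
  ultimately show ?thesis by (subst DERIV_cong_ev[OF refl _ refl])
qed

lemma Ck_step: "Ck k f \<Longrightarrow> Ck k (\<lambda>x. step (f x))"
proof (cases k)
  case 0
  assume f: "Ck k f"
  have "continuous_on UNIV step"
    by (rule DERIV_continuous_on[OF has_field_derivative_at_within[OF step_derivative]])
  then show ?thesis using 0 f continuous_on_compose2[of UNIV step UNIV f] by simp
next
  case (Suc j)
  assume "Ck k f"
  then have f: "Ck (Suc j) f" by (simp only: Suc)
  show ?thesis unfolding Suc
    by (rule Ck_SucI[OF has_derivative_real_compose[where \<phi>=step and f=f, OF step_derivative Ck_SucD(1)[OF f]]])
      (simp only: divide_inverse, intro Ck_mult Ck_const Ck_bump Ck_SucD(2)[OF f] Ck_lower[OF f])
qed

lemma step_eq_0: "x \<le> 0 \<Longrightarrow> step x = 0"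
  unfolding step_def by (simp add: integral_bump_nonpos)

lemma step_eq_1: assumes "1 \<le> x" shows "step x = 1"
proof -
  have c: "integral {a..b} bump + integral {b..c} bump = integral {a..c} bump" if "a \<le> b" "b \<le> c" for a b c
    using that integrable_continuous_interval[OF continuous_on_bump, of a c]
    by (intro Henstock_Kurzweil_Integration.integral_combine) auto
  have "integral {1..x} bump = integral {1..x} (\<lambda>_. 0)"
    by (intro integral_cong) (auto simp: bump_eq_0)
  then have "integral {1..x} bump = 0" by simp
  moreover have "integral {-1..0} bump = 0" by (rule integral_bump_nonpos) simp
  ultimately have "integral {-1..x} bump = integral {0..1} bump"
    using c[of "-1" 0 x] c[of 0 1 x] assms by linarith
  then show ?thesis using bump_mass_pos by (simp add: step_def bump_mass_def)
qed

lemma step_mono: "x \<le> y \<Longrightarrow> step x \<le> step y"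
  using step_derivative bump_bounds bump_mass_pos
  by (intro DERIV_nonneg_imp_nondecreasing[of x y step]) (auto intro!: divide_nonneg_pos)

lemma step_bounds: "0 \<le> step x" "step x \<le> 1"
  using step_mono[of "min 0 x" x] step_mono[of x "max 1 x"] step_eq_0[of "min 0 x"] step_eq_1[of "max 1 x"]
  by auto

text \<open>
  A radial function, so that a cutoff in the velocity is invariant under bounces. The square
  keeps it smooth at the origin.
\<close>

definition cutoff :: "real \<Rightarrow> 'b::euclidean_space \<Rightarrow> real" where
  "cutoff \<rho> x = step (2 - (norm x)\<^sup>2 / \<rho>\<^sup>2)"

lemma cutoff_bounds: "0 \<le> cutoff \<rho> x" "cutoff \<rho> x \<le> 1"
  by (simp_all add: cutoff_def step_bounds)

lemma Ck_cutoff: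
  fixes g :: "'b::euclidean_space \<Rightarrow> 'c::euclidean_space"
  assumes "bounded_linear g" shows "Ck k (\<lambda>x. cutoff \<rho> (g x))"
  unfolding cutoff_def divide_inverse
  by (intro Ck_step Ck_diff Ck_const Ck_mult Ck_norm_square assms)

lemma cutoff_eq_1: "0 < \<rho> \<Longrightarrow> norm x \<le> \<rho> \<Longrightarrow> cutoff \<rho> x = 1"
  unfolding cutoff_def by (rule step_eq_1) (simp add: power_mono)

lemma cutoff_eq_0: assumes "0 < \<rho>" "2 * \<rho> \<le> norm x" shows "cutoff \<rho> x = 0"
  unfolding cutoff_def
proof (rule step_eq_0)
  have "(2*\<rho>)\<^sup>2 \<le> (norm x)\<^sup>2" using assms by (intro power_mono) auto
  moreover have "2 * \<rho>\<^sup>2 \<le> (2*\<rho>)\<^sup>2" by (simp add: power_mult_distrib)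
  ultimately have "2 * \<rho>\<^sup>2 \<le> (norm x)\<^sup>2" by linarith
  then show "2 - (norm x)\<^sup>2 / \<rho>\<^sup>2 \<le> 0" using assms by (simp add: field_simps)
qed

section \<open>Test functions are dense in \<open>C\<^sub>0\<close>\<close>

lemma Cc_infinityI:
  assumes "\<And>k. Ck k f" and "\<And>x. R \<le> norm x \<Longrightarrow> f x = 0"
  shows "f \<in> Cc_infinity"
proof -
  have "{x. f x \<noteq> 0} \<subseteq> ball 0 R" using assms(2) by (force simp: not_le[symmetric])
  then show ?thesis using assms(1) bounded_subset[OF bounded_ball]
    by (auto simp: Cc_infinity_def)
qed

lemma Cc_infinity_Ck: "f \<in> Cc_infinity \<Longrightarrow> Ck k f"
  by (simp add: Cc_infinity_def)

lemma Cc_infinity_support: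
  assumes "f \<in> Cc_infinity"
  obtains R where "0 < R" "\<And>x. R \<le> norm x \<Longrightarrow> f x = 0"
proof -
  have "bounded {x. f x \<noteq> 0}"
    using assms compact_imp_bounded closure_subset bounded_subset
    by (fastforce simp: Cc_infinity_def)
  then obtain B where "0 < B" "\<forall>x\<in>{x. f x \<noteq> 0}. norm x \<le> B" by (auto simp: bounded_pos)
  then show thesis by (intro that[of "B + 1"]) force+
qed

lemma Cc_infinity_add:
  assumes "f \<in> Cc_infinity" "g \<in> Cc_infinity"
  shows "(\<lambda>x. f x + g x) \<in> Cc_infinity"
proof -
  obtain R R' where "\<And>x. R \<le> norm x \<Longrightarrow> f x = 0" "\<And>x. R' \<le> norm x \<Longrightarrow> g x = 0"
    using assms Cc_infinity_support by metis
  then show ?thesis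
    by (intro Cc_infinityI[of _ "max R R'"] Ck_add Cc_infinity_Ck[OF assms(1)] Cc_infinity_Ck[OF assms(2)]) auto
qed

lemma Cc_infinity_mult:
  assumes "f \<in> Cc_infinity" "\<And>k. Ck k g"
  shows "(\<lambda>x. g x * f x) \<in> Cc_infinity"
proof -
  obtain R where "\<And>x. R \<le> norm x \<Longrightarrow> f x = 0"
    using assms Cc_infinity_support by metis
  then show ?thesis
    by (intro Cc_infinityI[of _ R] Ck_mult Cc_infinity_Ck[OF assms(1)] assms(2)) auto
qed

lemma C0I:
  assumes "continuous_on UNIV f" "\<And>x. R \<le> norm x \<Longrightarrow> f x = 0"
  shows "f \<in> C0"
proof -
  have "(f \<longlongrightarrow> 0) at_infinity"
    by (rule Lim_transform_eventually[OF tendsto_const])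
      (auto simp: eventually_at_infinity assms intro!: exI[of _ R])
  with assms show ?thesis by (simp add: C0_def)
qed

lemma Cc_infinity_C0: assumes "f \<in> Cc_infinity" shows "f \<in> C0"
  using assms by (metis C0I Cc_infinity_Ck Cc_infinity_support Ck_continuous)

lemma C0_continuous: "f \<in> C0 \<Longrightarrow> continuous_on UNIV f"
  by (simp add: C0_def)

lemma C0_small_outside:
  assumes "f \<in> C0" "0 < \<epsilon>"
  obtains R where "0 < R" "\<And>x. R \<le> norm x \<Longrightarrow> \<bar>f x\<bar> < \<epsilon>"
proof -
  have "\<forall>\<^sub>F x in at_infinity. dist (f x) 0 < \<epsilon>" using assms tendstoD unfolding C0_def by blast
  then obtain R where "\<And>x. R \<le> norm x \<Longrightarrow> \<bar>f x\<bar> < \<epsilon>"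
    by (auto simp: eventually_at_infinity)
  then show thesis by (intro that[of "max R 1"]) auto
qed

lemma C0_bounded:
  fixes f :: "'b::euclidean_space \<Rightarrow> real"
  assumes "f \<in> C0"
  obtains M where "0 < M" "\<And>x. \<bar>f x\<bar> \<le> M"
proof -
  obtain R where R: "0 < R" "\<And>x. R \<le> norm x \<Longrightarrow> \<bar>f x\<bar> < 1"
    using C0_small_outside[OF assms, of 1] by auto
  have "compact (f ` cball 0 R)"
    by (intro compact_continuous_image continuous_on_subset[OF C0_continuous[OF assms]]) auto
  then obtain B where "\<And>x. norm x \<le> R \<Longrightarrow> \<bar>f x\<bar> \<le> B"
    using compact_imp_bounded[of "f ` cball 0 R"] unfolding bounded_iff by (fastforce simp: mem_cball)
  moreover have "\<bar>f x\<bar> \<le> 1" if "\<not> norm x \<le> R" for x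
    using R(2)[of x] that by simp
  ultimately show thesis by (intro that[of "max B 1"]) (auto simp: le_max_iff_disj)
qed

lemma C0_add: "f \<in> C0 \<Longrightarrow> g \<in> C0 \<Longrightarrow> (\<lambda>x. f x + g x) \<in> C0"
  using tendsto_add_zero by (auto simp: C0_def intro: continuous_intros)

lemma C0_cmult: "f \<in> C0 \<Longrightarrow> (\<lambda>x. c * f x) \<in> C0"
  using tendsto_mult_right_zero by (auto simp: C0_def intro: continuous_intros)

lemma C0_diff: "f \<in> C0 \<Longrightarrow> g \<in> C0 \<Longrightarrow> (\<lambda>x. f x - g x) \<in> C0"
  using C0_add[OF _ C0_cmult[of g "-1"], of f] by simp

lemma C0_closed:
  assumes "\<And>\<epsilon>. 0 < \<epsilon> \<Longrightarrow> \<exists>h\<in>C0. \<forall>x. \<bar>f x - h x\<bar> \<le> \<epsilon>"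
  shows "f \<in> C0"
proof -
  have "\<exists>h\<in>C0. \<forall>x. \<bar>f x - h x\<bar> \<le> inverse (real (Suc n))" for n
    using assms by simp
  then obtain h where h: "\<And>n. h n \<in> C0" "\<And>n x. \<bar>f x - h n x\<bar> \<le> inverse (real (Suc n))"
    by metis
  have "uniform_limit UNIV h f sequentially"
  proof (rule uniform_limitI)
    fix e :: real assume "0 < e"
    then have "\<forall>\<^sub>F n in sequentially. inverse (real (Suc n)) < e"
      using LIMSEQ_inverse_real_of_nat order_tendstoD(2) by blast
    then show "\<forall>\<^sub>F n in sequentially. \<forall>x\<in>UNIV. dist (h n x) (f x) < e"
      by eventually_elim (use h(2) in \<open>auto simp: dist_real_def abs_minus_commute intro: le_less_trans\<close>)
  qed
  then have "continuous_on UNIV f"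
    by (rule uniform_limit_theorem[rotated]) (auto simp: h C0_continuous)
  moreover have "(f \<longlongrightarrow> 0) at_infinity"
  proof (rule tendstoI)
    fix e :: real assume e: "0 < e"
    then obtain g where g: "g \<in> C0" "\<And>x. \<bar>f x - g x\<bar> \<le> e / 2" using assms[of "e/2"] by auto
    obtain R where "\<And>x. R \<le> norm x \<Longrightarrow> \<bar>g x\<bar> < e / 2"
      using C0_small_outside[OF g(1), of "e/2"] e by auto
    note R = this
    have "dist (f x) 0 < e" if "R \<le> norm x" for x
      using g(2)[of x] R[OF that] unfolding dist_real_def by linarith
    then show "\<forall>\<^sub>F x in at_infinity. dist (f x) 0 < e"
      by (auto simp: eventually_at_infinity)
  qed
  ultimately show ?thesis by (simp add: C0_def)
qed

text \<open>
  A polynomial that approximates on a large ball, multiplied by a smooth cutoff.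
\<close>

lemma Cc_infinity_dense:
  fixes g :: "'b::euclidean_space \<Rightarrow> real"
  assumes "g \<in> C0" "0 < \<epsilon>"
  obtains f where "f \<in> Cc_infinity" "\<And>x. \<bar>f x - g x\<bar> \<le> \<epsilon>"
proof -
  obtain R where R: "0 < R" "\<And>x. R \<le> norm x \<Longrightarrow> \<bar>g x\<bar> < \<epsilon>/2"
    using C0_small_outside[OF assms(1), of "\<epsilon>/2"] assms(2) by auto
  obtain P where P: "real_polynomial_function P" "\<And>x. x \<in> cball 0 (2*R) \<Longrightarrow> \<bar>g x - P x\<bar> < \<epsilon>/2"
    using Stone_Weierstrass_real_polynomial_function[of "cball 0 (2*R)" g "\<epsilon>/2"]
      continuous_on_subset[OF C0_continuous[OF assms(1)]] assms(2) by auto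
  let ?f = "\<lambda>x. cutoff R x * P x"
  show thesis
  proof
    show "?f \<in> Cc_infinity"
      by (rule Cc_infinityI[of _ "2*R"])
        (use R in \<open>auto intro!: Ck_mult Ck_cutoff bounded_linear_ident
          Ck_real_polynomial_function[OF P(1)] simp: cutoff_eq_0\<close>)
    fix x
    show "\<bar>?f x - g x\<bar> \<le> \<epsilon>"
    proof (cases "2 * R \<le> norm x")
      case True
      then show ?thesis using R(2)[of x] R(1) assms(2) by (simp add: cutoff_eq_0)
    next
      case False
      have "\<bar>(1 - cutoff R x) * g x\<bar> \<le> \<epsilon>/2"
      proof (cases "norm x \<le> R")
        case True
        then show ?thesis using R assms(2) by (simp add: cutoff_eq_1)
      next
        case False
        have "\<bar>1 - cutoff R x\<bar> * \<bar>g x\<bar> \<le> 1 * \<bar>g x\<bar>"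
          using cutoff_bounds[of R x] by (intro mult_right_mono) auto
        then show ?thesis using R(2)[of x] False by (simp add: abs_mult)
      qed
      moreover have "\<bar>cutoff R x * (P x - g x)\<bar> \<le> \<epsilon>/2"
      proof -
        have "\<bar>cutoff R x\<bar> * \<bar>P x - g x\<bar> \<le> 1 * \<bar>P x - g x\<bar>"
          using cutoff_bounds[of R x] by (intro mult_right_mono) auto
        moreover have "\<bar>P x - g x\<bar> < \<epsilon>/2" using P(2)[of x] False by (simp add: abs_minus_commute)
        ultimately show ?thesis by (simp add: abs_mult)
      qed
      moreover have "?f x - g x = cutoff R x * (P x - g x) - (1 - cutoff R x) * g x"
        by (simp add: algebra_simps)
      ultimately show ?thesis by linarith
    qed
  qed
qed

section \<open>Free transport\<close>

lemma flow_Pair [simp]: "flow t (q, p) = (q + t *\<^sub>R p, p)"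
  by (simp add: flow_def)

lemma flow_eq: "flow t z = (fst z + t *\<^sub>R snd z, snd z)"
  by (cases z) simp

lemma fst_flow: "fst (flow t z) = fst z + t *\<^sub>R snd z" and snd_flow [simp]: "snd (flow t z) = snd z"
  by (simp_all add: flow_eq)

lemma flow_0 [simp]: "flow 0 z = z"
  by (simp add: flow_eq)

lemma flow_flow: "flow s (flow t z) = flow (s + t) z"
  by (simp add: flow_eq algebra_simps)

lemma continuous_on_flow [continuous_intros]:
  "continuous_on S g \<Longrightarrow> continuous_on S h \<Longrightarrow> continuous_on S (\<lambda>x. flow (g x) (h x))"
  unfolding flow_eq by (intro continuous_intros)

lemma bounded_linear_flow: "bounded_linear (flow t)"
proof -
  have "bounded_linear (\<lambda>z::'a::euclidean_space \<times> 'a. (fst z + t *\<^sub>R snd z, snd z))"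
    by (intro bounded_linear_Pair bounded_linear_add bounded_linear_fst bounded_linear_snd
        bounded_linear_const_scaleR)
  then show ?thesis by (simp add: flow_eq[abs_def])
qed

lemma norm_flow_le: "norm (flow t z) \<le> (1 + \<bar>t\<bar>) * norm z"
proof -
  have "flow t z = z + t *\<^sub>R (snd z, 0)" by (cases z) simp
  then have "norm (flow t z) \<le> norm z + norm (t *\<^sub>R (snd z, 0::'a))"
    by (metis norm_triangle_ineq)
  also have "norm (t *\<^sub>R (snd z, 0::'a)) \<le> \<bar>t\<bar> * norm z"
    using norm_snd_le[of "snd z" "fst z"] by (simp add: norm_Pair mult_left_mono)
  finally show ?thesis by (simp add: algebra_simps)
qed

lemma norm_le_flow: "norm z \<le> (1 + \<bar>t\<bar>) * norm (flow t z)"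
  using norm_flow_le[of "-t" "flow t z"] by (simp add: flow_flow)

text \<open>
  The flow differs from the identity by the nilpotent map \<open>(q, p) \<mapsto> (t p, 0)\<close>, which is why
  directional derivatives along the flow only involve the direction \<open>(p, 0)\<close>.
\<close>

lemma linear_scale_fst:
  fixes D :: "'a::euclidean_space \<times> 'a \<Rightarrow> real"
  assumes "linear D" shows "D (h *\<^sub>R p, 0) = h * D (p, 0)"
  using linear_scale[OF assms, of h "(p, 0)"] by simp

lemma linear_flow_arg:
  fixes D :: "'a::euclidean_space \<times> 'a \<Rightarrow> real"
  assumes "linear D" shows "D (flow t v) = D v + t * D (snd v, 0)"
proof -
  have "flow t v = v + (t *\<^sub>R snd v, 0)" by (cases v) simp
  then show ?thesis using linear_add[OF assms] linear_scale_fst[OF assms] by simp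
qed

definition transport :: "('a::euclidean_space \<times> 'a \<Rightarrow> real) \<Rightarrow> 'a \<times> 'a \<Rightarrow> real" where
  "transport f z = frechet_derivative f (at z) (snd z, 0)"

lemma Ck_1_has_derivative:
  "Ck 1 f \<Longrightarrow> (f has_derivative frechet_derivative f (at x)) (at x)"
  using Ck_SucD(1)[of 0 f x] by simp

lemma DERIV_along_flow:
  assumes "Ck 1 f"
  shows "((\<lambda>s. f (flow s z)) has_real_derivative transport f (flow s z)) (at s)"
proof -
  have "((\<lambda>s. flow s z) has_derivative (\<lambda>h. h *\<^sub>R (snd z, 0))) (at s)"
    unfolding flow_eq by (auto intro!: derivative_eq_intros)
  from has_derivative_compose[OF this Ck_1_has_derivative[OF assms]]
  have "((\<lambda>s. f (flow s z)) has_derivative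
     (\<lambda>h. frechet_derivative f (at (flow s z)) (h *\<^sub>R (snd z, 0)))) (at s)" .
  moreover have "frechet_derivative f (at (flow s z)) (h *\<^sub>R (snd z, 0)) = transport f (flow s z) * h" for h
    using linear_scale_fst[OF has_derivative_linear[OF Ck_1_has_derivative[OF assms]]]
    by (simp add: transport_def flow_eq)
  ultimately show ?thesis by (simp add: has_field_derivative_def)
qed

lemma transport_unique:
  assumes "Ck 1 f" "((\<lambda>s. f (flow s z)) has_real_derivative d) (at 0)"
  shows "transport f z = d"
  using DERIV_unique[OF DERIV_along_flow[OF assms(1), of z 0] assms(2)] by simp

lemma transport_add:
  assumes "Ck 1 f" "Ck 1 g"
  shows "transport (\<lambda>x. f x + g x) z = transport f z + transport g z"
  using DERIV_add[OF DERIV_along_flow[OF assms(1), of z 0] DERIV_along_flow[OF assms(2), of z 0]]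
  by (intro transport_unique Ck_add assms) simp

lemma transport_mult:
  assumes "Ck 1 f" "Ck 1 g"
  shows "transport (\<lambda>x. f x * g x) z = f z * transport g z + g z * transport f z"
  using DERIV_mult[OF DERIV_along_flow[OF assms(1), of z 0] DERIV_along_flow[OF assms(2), of z 0]]
  by (intro transport_unique Ck_mult assms) (simp add: algebra_simps)

lemma continuous_on_transport:
  assumes "Ck 1 f" shows "continuous_on UNIV (transport f)"
proof -
  have eq: "transport f z = (\<Sum>b\<in>Basis. (snd z \<bullet> b) * frechet_derivative f (at z) (b, 0))" for z
  proof -
    interpret linear "frechet_derivative f (at z)"
      using has_derivative_linear[OF Ck_1_has_derivative[OF assms]] .
    have "(snd z, 0::'a) = (\<Sum>b\<in>Basis. ((snd z \<bullet> b) *\<^sub>R b, 0))"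
      by (simp add: prod_eq_iff fst_sum snd_sum euclidean_representation)
    then show ?thesis by (simp add: transport_def sum linear_scale_fst[OF linear_axioms])
  qed
  have [continuous_intros]: "continuous_on UNIV (\<lambda>z. frechet_derivative f (at z) v)" for v
    using Ck_SucD(2)[of 0 f v] assms by simp
  show ?thesis unfolding eq[abs_def] by (intro continuous_intros)
qed

lemma transport_C0:
  assumes "f \<in> Cc_infinity" shows "transport f \<in> C0"
proof -
  obtain R where R: "\<And>x. R \<le> norm x \<Longrightarrow> f x = 0" using Cc_infinity_support[OF assms] by metis
  show ?thesis
  proof (rule C0I[of _ "R + 1"])
    show "continuous_on UNIV (transport f)"
      by (rule continuous_on_transport[OF Cc_infinity_Ck[OF assms]])
    fix z :: "'a \<times> 'a" assume z: "R + 1 \<le> norm z"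
    have "(f has_derivative (\<lambda>_. 0)) (at z)"
    proof (rule has_derivative_transform_within_open)
      show "((\<lambda>_. 0) has_derivative (\<lambda>_. 0)) (at z)" by simp
      show "open {x::'a \<times> 'a. R < norm x}" by (intro open_Collect_less continuous_intros)
    qed (use z R in auto)
    from frechet_derivative_at[OF this] show "transport f z = 0"
      by (metis transport_def)
  qed
qed

lemma
  fixes g :: "'a::euclidean_space \<times> 'a \<Rightarrow> real"
  assumes "Ck 1 g" "continuous_on UNIV a"
  shows flow_average_has_derivative:
    "((\<lambda>z. integral {0..T} (\<lambda>t. a t * g (flow t z))) has_derivative
      (\<lambda>v. integral {0..T} (\<lambda>t. a t * frechet_derivative g (at (flow t z)) (flow t v)))) (at z)"
    and flow_average_derivative_integrable:
    "(\<lambda>t. a t * frechet_derivative g (at (flow t z)) v) integrable_on {0..T}"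
proof -
  have g: "continuous_on UNIV g" using Ck_continuous[OF assms(1)] .
  have dg: "continuous_on UNIV (\<lambda>z. frechet_derivative g (at z) v)" for v
    using Ck_SucD(2)[of 0 g v] assms(1) by simp
  note ci = continuous_on_compose2[OF g, simplified] continuous_on_compose2[OF dg, simplified]
    continuous_on_compose2[OF assms(2), simplified]
  show int: "(\<lambda>t. a t * frechet_derivative g (at (flow t z)) v) integrable_on {0..T}" for v z
    by (intro integrable_continuous_interval continuous_intros ci)
  define fx where "fx z t = Blinfun (\<lambda>v. a t * frechet_derivative g (at (flow t z)) (flow t v))" for z t
  have bl: "bounded_linear (\<lambda>v. a t * frechet_derivative g (at (flow t z)) (flow t v))" for z t
    by (intro bounded_linear_const_mult
        bounded_linear_compose[OF has_derivative_bounded_linear[OF Ck_1_has_derivative[OF assms(1)]]]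
        bounded_linear_flow)
  have fx: "blinfun_apply (fx z t) = (\<lambda>v. a t * frechet_derivative g (at (flow t z)) (flow t v))" for z t
    unfolding fx_def by (rule bounded_linear_Blinfun_apply[OF bl])
  have lin: "frechet_derivative g (at z) (flow t v) =
      frechet_derivative g (at z) v + t * frechet_derivative g (at z) (snd v, 0)" for z t v
    by (rule linear_flow_arg[OF has_derivative_linear[OF Ck_1_has_derivative[OF assms(1)]]])
  have cfx: "continuous_on (UNIV \<times> cbox 0 T) (\<lambda>(z, t). fx z t)"
    by (rule continuous_on_blinfun_componentwise)
      (simp only: split_def fx lin, intro continuous_intros ci)
  have "((\<lambda>z. integral (cbox 0 T) (\<lambda>t. a t * g (flow t z))) has_derivative
      blinfun_apply (integral (cbox 0 T) (fx z))) (at z within UNIV)"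
  proof (rule leibniz_rule[where fx=fx, OF _ _ cfx])
    show "((\<lambda>z. a t * g (flow t z)) has_derivative blinfun_apply (fx z t)) (at z within UNIV)" for z t
      unfolding fx
      by (intro has_derivative_mult_right has_derivative_compose[OF _ Ck_1_has_derivative[OF assms(1)]]
          bounded_linear_imp_has_derivative bounded_linear_flow)
    show "(\<lambda>t. a t * g (flow t z)) integrable_on cbox 0 T" for z
      unfolding interval_cbox[symmetric]
      by (intro integrable_continuous_interval continuous_intros ci)
  qed auto
  moreover have "blinfun_apply (integral (cbox 0 T) (fx z)) v =
      integral {0..T} (\<lambda>t. a t * frechet_derivative g (at (flow t z)) (flow t v))" for v
  proof -
    have "fx z integrable_on cbox 0 T"
      by (rule integrable_continuous)
        (rule continuous_on_compose2[OF cfx, of _ "\<lambda>t. (z, t)", simplified], auto intro!: continuous_intros)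
    from blinfun_apply_integral[OF this, of v] show ?thesis by (simp add: fx)
  qed
  ultimately show "((\<lambda>z. integral {0..T} (\<lambda>t. a t * g (flow t z))) has_derivative
      (\<lambda>v. integral {0..T} (\<lambda>t. a t * frechet_derivative g (at (flow t z)) (flow t v)))) (at z)"
    by (simp add: has_derivative_eq_rhs[OF _ ext])
qed

text \<open>
  Differentiating such an average in a direction \<open>(v, w)\<close> gives averages of the derivatives of
  \<open>g\<close> in the directions \<open>(v, w)\<close> and \<open>(w, 0)\<close>, the latter with the weight \<open>t\<close>; hence the
  arbitrary weight \<open>a\<close> in the induction.
\<close>

lemma Ck_flow_average:
  fixes g :: "'a::euclidean_space \<times> 'a \<Rightarrow> real"
  assumes "Ck k g" "continuous_on UNIV a"
  shows "Ck k (\<lambda>z. integral {0..T} (\<lambda>t. a t * g (flow t z)))"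
  using assms
proof (induction k arbitrary: g a)
  case 0
  have g: "continuous_on UNIV g" using Ck_continuous[OF 0(1)] .
  have "continuous_on UNIV (\<lambda>z. integral (cbox 0 T) (\<lambda>t. a t * g (flow t z)))"
    by (rule integral_continuous_on_param)
      (simp only: split_def, intro continuous_intros continuous_on_compose2[OF g, simplified]
        continuous_on_compose2[OF 0(2), simplified])
  then show ?case by simp
next
  case (Suc k)
  have g1: "Ck 1 g"
    using Ck_SucD(1)[OF Suc.prems(1)] Ck_continuous[OF Ck_SucD(2)[OF Suc.prems(1)]]
    by (auto simp: differentiable_def)
  show ?case
  proof (rule Ck_SucI[OF flow_average_has_derivative[OF g1 Suc.prems(2)]])
    fix v :: "'a \<times> 'a"
    have "integral {0..T} (\<lambda>t. a t * frechet_derivative g (at (flow t z)) (flow t v)) =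
        integral {0..T} (\<lambda>t. a t * frechet_derivative g (at (flow t z)) v) +
        integral {0..T} (\<lambda>t. (a t * t) * frechet_derivative g (at (flow t z)) (snd v, 0))" for z
    proof -
      have "a t * frechet_derivative g (at (flow t z)) (flow t v) =
         a t * frechet_derivative g (at (flow t z)) v +
         (a t * t) * frechet_derivative g (at (flow t z)) (snd v, 0)" for t
        by (simp add: linear_flow_arg[OF has_derivative_linear[OF Ck_1_has_derivative[OF g1]]] algebra_simps)
      then show ?thesis
        by (simp only:) (intro Henstock_Kurzweil_Integration.integral_add
          flow_average_derivative_integrable g1 Suc.prems(2) continuous_intros)
    qed
    then show "Ck k (\<lambda>z. integral {0..T} (\<lambda>t. a t * frechet_derivative g (at (flow t z)) (flow t v)))"
      by (simp only:) (intro Ck_add Suc.IH Ck_SucD(2)[OF Suc.prems(1)] Suc.prems(2) continuous_intros)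
  qed
qed

text \<open>
  The resolvent of the transport semigroup, truncated at a large time \<open>T\<close>, keeps smooth compactly
  supported functions smooth and compactly supported; the truncation costs \<open>e\<^bsup>-\<nu>T\<^esup>\<close>.
\<close>

lemma transport_range_dense:
  fixes g :: "'a::euclidean_space \<times> 'a \<Rightarrow> real"
  assumes "0 < \<nu>" "g \<in> C0" "0 < \<epsilon>"
  shows "\<exists>f\<in>Cc_infinity. \<forall>z. \<bar>\<nu> * f z - transport f z - g z\<bar> \<le> \<epsilon>"
proof -
  obtain h where h: "h \<in> Cc_infinity" "\<And>z. \<bar>h z - g z\<bar> \<le> \<epsilon>/2"
    using Cc_infinity_dense[OF assms(2), of "\<epsilon>/2"] assms(3) by auto
  obtain R where R: "0 < R" "\<And>x. R \<le> norm x \<Longrightarrow> h x = 0"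
    using Cc_infinity_support[OF h(1)] by metis
  obtain M where M: "0 < M" "\<And>x. \<bar>h x\<bar> \<le> M" using C0_bounded[OF Cc_infinity_C0[OF h(1)]] by metis
  \<comment> \<open>large enough for the truncation error \<open>e\<^bsup>-\<nu>T\<^esup> M\<close> to be at most \<open>\<epsilon>/2\<close>\<close>
  define T where "T = max 0 (ln (2 * M / \<epsilon>) / \<nu>)"
  have T0: "0 \<le> T" by (simp add: T_def)
  have small: "exp (- \<nu> * T) * M \<le> \<epsilon>/2"
  proof -
    have "ln (2 * M / \<epsilon>) \<le> \<nu> * T" using assms(1) by (simp add: T_def field_simps max_def)
    then have "exp (ln (2 * M / \<epsilon>)) \<le> exp (\<nu> * T)" by (simp only: exp_le_cancel_iff)
    then have "2 * M / \<epsilon> \<le> exp (\<nu> * T)" using M(1) assms(3) by simp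
    then show ?thesis using assms(3) by (simp add: exp_minus field_simps)
  qed
  let ?a = "\<lambda>t. exp (- \<nu> * t)"
  define f where "f = (\<lambda>z. integral {0..T} (\<lambda>t. ?a t * h (flow t z)))"
  have a: "continuous_on UNIV ?a" by (intro continuous_intros)
  have h1: "Ck 1 h" using Cc_infinity_Ck[OF h(1)] .
  have fC: "f \<in> Cc_infinity"
  proof (rule Cc_infinityI)
    show "Ck k f" for k unfolding f_def by (intro Ck_flow_average Cc_infinity_Ck h a)
    fix z :: "'a \<times> 'a" assume z: "(1 + T) * R \<le> norm z"
    have "h (flow t z) = 0" if "t \<in> {0..T}" for t
    proof (rule R(2), rule ccontr)
      assume "\<not> R \<le> norm (flow t z)"
      then have "(1 + \<bar>t\<bar>) * norm (flow t z) < (1 + T) * R"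
        using that R(1) by (intro mult_le_less_imp_less) auto
      then show False using norm_le_flow[of z t] z by linarith
    qed
    then show "f z = 0" unfolding f_def by (subst integral_cong[where g="\<lambda>_. 0"]) auto
  qed
  have eq: "\<nu> * f z - transport f z = h z - ?a T * h (flow T z)" for z
  proof -
    have tf: "transport f z = integral {0..T} (\<lambda>t. ?a t * transport h (flow t z))"
    proof -
      have "frechet_derivative f (at z) =
          (\<lambda>v. integral {0..T} (\<lambda>t. ?a t * frechet_derivative h (at (flow t z)) (flow t v)))"
        unfolding f_def by (rule frechet_derivative_at[OF flow_average_has_derivative[OF h1 a], symmetric])
      then show ?thesis by (simp add: transport_def)
    qed
    have fz: "f z = integral {0..T} (\<lambda>t. ?a t * h (flow t z))" by (simp add: f_def)
    have "((\<lambda>t. ?a t * transport h (flow t z) + (- \<nu> * ?a t) * h (flow t z)) has_integral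
        ?a T * h (flow T z) - ?a 0 * h (flow 0 z)) {0..T}"
      using T0 by (intro fundamental_theorem_of_calculus)
        (auto intro!: derivative_eq_intros has_field_derivative_at_within[OF DERIV_along_flow[OF h1]]
          simp: has_real_derivative_iff_has_vector_derivative[symmetric])
    then have "integral {0..T} (\<lambda>t. ?a t * transport h (flow t z) - \<nu> * (?a t * h (flow t z))) =
        ?a T * h (flow T z) - h z"
      by (simp add: integral_unique algebra_simps)
    moreover have "integral {0..T} (\<lambda>t. ?a t * transport h (flow t z) - \<nu> * (?a t * h (flow t z))) =
        transport f z - \<nu> * f z"
      unfolding tf fz
      by (subst Henstock_Kurzweil_Integration.integral_diff)
        (auto intro!: integrable_continuous_interval continuous_intros
          continuous_on_compose2[OF continuous_on_transport[OF h1], simplified]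
          continuous_on_compose2[OF Ck_continuous[OF h1], simplified])
    ultimately show ?thesis by linarith
  qed
  show ?thesis
  proof (intro bexI[OF _ fC] allI)
    fix z
    have "\<bar>?a T * h (flow T z)\<bar> \<le> ?a T * M"
      using M(2)[of "flow T z"] by (simp add: abs_mult)
    then show "\<bar>\<nu> * f z - transport f z - g z\<bar> \<le> \<epsilon>"
      using eq[of z] h(2)[of z] small by linarith
  qed
qed

text \<open>
  Positive maximum principle: at a maximum of \<open>f\<close> the derivative vanishes and every jump lowers
  \<open>f\<close>.
\<close>

lemma maximum_principle:
  assumes f: "f \<in> Cc_infinity" and "0 < \<mu>" and \<eta>: "\<And>z. 0 \<le> \<eta> z"
    and G: "\<And>z. \<bar>\<mu> * f z - transport f z - \<eta> z * (f (B z) - f z)\<bar> \<le> G"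
  shows "\<bar>f z\<bar> \<le> G / \<mu>"
proof -
  have upper: "f z \<le> G / \<mu>" if f: "f \<in> Cc_infinity"
    and G: "\<And>z. \<mu> * f z - transport f z - \<eta> z * (f (B z) - f z) \<le> G" and "0 \<le> G" for f z
  proof (cases "f z \<le> 0")
    case True
    then show ?thesis using \<open>0 \<le> G\<close> \<open>0 < \<mu>\<close> by (meson divide_nonneg_pos order_trans)
  next
    case False
    obtain R where R: "0 < R" "\<And>x. R \<le> norm x \<Longrightarrow> f x = 0"
      using Cc_infinity_support[OF f] by metis
    have "continuous_on (cball 0 R) f"
      using Ck_continuous[OF Cc_infinity_Ck[OF f]] continuous_on_subset by blast
    then obtain y where y: "\<forall>x\<in>cball 0 R. f x \<le> f y"
      using continuous_attains_sup[of "cball 0 R" f] R(1) by auto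
    have "norm z < R" using R(2)[of z] False by force
    then have zy: "f z \<le> f y" using y by simp
    have max: "f x \<le> f y" for x
      using y R(2)[of x] False zy by (cases "R \<le> norm x") auto
    have "frechet_derivative f (at y) = (\<lambda>v. 0)"
      using max by (intro differential_zero_maxmin[OF _ open_UNIV
          Ck_1_has_derivative[OF Cc_infinity_Ck[OF f]]]) auto
    then have "transport f y = 0" by (simp add: transport_def)
    moreover have "\<eta> y * (f (B y) - f y) \<le> 0"
      using max[of "B y"] \<eta>[of y] by (simp add: mult_nonneg_nonpos)
    ultimately have "\<mu> * f y \<le> G" using G[of y] by linarith
    then have "f y \<le> G / \<mu>" using \<open>0 < \<mu>\<close> by (simp add: field_simps)
    then show ?thesis using zy by linarith
  qed
  have f1: "Ck 1 f" using Cc_infinity_Ck[OF f] .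
  have "f z \<le> G / \<mu>"
  proof (rule upper[OF f])
    show "\<mu> * f z - transport f z - \<eta> z * (f (B z) - f z) \<le> G" for z using G[of z] by linarith
    show "0 \<le> G" using G[of z] by linarith
  qed
  moreover have "- f z \<le> G / \<mu>"
  proof -
    have t: "transport (\<lambda>z. - 1 * f z) z = - transport f z" for z
      using transport_mult[OF Ck_const[of 1 "-1"] f1, of z]
      by (simp add: transport_def)
    have "- 1 * f z \<le> G / \<mu>"
    proof (rule upper)
      show "(\<lambda>z. - 1 * f z) \<in> Cc_infinity" by (intro Cc_infinity_mult f Ck_const)
      show "\<mu> * (- 1 * f z) - transport (\<lambda>z. - 1 * f z) z - \<eta> z * (- 1 * f (B z) - - 1 * f z) \<le> G" for z
        using G[of z] unfolding t by (simp add: abs_le_iff algebra_simps)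
      show "0 \<le> G" using G[of z] by linarith
    qed
    then show ?thesis by simp
  qed
  ultimately show ?thesis by linarith
qed

section \<open>Bounded perturbations preserve dense ranges\<close>

text \<open>
  An approximate solution for \<open>A\<close> alone leaves a residual that is smaller than the right-hand side
  by the factor \<open>k/\<nu> < 1\<close>, up to an arbitrarily small error. Solving again for the residual
  and adding up gives a geometric decay.
\<close>

lemma dense_range_perturbation:
  fixes A K :: "('b::euclidean_space \<Rightarrow> real) \<Rightarrow> 'b \<Rightarrow> real"
  assumes zero: "(\<lambda>x. 0) \<in> D" and sub: "D \<subseteq> C0"
    and add: "\<And>f g. f \<in> D \<Longrightarrow> g \<in> D \<Longrightarrow> (\<lambda>x. f x + g x) \<in> D"
    and A_add: "\<And>f g x. f \<in> D \<Longrightarrow> g \<in> D \<Longrightarrow> A (\<lambda>x. f x + g x) x = A f x + A g x"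
    and K_add: "\<And>f g x. f \<in> D \<Longrightarrow> g \<in> D \<Longrightarrow> K (\<lambda>x. f x + g x) x = K f x + K g x"
    and A_C0: "\<And>f. f \<in> D \<Longrightarrow> A f \<in> C0" and K_C0: "\<And>f. f \<in> D \<Longrightarrow> K f \<in> C0"
    and range: "\<And>g \<epsilon>. g \<in> C0 \<Longrightarrow> 0 < \<epsilon> \<Longrightarrow> \<exists>f\<in>D. \<forall>x. \<bar>A f x - g x\<bar> \<le> \<epsilon>"
    and coercive: "\<And>f G x. f \<in> D \<Longrightarrow> (\<And>x. \<bar>A f x\<bar> \<le> G) \<Longrightarrow> \<bar>f x\<bar> \<le> G / \<nu>"
    and K_bound: "\<And>f G x. f \<in> D \<Longrightarrow> (\<And>x. \<bar>f x\<bar> \<le> G) \<Longrightarrow> \<bar>K f x\<bar> \<le> k * G"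
    and k: "0 \<le> k" "k < \<nu>" and g: "g \<in> C0" "0 < \<epsilon>"
  shows "\<exists>f\<in>D. \<forall>x. \<bar>A f x - K f x - g x\<bar> \<le> \<epsilon>"
proof -
  define \<theta> where "\<theta> = (1 + k / \<nu>) / 2"
  have \<theta>: "0 < \<theta>" "\<theta> < 1" "k / \<nu> < \<theta>" using k by (auto simp: \<theta>_def field_simps)
  have one: "\<exists>f\<in>D. \<forall>x. \<bar>A f x - K f x - g x\<bar> \<le> \<theta> * G"
    if g: "g \<in> C0" "\<And>x. \<bar>g x\<bar> \<le> G" "0 < G" for g G
  proof -
    \<comment> \<open>the error \<open>\<delta>\<close> is counted twice: as residual for \<open>A\<close>, and through the bound on \<open>f\<close>\<close>
    define \<delta> where "\<delta> = (\<theta> - k / \<nu>) * G / 2"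
    have \<delta>: "0 < \<delta>" using \<theta> g by (simp add: \<delta>_def)
    obtain f where f: "f \<in> D" "\<And>x. \<bar>A f x - g x\<bar> \<le> \<delta>" using range[OF g(1) \<delta>] by auto
    have "\<bar>A f x\<bar> \<le> G + \<delta>" for x using f(2)[of x] g(2)[of x] by linarith
    then have "\<bar>f x\<bar> \<le> (G + \<delta>) / \<nu>" for x by (rule coercive[OF f(1)])
    then have Kf: "\<bar>K f x\<bar> \<le> k * ((G + \<delta>) / \<nu>)" for x by (rule K_bound[OF f(1)])
    have "k / \<nu> * \<delta> \<le> 1 * \<delta>" using k \<delta> by (intro mult_right_mono) auto
    then have "\<delta> + k * ((G + \<delta>) / \<nu>) \<le> 2 * \<delta> + k / \<nu> * G" by (simp add: algebra_simps add_divide_distrib)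
    also have "\<dots> = \<theta> * G" by (simp add: \<delta>_def field_simps)
    finally have "\<delta> + k * ((G + \<delta>) / \<nu>) \<le> \<theta> * G" .
    then have "\<bar>A f x - K f x - g x\<bar> \<le> \<theta> * G" for x
      using f(2)[of x] Kf[of x] by linarith
    with f(1) show ?thesis by blast
  qed
  obtain G where G: "0 < G" "\<And>x. \<bar>g x\<bar> \<le> G" using C0_bounded[OF g(1)] by metis
  have A0: "A (\<lambda>x. 0) x = 0" for x using A_add[OF zero zero, of x] by simp
  have K0: "K (\<lambda>x. 0) x = 0" for x using K_add[OF zero zero, of x] by simp
  have iter: "\<exists>f\<in>D. \<forall>x. \<bar>A f x - K f x - g x\<bar> \<le> \<theta> ^ n * G" for n
  proof (induction n)
    case 0
    show ?case using G by (intro bexI[OF _ zero]) (auto simp: A0 K0)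
  next
    case (Suc n)
    then obtain f where f: "f \<in> D" "\<And>x. \<bar>A f x - K f x - g x\<bar> \<le> \<theta> ^ n * G" by auto
    let ?\<rho> = "\<lambda>x. g x - (A f x - K f x)"
    have "?\<rho> \<in> C0" by (intro C0_diff A_C0 K_C0 f g)
    moreover have "\<bar>?\<rho> x\<bar> \<le> \<theta> ^ n * G" for x using f(2)[of x] by linarith
    moreover have "0 < \<theta> ^ n * G" using \<theta> G by simp
    ultimately obtain h where h: "h \<in> D" "\<And>x. \<bar>A h x - K h x - ?\<rho> x\<bar> \<le> \<theta> * (\<theta> ^ n * G)"
      using one by meson
    show ?case
    proof (intro bexI[OF _ add[OF f(1) h(1)]] allI)
      fix x
      show "\<bar>A (\<lambda>x. f x + h x) x - K (\<lambda>x. f x + h x) x - g x\<bar> \<le> \<theta> ^ Suc n * G"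
        using h(2)[of x] by (simp add: A_add K_add f h algebra_simps)
    qed
  qed
  have "(\<lambda>n. \<theta> ^ n * G) \<longlonglongrightarrow> 0 * G"
    using \<theta> by (intro tendsto_intros LIMSEQ_realpow_zero) auto
  then have "\<forall>\<^sub>F n in sequentially. \<theta> ^ n * G < \<epsilon>" using g(2) by (simp add: order_tendsto_iff)
  then obtain n where "\<theta> ^ n * G < \<epsilon>" by (auto simp: eventually_sequentially)
  with iter[of n] show ?thesis by (meson less_imp_le order_trans)
qed

section \<open>Transport with bounces\<close>

locale C1_potential =
  fixes U :: "'a::euclidean_space \<Rightarrow> real"
  assumes C1: "Ck 1 U"
begin

lemma fst_bounce [simp]: "fst (bounce U z) = fst z"
  by (simp add: bounce_def split: prod.split)

lemma norm_snd_bounce [simp]: "norm (snd (bounce U z)) = norm (snd z)"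
proof -
  obtain q p where z: "z = (q, p)" by (cases z)
  define n where "n = nabla U q"
  have "(norm (snd (bounce U z)))\<^sup>2 = (norm p)\<^sup>2"
  proof (cases "n = 0")
    case True
    then show ?thesis by (simp add: z bounce_def n_def)
  next
    case False
    let ?c = "2 * (n \<bullet> p) / (norm n)\<^sup>2"
    have "(norm (p - ?c *\<^sub>R n))\<^sup>2 = (norm p)\<^sup>2 - 2 * ?c * (n \<bullet> p) + ?c\<^sup>2 * (norm n)\<^sup>2"
      unfolding power2_norm_eq_inner inner_diff_left inner_diff_right
      by (simp add: inner_commute[of p n] power2_eq_square algebra_simps)
    also have "?c\<^sup>2 * (norm n)\<^sup>2 = 2 * ?c * (n \<bullet> p)"
      using False by (simp add: field_simps power2_eq_square)
    finally show ?thesis unfolding z bounce_def n_def by simp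
  qed
  then show ?thesis by (simp add: z)
qed

lemma norm_bounce [simp]: "norm (bounce U z) = norm z"
  by (cases "bounce U z"; cases z) (metis fst_bounce norm_snd_bounce norm_Pair fst_conv snd_conv)

lemma bounce_rate_nonneg: "0 \<le> bounce_rate U z"
  by (simp add: bounce_rate_def split: prod.split)

lemma continuous_on_nabla_compose [continuous_intros]:
  "continuous_on S g \<Longrightarrow> continuous_on S (\<lambda>x. nabla U (g x))"
  using continuous_on_compose2[OF continuous_on_nabla[OF C1]] by auto

lemma bounce_rate_eq: "bounce_rate U z = max (nabla U (fst z) \<bullet> snd z) 0"
  by (simp add: bounce_rate_def split: prod.split)

lemma bounce_eq: "bounce U z =
    (fst z, snd z - (2 * (nabla U (fst z) \<bullet> snd z) / (norm (nabla U (fst z)))\<^sup>2) *\<^sub>R nabla U (fst z))"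
  by (simp add: bounce_def split: prod.split)

lemma continuous_on_rate [continuous_intros]:
  "continuous_on S g \<Longrightarrow> continuous_on S (\<lambda>x. bounce_rate U (g x))"
  unfolding bounce_rate_eq by (intro continuous_intros)

text \<open>
  The bounce map is discontinuous where \<open>\<nabla>U\<close> vanishes, but there the bounce rate tends to zero.
\<close>

lemma continuous_on_bounce_term:
  assumes u: "continuous_on UNIV (\<lambda>(t::real, z). u t z)" and M: "\<And>t z. \<bar>u t z\<bar> \<le> M"
  shows "continuous_on UNIV (\<lambda>(t, z). bounce_rate U z * u t (bounce U z))"
proof -
  let ?F = "\<lambda>(t, z). bounce_rate U z * u t (bounce U z)"
  have "isCont ?F (t0, z0)" for t0 z0
  proof (cases "nabla U (fst z0) = 0")
    case True
    have r0: "bounce_rate U z0 = 0" by (simp add: bounce_rate_eq True)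
    have "((\<lambda>x. bounce_rate U (snd x) * M) \<longlongrightarrow> bounce_rate U (snd (t0, z0)) * M) (at (t0, z0))"
    proof -
      have "continuous_on UNIV (\<lambda>x::real\<times>('a \<times> 'a). bounce_rate U (snd x) * M)"
        by (intro continuous_intros)
      then have "isCont (\<lambda>x::real\<times>('a \<times> 'a). bounce_rate U (snd x) * M) (t0, z0)"
        using continuous_on_eq_continuous_at[OF open_UNIV] by blast
      then show ?thesis by (simp only: isCont_def)
    qed
    then have lim: "((\<lambda>x. bounce_rate U (snd x) * M) \<longlongrightarrow> 0) (at (t0, z0))" by (simp add: r0)
    have "(?F \<longlongrightarrow> 0) (at (t0, z0))"
    proof (rule Lim_null_comparison[OF _ lim])
      show "\<forall>\<^sub>F x in at (t0, z0). norm (?F x) \<le> bounce_rate U (snd x) * M"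
        by (intro always_eventually allI)
          (auto simp: abs_mult bounce_rate_nonneg intro!: mult_left_mono M)
    qed
    then show ?thesis by (simp add: isCont_def r0)
  next
    case False
    let ?S = "{x::real\<times>('a \<times> 'a). nabla U (fst (snd x)) \<noteq> 0}"
    have "open ?S" by (intro open_Collect_neq continuous_intros)
    moreover have "continuous_on ?S (\<lambda>x. bounce_rate U (snd x) * u (fst x) (bounce U (snd x)))"
      unfolding bounce_eq
      by (intro continuous_intros continuous_on_compose2[OF u, of _ "\<lambda>x. (f x, g x)" for f g, simplified])
        auto
    ultimately have "isCont (\<lambda>x. bounce_rate U (snd x) * u (fst x) (bounce U (snd x))) (t0, z0)"
      using False continuous_on_eq_continuous_at[of ?S] by fastforce
    then show ?thesis by (simp add: split_def)
  qed
  then show ?thesis by (simp add: continuous_on_eq_continuous_at)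
qed

lemma continuous_on_bounce_term_static:
  assumes "continuous_on UNIV f" "\<And>z. \<bar>f z\<bar> \<le> M"
  shows "continuous_on UNIV (\<lambda>z. bounce_rate U z * f (bounce U z))"
proof -
  have "continuous_on UNIV (\<lambda>(t::real, z). f z)"
    unfolding split_def by (intro continuous_on_compose2[OF assms(1)] continuous_intros) auto
  from continuous_on_bounce_term[OF this assms(2)]
  have "continuous_on UNIV (\<lambda>z. (\<lambda>(t::real, z). bounce_rate U z * f (bounce U z)) (0, z))"
    by (rule continuous_on_compose2) (auto intro!: continuous_intros)
  then show ?thesis by simp
qed

definition bounce_part :: "('a \<times> 'a \<Rightarrow> real) \<Rightarrow> 'a \<times> 'a \<Rightarrow> real" where
  "bounce_part f z = bounce_rate U z * (f (bounce U z) - f z)"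

lemma bounce_part_C0:
  assumes "f \<in> Cc_infinity" shows "bounce_part f \<in> C0"
proof -
  obtain R where R: "\<And>x. R \<le> norm x \<Longrightarrow> f x = 0" using Cc_infinity_support[OF assms] by metis
  obtain M where M: "\<And>x. \<bar>f x\<bar> \<le> M" using C0_bounded[OF Cc_infinity_C0[OF assms]] by metis
  note f = Ck_continuous[OF Cc_infinity_Ck[OF assms, of 0]]
  show ?thesis
  proof (rule C0I)
    show "continuous_on UNIV (bounce_part f)"
      unfolding bounce_part_def right_diff_distrib
      by (intro continuous_on_diff continuous_on_bounce_term_static[OF f M] continuous_on_mult
          continuous_on_rate continuous_on_id f)
    show "bounce_part f x = 0" if "R \<le> norm x" for x
      using that by (simp add: bounce_part_def R)
  qed
qed

text \<open>
  If \<open>\<Lambda>\<close> bounds the cut-off rate, then adding \<open>\<Lambda> f\<close> to the bounce part turns it into a positive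
  combination of \<open>f \<circ> bounce\<close> and \<open>f\<close> of total weight \<open>\<Lambda>\<close>, which is smaller than the constant
  \<open>\<mu> + \<Lambda>\<close> left with the transport part.
\<close>

lemma cutoff_bounce_range_dense:
  assumes "0 < \<mu>" "g \<in> C0" "0 < \<epsilon>" "0 < \<rho>"
  shows "\<exists>f\<in>Cc_infinity. \<forall>z. \<bar>\<mu> * f z - transport f z - cutoff \<rho> z * bounce_part f z - g z\<bar> \<le> \<epsilon>"
proof -
  let ?\<eta> = "\<lambda>z. cutoff \<rho> z * bounce_rate U z"
  have \<eta>0: "0 \<le> ?\<eta> z" for z using cutoff_bounds bounce_rate_nonneg by (intro mult_nonneg_nonneg)
  have cc: "continuous_on UNIV (cutoff \<rho> :: 'a \<times> 'a \<Rightarrow> real)"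
    by (rule Ck_continuous[of 0, OF Ck_cutoff[OF bounded_linear_ident]])
  have "?\<eta> \<in> C0"
  proof (rule C0I[of _ "2 * \<rho>"])
    show "continuous_on UNIV ?\<eta>" by (intro continuous_on_mult cc continuous_on_rate continuous_on_id)
  qed (simp add: cutoff_eq_0 assms)
  then obtain \<Lambda> where \<Lambda>': "0 < \<Lambda>" "\<And>z. \<bar>?\<eta> z\<bar> \<le> \<Lambda>" by (rule C0_bounded) blast
  have \<Lambda>: "0 < \<Lambda>" "\<And>z. ?\<eta> z \<le> \<Lambda>" using \<Lambda>'(1) order_trans[OF abs_ge_self \<Lambda>'(2)] by auto
  let ?A = "\<lambda>f z. (\<mu> + \<Lambda>) * f z - transport f z"
  let ?K = "\<lambda>f z. cutoff \<rho> z * bounce_part f z + \<Lambda> * f z"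
  have "\<exists>f\<in>Cc_infinity. \<forall>z. \<bar>?A f z - ?K f z - g z\<bar> \<le> \<epsilon>"
  proof (rule dense_range_perturbation[where \<nu>="\<mu>+\<Lambda>" and k=\<Lambda>])
    show "(\<lambda>x. 0) \<in> Cc_infinity" by (rule Cc_infinityI[of _ 0]) (auto intro: Ck_const)
    show "?K f \<in> C0" if "f \<in> Cc_infinity" for f
    proof (intro C0_add C0_cmult Cc_infinity_C0[OF that])
      show "(\<lambda>z. cutoff \<rho> z * bounce_part f z) \<in> C0"
      proof (rule C0I[of _ "2 * \<rho>"])
        show "continuous_on UNIV (\<lambda>z. cutoff \<rho> z * bounce_part f z)"
          by (intro continuous_on_mult cc C0_continuous bounce_part_C0 that)
      qed (simp add: cutoff_eq_0 assms)
    qed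
    show "\<bar>f x\<bar> \<le> G / (\<mu> + \<Lambda>)" if "f \<in> Cc_infinity" "\<And>x. \<bar>?A f x\<bar> \<le> G" for f G x
      using assms \<Lambda> that by (intro maximum_principle[where \<eta>="\<lambda>_. 0" and B=id]) auto
    show "\<bar>?K f x\<bar> \<le> \<Lambda> * G" if "\<And>x. \<bar>f x\<bar> \<le> G" for f G x
    proof -
      have "?K f x = ?\<eta> x * f (bounce U x) + (\<Lambda> - ?\<eta> x) * f x"
        by (simp add: bounce_part_def algebra_simps)
      also have "\<bar>\<dots>\<bar> \<le> \<bar>?\<eta> x * f (bounce U x)\<bar> + \<bar>(\<Lambda> - ?\<eta> x) * f x\<bar>" by (rule abs_triangle_ineq)
      also have "\<dots> = ?\<eta> x * \<bar>f (bounce U x)\<bar> + (\<Lambda> - ?\<eta> x) * \<bar>f x\<bar>"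
        using abs_of_nonneg[OF \<eta>0[of x]] \<Lambda>(2)[of x] abs_mult[of "?\<eta> x" "f (bounce U x)"]
          abs_mult[of "\<Lambda> - ?\<eta> x" "f x"] by simp
      also have "\<dots> \<le> ?\<eta> x * G + (\<Lambda> - ?\<eta> x) * G"
        using \<eta>0[of x] \<Lambda>(2)[of x] that by (intro add_mono mult_left_mono) auto
      finally show ?thesis by (simp add: algebra_simps)
    qed
    show "?A (\<lambda>x. f x + g x) x = ?A f x + ?A g x" if "f \<in> Cc_infinity" "g \<in> Cc_infinity" for f g x
      using transport_add[OF Cc_infinity_Ck[OF that(1)] Cc_infinity_Ck[OF that(2)], of x]
      by (simp add: algebra_simps)
    show "?A f \<in> C0" if "f \<in> Cc_infinity" for f
      by (intro C0_diff C0_cmult transport_C0 Cc_infinity_C0 that)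
    show "\<exists>f\<in>Cc_infinity. \<forall>x. \<bar>?A f x - g x\<bar> \<le> \<epsilon>" if "g \<in> C0" "0 < \<epsilon>" for g \<epsilon>
      using transport_range_dense[OF _ that, of "\<mu> + \<Lambda>"] assms(1) \<Lambda>(1) by simp
  qed (use assms \<Lambda> in \<open>auto intro!: Cc_infinity_C0 Cc_infinity_add simp: bounce_part_def algebra_simps\<close>)
  then show ?thesis by (simp add: algebra_simps)
qed

lemma transport_cutoff_bound:
  assumes "0 < m" "0 < R"
  shows "\<bar>transport (\<lambda>z. cutoff m (fst z) * cutoff R (snd z)) z\<bar> \<le> 8 * R / (bump_mass * m)"
proof -
  obtain q p where z: "z = (q, p)" by (cases z)
  let ?b = "bump (2 - (norm q)\<^sup>2 / m\<^sup>2)"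
  have "((\<lambda>s. 2 - (norm (q + s *\<^sub>R p))\<^sup>2 / m\<^sup>2) has_real_derivative - (2 * (q \<bullet> p)) / m\<^sup>2) (at 0)"
  proof -
    have "(norm (q + s *\<^sub>R p))\<^sup>2 = q \<bullet> q + 2 * s * (q \<bullet> p) + s\<^sup>2 * (p \<bullet> p)" for s
      unfolding power2_norm_eq_inner inner_add_left inner_add_right
      by (simp add: inner_commute[of p q] power2_eq_square algebra_simps)
    then show ?thesis using assms(1)
      by (simp only:) (auto intro!: derivative_eq_intros simp: field_simps power2_eq_square)
  qed
  from DERIV_chain2[OF step_derivative this]
  have "((\<lambda>s. cutoff m (q + s *\<^sub>R p)) has_real_derivative
      ?b / bump_mass * (- (2 * (q \<bullet> p)) / m\<^sup>2)) (at 0)"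
    by (simp add: cutoff_def)
  from DERIV_cmult_right[OF this, of "cutoff R p"]
  have t: "transport (\<lambda>z. cutoff m (fst z) * cutoff R (snd z)) z =
      ?b / bump_mass * (- (2 * (q \<bullet> p)) / m\<^sup>2) * cutoff R p"
    by (intro transport_unique Ck_mult Ck_cutoff bounded_linear_fst bounded_linear_snd) (simp add: z)
  have nonneg: "0 \<le> 8 * R / (bump_mass * m)" using assms bump_mass_pos by simp
  show ?thesis
  proof (cases "?b = 0 \<or> cutoff R p = 0")
    case True
    then show ?thesis using nonneg unfolding t by auto
  next
    case False
    have p: "norm p \<le> 2 * R" using False cutoff_eq_0[OF assms(2), of p] by linarith
    have "2 - (norm q)\<^sup>2 / m\<^sup>2 > 0" using False bump_eq_0 by (metis not_le)
    then have "(norm q)\<^sup>2 \<le> 2 * m\<^sup>2" using assms(1) by (simp add: field_simps)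
    also have "\<dots> \<le> (2 * m)\<^sup>2" by (simp add: power_mult_distrib)
    finally have q2: "(norm q)\<^sup>2 \<le> (2 * m)\<^sup>2" .
    have q: "norm q \<le> 2 * m" by (rule power2_le_imp_le[OF q2]) (use assms(1) in simp)
    have "\<bar>q \<bullet> p\<bar> \<le> (2 * m) * (2 * R)"
      using order_trans[OF Cauchy_Schwarz_ineq2 mult_mono[OF q p]] assms by simp
    then have qp: "\<bar>2 * (q \<bullet> p)\<bar> / m\<^sup>2 \<le> 8 * R / m"
      using assms by (simp add: field_simps power2_eq_square)
    have "\<bar>transport (\<lambda>z. cutoff m (fst z) * cutoff R (snd z)) z\<bar> =
        ?b / bump_mass * (\<bar>2 * (q \<bullet> p)\<bar> / m\<^sup>2) * cutoff R p"
      unfolding t using bump_mass_pos bump_bounds(1)[of "2 - (norm q)\<^sup>2 / m\<^sup>2"] cutoff_bounds(1)[of R p]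
      by (simp add: abs_mult)
    also have "\<dots> \<le> 1 / bump_mass * (8 * R / m) * 1"
      using bump_mass_pos bump_bounds cutoff_bounds qp assms
      by (intro mult_mono divide_right_mono) auto
    finally show ?thesis by (simp add: field_simps)
  qed
qed

text \<open>
  The bounce rate is unbounded, but transport and bounces preserve \<open>\<bar>p\<bar>\<close>. A solution for a cut-off
  rate can therefore be multiplied by a function of \<open>\<bar>p\<bar>\<close> and of \<open>\<bar>q\<bar>/m\<close>: this function
  commutes with the bounces, it hides the places where the rate was changed, and along the flow it
  varies at a speed of order \<open>1/m\<close> only, because \<open>\<bar>p\<bar>\<close> is bounded on its support.
\<close>

lemma bounce_range_dense:
  assumes "0 < \<mu>" "g \<in> C0" "0 < \<epsilon>"
  shows "\<exists>f\<in>Cc_infinity. \<forall>z. \<bar>\<mu> * f z - transport f z - bounce_part f z - g z\<bar> \<le> \<epsilon>"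
proof -
  obtain h where h: "h \<in> Cc_infinity" "\<And>z. \<bar>h z - g z\<bar> \<le> \<epsilon>/3"
    using Cc_infinity_dense[OF assms(2), of "\<epsilon>/3"] assms(3) by auto
  obtain R where R: "0 < R" "\<And>x. R \<le> norm x \<Longrightarrow> h x = 0"
    using Cc_infinity_support[OF h(1)] by metis
  obtain G where G: "0 < G" "\<And>x. \<bar>h x\<bar> \<le> G" using C0_bounded[OF Cc_infinity_C0[OF h(1)]] by metis
  \<comment> \<open>\<open>C/m\<close> bounds the commutator term: the supremum of the solution times the derivative of the cutoff\<close>
  define C where "C = (G + \<epsilon>/3) / \<mu> * (8 * R / bump_mass)"
  define m where "m = max R (3 * C / \<epsilon>)"
  have C0: "0 \<le> C" using G assms R bump_mass_pos by (simp add: C_def)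
  have m: "0 < m" "R \<le> m" using R(1) by (auto simp: m_def)
  have Cm: "C / m \<le> \<epsilon>/3"
  proof -
    have "3 * C / \<epsilon> \<le> m" by (simp add: m_def)
    then show ?thesis using assms(3) m(1) by (simp add: field_simps)
  qed
  define \<theta> where "\<theta> = (\<lambda>z::'a \<times> 'a. cutoff m (fst z) * cutoff R (snd z))"
  have \<theta>k: "Ck k \<theta>" for k
    unfolding \<theta>_def by (intro Ck_mult Ck_cutoff bounded_linear_fst bounded_linear_snd)
  have \<theta>01: "0 \<le> \<theta> z" "\<theta> z \<le> 1" for z
    unfolding \<theta>_def by (auto intro!: mult_le_one mult_nonneg_nonneg cutoff_bounds)
  have \<theta>1: "\<theta> z * h z = h z" for z
  proof (cases "R \<le> norm z")
    case False
    then have "norm (fst z) \<le> m" "norm (snd z) \<le> R"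
      using norm_fst_le[of "fst z" "snd z"] norm_snd_le[of "snd z" "fst z"] m by auto
    then show ?thesis using m R by (simp add: \<theta>_def cutoff_eq_1)
  qed (simp add: R)
  let ?\<rho> = "2 * m + 2 * R"
  have \<rho>: "0 < ?\<rho>" using m R by simp
  have \<theta>\<rho>: "\<theta> z * cutoff ?\<rho> z = \<theta> z" for z
  proof (cases "norm (fst z) \<le> 2 * m \<and> norm (snd z) \<le> 2 * R")
    case True
    then have "norm z \<le> ?\<rho>" using norm_Pair_le[of "fst z" "snd z"] by simp
    then show ?thesis by (simp add: cutoff_eq_1[OF \<rho>])
  next
    case False
    then have "\<theta> z = 0" using cutoff_eq_0[OF m(1), of "fst z"] cutoff_eq_0[OF R(1), of "snd z"]
      by (auto simp: \<theta>_def)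
    then show ?thesis by simp
  qed
  obtain f where f: "f \<in> Cc_infinity"
    "\<And>z. \<bar>\<mu> * f z - transport f z - cutoff ?\<rho> z * bounce_part f z - h z\<bar> \<le> \<epsilon>/3"
    using cutoff_bounce_range_dense[OF assms(1) Cc_infinity_C0[OF h(1)] _ \<rho>, of "\<epsilon>/3"] assms(3) by auto
  have fb: "\<bar>f z\<bar> \<le> (G + \<epsilon>/3) / \<mu>" for z
  proof (rule maximum_principle[OF f(1) assms(1), where \<eta>="\<lambda>z. cutoff ?\<rho> z * bounce_rate U z" and B="bounce U"])
    fix z
    show "0 \<le> cutoff ?\<rho> z * bounce_rate U z"
      using cutoff_bounds bounce_rate_nonneg by (intro mult_nonneg_nonneg)
    show "\<bar>\<mu> * f z - transport f z - cutoff ?\<rho> z * bounce_rate U z * (f (bounce U z) - f z)\<bar> \<le> G + \<epsilon>/3"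
      using f(2)[of z] G(2)[of z] unfolding bounce_part_def mult.assoc by linarith
  qed
  show ?thesis
  proof (intro bexI allI)
    show "(\<lambda>z. \<theta> z * f z) \<in> Cc_infinity" by (intro Cc_infinity_mult f \<theta>k)
    fix z
    let ?e = "\<mu> * f z - transport f z - cutoff ?\<rho> z * bounce_part f z - h z"
    have "\<theta> (bounce U z) = \<theta> z" by (simp add: \<theta>_def cutoff_def)
    then have bp: "bounce_part (\<lambda>z. \<theta> z * f z) z = \<theta> z * cutoff ?\<rho> z * bounce_part f z"
      unfolding \<theta>\<rho> by (simp add: bounce_part_def algebra_simps)
    have tr: "transport (\<lambda>z. \<theta> z * f z) z = \<theta> z * transport f z + f z * transport \<theta> z"
      by (intro transport_mult \<theta>k Cc_infinity_Ck f)
    have "\<mu> * (\<theta> z * f z) - transport (\<lambda>z. \<theta> z * f z) z - bounce_part (\<lambda>z. \<theta> z * f z) z - g z =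
        \<theta> z * ?e - f z * transport \<theta> z + (\<theta> z * h z - g z)"
      unfolding bp tr by (simp add: algebra_simps)
    moreover have "\<bar>\<theta> z * ?e\<bar> \<le> \<epsilon>/3"
      using mult_mono[OF \<theta>01(2)[of z] f(2)[of z]] \<theta>01(1)[of z] by (simp add: abs_mult)
    moreover have "\<bar>f z * transport \<theta> z\<bar> \<le> \<epsilon>/3"
    proof -
      have "\<bar>f z * transport \<theta> z\<bar> \<le> (G + \<epsilon>/3) / \<mu> * (8 * R / (bump_mass * m))"
        unfolding abs_mult \<theta>_def
        by (intro mult_mono fb transport_cutoff_bound m R) (use G assms in auto)
      also have "\<dots> = C / m" by (simp add: C_def)
      finally show ?thesis using Cm by linarith
    qed
    moreover have "\<bar>\<theta> z * h z - g z\<bar> \<le> \<epsilon>/3" unfolding \<theta>1 by (rule h(2))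
    ultimately show "\<bar>\<mu> * (\<theta> z * f z) - transport (\<lambda>z. \<theta> z * f z) z
        - bounce_part (\<lambda>z. \<theta> z * f z) z - g z\<bar> \<le> \<epsilon>" by linarith
  qed
qed

end

section \<open>Integrals of continuous functions over \<open>{0..t}\<close>\<close>

lemma compact_continuous_bounded:
  fixes f :: "'b::topological_space \<Rightarrow> real"
  assumes "compact K" "continuous_on K f"
  obtains B where "\<And>x. x \<in> K \<Longrightarrow> \<bar>f x\<bar> \<le> B"
proof -
  obtain B where "\<forall>y\<in>f ` K. norm y \<le> B"
    using compact_imp_bounded[OF compact_continuous_image[OF assms(2,1)]] by (auto simp: bounded_iff)
  then show thesis by (intro that) auto
qed

text \<open>
  Substituting \<open>s = \<tau> x\<close> makes the domain of integration independent of the parameter.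
\<close>

lemma integral_scale_unit:
  fixes f :: "real \<Rightarrow> real"
  assumes "0 \<le> \<tau>" "continuous_on UNIV f"
  shows "integral {0..\<tau>} f = \<tau> * integral {0..1} (\<lambda>x. f (\<tau> * x))"
proof (cases "\<tau> = 0")
  case False
  with assms(1) have "0 < \<tau>" by simp
  have "(f has_integral integral (cbox 0 \<tau>) f) (cbox 0 \<tau>)"
    by (intro integrable_integral integrable_continuous continuous_on_subset[OF assms(2)]) auto
  from has_integral_affinity'[OF this \<open>0 < \<tau>\<close>, of 0]
  have "((\<lambda>x. f (\<tau> * x)) has_integral integral {0..\<tau>} f / \<tau>) {0..1}"
    using \<open>0 < \<tau>\<close> by (simp add: field_simps)
  then show ?thesis using \<open>0 < \<tau>\<close> by (simp add: integral_unique)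
qed simp

lemma continuous_on_integral_upto:
  fixes F :: "'x::topological_space \<Rightarrow> real \<Rightarrow> real"
  assumes F: "continuous_on UNIV (\<lambda>(x, s). F x s)"
    and \<tau>: "continuous_on UNIV \<tau>" "\<And>x. 0 \<le> \<tau> x"
  shows "continuous_on UNIV (\<lambda>x. integral {0..\<tau> x} (F x))"
proof -
  have Fx: "continuous_on UNIV (F x)" for x
    using continuous_on_compose2[OF F continuous_on_Pair[OF continuous_on_const[of _ x] continuous_on_id]] by simp
  have "continuous_on UNIV (\<lambda>x. integral (cbox 0 1) (\<lambda>\<theta>. F x (\<tau> x * \<theta>)))"
  proof (rule integral_continuous_on_param)
    have "continuous_on (UNIV \<times> cbox 0 (1::real)) (\<lambda>y. (\<lambda>(x, s). F x s) (fst y, \<tau> (fst y) * snd y))"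
      by (rule continuous_on_compose2[OF F])
        (auto intro!: continuous_intros continuous_on_compose2[OF \<tau>(1)])
    then show "continuous_on (UNIV \<times> cbox 0 1) (\<lambda>(x, \<theta>). F x (\<tau> x * \<theta>))"
      by (simp add: split_def)
  qed
  then have "continuous_on UNIV (\<lambda>x. \<tau> x * integral {0..1} (\<lambda>\<theta>. F x (\<tau> x * \<theta>)))"
    by (intro continuous_on_mult \<tau>) simp
  then show ?thesis by (simp add: integral_scale_unit[OF \<tau>(2) Fx])
qed

lemma integral_eq_lborel:
  fixes h :: "real \<Rightarrow> real"
  assumes "continuous_on UNIV h"
  shows "integral {a..b} h = (\<integral>s. indicator {a..b} s *\<^sub>R h s \<partial>lborel)"
  using set_borel_integral_eq_integral(2)[OF borel_integrable_atLeastAtMost'[OF continuous_on_subset[OF assms subset_UNIV]]]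
  by (simp add: set_lebesgue_integral_def)

lemma integral_triangle_swap:
  fixes F :: "real \<Rightarrow> real \<Rightarrow> real"
  assumes F: "continuous_on UNIV (\<lambda>(\<sigma>, s). F \<sigma> s)" and t: "0 \<le> t"
  shows "integral {0..t} (\<lambda>\<tau>. integral {0..\<tau>} (\<lambda>s. F (\<tau> - s) s)) =
    integral {0..t} (\<lambda>s. integral {0..t - s} (\<lambda>\<sigma>. F \<sigma> s))"
proof -
  have c: "continuous_on UNIV (\<lambda>x. F (g x) (h x))" if "continuous_on UNIV g" "continuous_on UNIV h"
    for g h :: "'x::topological_space \<Rightarrow> real"
    using continuous_on_compose2[OF F continuous_on_Pair[OF that]] by simp
  let ?T = "{x::real \<times> real. 0 \<le> snd x \<and> snd x \<le> fst x \<and> fst x \<le> t}"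
  have Tm: "?T \<in> sets (lborel \<Otimes>\<^sub>M lborel)"
    unfolding lborel_prod sets_lborel
    by (intro borel_closed closed_Collect_conj closed_Collect_le continuous_intros)
  have sub: "?T \<subseteq> cbox (0, 0) (t, t)" by (auto simp: cbox_Pair_eq mem_box)
  have "continuous_on (cbox (0, 0) (t, t)) (\<lambda>(\<tau>, s). F (\<tau> - s) s)"
    unfolding split_def by (intro continuous_on_subset[OF c] continuous_intros) auto
  then obtain B where B: "\<And>x. x \<in> cbox (0, 0) (t, t) \<Longrightarrow> \<bar>(\<lambda>(\<tau>, s). F (\<tau> - s) s) x\<bar> \<le> B"
    using compact_continuous_bounded[OF compact_cbox] by blast
  have int: "integrable (lborel \<Otimes>\<^sub>M lborel) (\<lambda>x. indicator ?T x *\<^sub>R (\<lambda>(\<tau>, s). F (\<tau> - s) s) x)"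
  proof (rule integrableI_bounded_set_indicator[OF Tm, where B=B])
    show "(\<lambda>(\<tau>, s). F (\<tau> - s) s) \<in> borel_measurable (lborel \<Otimes>\<^sub>M lborel)"
      unfolding lborel_prod measurable_lborel2 split_def
      by (intro borel_measurable_continuous_onI c continuous_intros)
    have "emeasure lborel ?T \<le> emeasure lborel (cbox (0, 0) (t, t))"
      using Tm by (intro emeasure_mono[OF sub]) (auto simp: lborel_prod)
    also have "\<dots> < \<infinity>" by (rule emeasure_lborel_cbox_finite)
    finally show "emeasure (lborel \<Otimes>\<^sub>M lborel) ?T < \<infinity>" by (simp only: lborel_prod)
    show "AE x in lborel \<Otimes>\<^sub>M lborel. x \<in> ?T \<longrightarrow> norm ((\<lambda>(\<tau>, s). F (\<tau> - s) s) x) \<le> B"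
    proof (intro AE_I2 impI)
      fix x assume "x \<in> ?T"
      then have "x \<in> cbox (0, 0) (t, t)" using sub by (rule rev_subsetD)
      then show "norm ((\<lambda>(\<tau>, s). F (\<tau> - s) s) x) \<le> B" using B by (simp only: real_norm_def)
    qed
  qed
  have "continuous_on UNIV (\<lambda>\<tau>. integral {0..max 0 \<tau>} (\<lambda>s. F (\<tau> - s) s))"
    by (intro continuous_on_integral_upto)
      (simp add: split_def, intro c continuous_intros, intro continuous_intros, simp)
  then have "integral {0..t} (\<lambda>\<tau>. integral {0..max 0 \<tau>} (\<lambda>s. F (\<tau> - s) s)) =
      (\<integral>\<tau>. (\<integral>s. indicator ?T (\<tau>, s) *\<^sub>R F (\<tau> - s) s \<partial>lborel) \<partial>lborel)"
  proof (subst integral_eq_lborel, assumption, intro Bochner_Integration.integral_cong refl)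
    fix \<tau> :: real
    show "indicator {0..t} \<tau> *\<^sub>R integral {0..max 0 \<tau>} (\<lambda>s. F (\<tau> - s) s) =
      (\<integral>s. indicator ?T (\<tau>, s) *\<^sub>R F (\<tau> - s) s \<partial>lborel)"
    proof (cases "\<tau> \<in> {0..t}")
      case True
      then have "indicator {0..\<tau>} s = (indicator ?T (\<tau>, s) :: real)" for s
        by (auto simp: indicator_def)
      moreover have "integral {0..\<tau>} (\<lambda>s. F (\<tau> - s) s) =
          (\<integral>s. indicator {0..\<tau>} s *\<^sub>R F (\<tau> - s) s \<partial>lborel)"
        by (intro integral_eq_lborel c continuous_intros)
      ultimately show ?thesis using True by simp
    next
      case False
      then have "indicator ?T (\<tau>, s) = (0::real)" for s by (auto simp: indicator_def)
      then show ?thesis using False by simp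
    qed
  qed
  moreover have "continuous_on UNIV (\<lambda>s. integral {0..max 0 (t - s)} (\<lambda>\<sigma>. F \<sigma> s))"
    by (intro continuous_on_integral_upto)
      (simp add: split_def, intro c continuous_intros, intro continuous_intros, simp)
  then have "integral {0..t} (\<lambda>s. integral {0..max 0 (t - s)} (\<lambda>\<sigma>. F \<sigma> s)) =
      (\<integral>s. (\<integral>\<tau>. indicator ?T (\<tau>, s) *\<^sub>R F (\<tau> - s) s \<partial>lborel) \<partial>lborel)"
  proof (subst integral_eq_lborel, assumption, intro Bochner_Integration.integral_cong refl)
    fix s :: real
    show "indicator {0..t} s *\<^sub>R integral {0..max 0 (t - s)} (\<lambda>\<sigma>. F \<sigma> s) =
      (\<integral>\<tau>. indicator ?T (\<tau>, s) *\<^sub>R F (\<tau> - s) s \<partial>lborel)"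
    proof (cases "s \<in> {0..t}")
      case True
      have "(\<integral>\<sigma>. indicator {0..t - s} \<sigma> *\<^sub>R F \<sigma> s \<partial>lborel) =
          (\<integral>\<tau>. indicator {0..t - s} (-s + 1 * \<tau>) *\<^sub>R F (-s + 1 * \<tau>) s \<partial>lborel)"
        by (subst lborel_integral_real_affine[of 1 _ "-s"]) auto
      also have "\<dots> = (\<integral>\<tau>. indicator ?T (\<tau>, s) *\<^sub>R F (\<tau> - s) s \<partial>lborel)"
        using True by (intro Bochner_Integration.integral_cong refl) (auto simp: indicator_def)
      finally show ?thesis using True
        by (subst integral_eq_lborel[OF c]) (auto intro: continuous_intros)
    next
      case False
      then have "indicator ?T (\<tau>, s) = (0::real)" for \<tau> by (auto simp: indicator_def)
      then show ?thesis using False by simp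
    qed
  qed
  moreover have "(\<integral>\<tau>. (\<integral>s. indicator ?T (\<tau>, s) *\<^sub>R F (\<tau> - s) s \<partial>lborel) \<partial>lborel) =
      (\<integral>s. (\<integral>\<tau>. indicator ?T (\<tau>, s) *\<^sub>R F (\<tau> - s) s \<partial>lborel) \<partial>lborel)"
    using lborel_pair.Fubini_integral[of "\<lambda>\<tau> s. indicator ?T (\<tau>, s) *\<^sub>R F (\<tau> - s) s"] int
    by (simp add: split_def)
  ultimately have "integral {0..t} (\<lambda>\<tau>. integral {0..max 0 \<tau>} (\<lambda>s. F (\<tau> - s) s)) =
      integral {0..t} (\<lambda>s. integral {0..max 0 (t - s)} (\<lambda>\<sigma>. F \<sigma> s))" by simp
  moreover have "integral {0..t} (\<lambda>\<tau>. integral {0..max 0 \<tau>} (\<lambda>s. F (\<tau> - s) s)) =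
      integral {0..t} (\<lambda>\<tau>. integral {0..\<tau>} (\<lambda>s. F (\<tau> - s) s))"
    by (intro integral_cong) auto
  moreover have "integral {0..t} (\<lambda>s. integral {0..max 0 (t - s)} (\<lambda>\<sigma>. F \<sigma> s)) =
      integral {0..t} (\<lambda>s. integral {0..t - s} (\<lambda>\<sigma>. F \<sigma> s))"
    by (intro integral_cong) auto
  ultimately show ?thesis by simp
qed

section \<open>The renewal operator\<close>

text \<open>
  The class in which the renewal equation is solved: bounded and jointly continuous in time and
  state. A function of the state alone is in the class as a function constant in time. Negative
  times are included to keep continuity free of side conditions; functions that are meaningful
  for nonnegative times only are extended by their value at \<open>0\<close>.
\<close>

definition bc :: "(real \<Rightarrow> 'b::euclidean_space \<Rightarrow> real) \<Rightarrow> bool" where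
  "bc u \<longleftrightarrow> continuous_on UNIV (\<lambda>(t, z). u t z) \<and> (\<exists>M. \<forall>t z. \<bar>u t z\<bar> \<le> M)"

lemma bcI: "continuous_on UNIV (\<lambda>(t, z). u t z) \<Longrightarrow> (\<And>t z. \<bar>u t z\<bar> \<le> M) \<Longrightarrow> bc u"
  by (auto simp: bc_def)

lemma bc_continuous: "bc u \<Longrightarrow> continuous_on UNIV (\<lambda>(t, z). u t z)"
  by (simp add: bc_def)

lemma bc_bounded: assumes "bc u" obtains M where "0 \<le> M" "\<And>t z. \<bar>u t z\<bar> \<le> M"
proof -
  obtain M where M: "\<And>t z. \<bar>u t z\<bar> \<le> M" using assms by (auto simp: bc_def)
  moreover have "0 \<le> M" using M[of undefined undefined] by linarith
  ultimately show thesis using that by blast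
qed

lemma bc_compose:
  "bc u \<Longrightarrow> continuous_on S g \<Longrightarrow> continuous_on S h \<Longrightarrow> continuous_on S (\<lambda>x. u (g x) (h x))"
  using continuous_on_compose2[OF bc_continuous continuous_on_Pair] by fastforce

lemma bc_slice: "bc u \<Longrightarrow> continuous_on UNIV (u t)"
  using bc_compose[of u UNIV "\<lambda>_. t" "\<lambda>x. x"] by (simp add: continuous_on_const)

lemma bc_fun: "bc (\<lambda>_. f) \<longleftrightarrow> continuous_on UNIV f \<and> (\<exists>M. \<forall>z. \<bar>f z\<bar> \<le> M)"
proof -
  have "continuous_on UNIV f \<Longrightarrow> continuous_on UNIV (\<lambda>(t::real, z). f z)"
    unfolding split_def by (rule continuous_on_compose2) (auto intro: continuous_intros)
  then show ?thesis using bc_slice[of "\<lambda>_. f"] by (auto simp: bc_def)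
qed

lemma bc_C0: assumes "f \<in> C0" shows "bc (\<lambda>_. f)"
proof -
  obtain M where "\<And>x. \<bar>f x\<bar> \<le> M" using assms by (rule C0_bounded) blast
  then show ?thesis using C0_continuous[OF assms] unfolding bc_fun by blast
qed

lemma bc_const: "bc (\<lambda>_ _. c)"
  unfolding bc_fun by (auto intro: continuous_intros)

lemmas bc_projections = continuous_on_fst[OF continuous_on_id] continuous_on_snd[OF continuous_on_id]

lemma bc_time: assumes "bc u" "continuous_on UNIV \<tau>" shows "bc (\<lambda>t. u (\<tau> t))"
proof -
  obtain M where "\<And>t z. \<bar>u t z\<bar> \<le> M" using assms(1) by (rule bc_bounded) blast
  then show ?thesis unfolding bc_def split_def
    by (intro conjI bc_compose[OF assms(1)] continuous_on_compose2[OF assms(2)] bc_projections subset_UNIV) blast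
qed

lemma bc_at: "bc u \<Longrightarrow> bc (\<lambda>_. u t)"
  using bc_time[of u "\<lambda>_. t"] by (simp add: continuous_on_const)

lemma bc_add: assumes "bc u" "bc v" shows "bc (\<lambda>t z. u t z + v t z)"
proof -
  obtain M where M: "\<And>t z. \<bar>u t z\<bar> \<le> M" using assms(1) by (rule bc_bounded) blast
  obtain M' where M': "\<And>t z. \<bar>v t z\<bar> \<le> M'" using assms(2) by (rule bc_bounded) blast
  show ?thesis
  proof (rule bcI)
    show "continuous_on UNIV (\<lambda>(t, z). u t z + v t z)"
      unfolding split_def by (intro continuous_on_add bc_compose[OF assms(1)] bc_compose[OF assms(2)] bc_projections)
    show "\<bar>u t z + v t z\<bar> \<le> M + M'" for t z using M[of t z] M'[of t z] by linarith
  qed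
qed

lemma bc_cmult: assumes "bc u" shows "bc (\<lambda>t z. c * u t z)"
proof -
  obtain M where M: "\<And>t z. \<bar>u t z\<bar> \<le> M" using assms(1) by (rule bc_bounded) blast
  show ?thesis
  proof (rule bcI)
    show "continuous_on UNIV (\<lambda>(t, z). c * u t z)"
      unfolding split_def by (intro continuous_on_mult continuous_on_const bc_compose[OF assms] bc_projections)
    show "\<bar>c * u t z\<bar> \<le> \<bar>c\<bar> * M" for t z using M by (simp add: abs_mult mult_left_mono)
  qed
qed

lemma bc_diff: "bc u \<Longrightarrow> bc v \<Longrightarrow> bc (\<lambda>t z. u t z - v t z)"
  using bc_add[of u "\<lambda>t z. -1 * v t z"] bc_cmult[of v "-1"] by simp

lemma bc_abs: assumes "bc u" shows "bc (\<lambda>t z. \<bar>u t z\<bar>)"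
proof -
  obtain M where M: "\<And>t z. \<bar>u t z\<bar> \<le> M" using assms(1) by (rule bc_bounded) blast
  show ?thesis
  proof (rule bcI)
    show "continuous_on UNIV (\<lambda>(t, z). \<bar>u t z\<bar>)"
      unfolding split_def by (intro continuous_on_rabs bc_compose[OF assms] bc_projections)
    show "\<bar>\<bar>u t z\<bar>\<bar> \<le> M" for t z using M by simp
  qed
qed

text \<open>
  The law \<open>\<gamma>\<close> of the fresh velocity enters only through its first moment.
\<close>

locale bps_kernel = C1_potential U + G: prob_space \<gamma>
  for U :: "'a::euclidean_space \<Rightarrow> real" and \<gamma> :: "'a measure" +
  fixes r \<alpha> :: real
  assumes r_pos: "0 < r" and \<alpha>: "0 < \<alpha>" "\<alpha> \<le> 1"
    and sets_\<gamma> [measurable_cong]: "sets \<gamma> = sets borel"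
    and moment: "integrable \<gamma> norm"
begin

abbreviation "\<beta> \<equiv> sqrt (1 - \<alpha>\<^sup>2)"

lemma \<beta>: "0 \<le> \<beta>" "\<beta> \<le> 1"
  using \<alpha> by (auto simp: power_le_one)

definition refresh_mean :: "('a \<times> 'a \<Rightarrow> real) \<Rightarrow> 'a \<times> 'a \<Rightarrow> real" where
  "refresh_mean g z = (\<integral>x. g (refresh \<alpha> x z) \<partial>\<gamma>)"

definition jump :: "('a \<times> 'a \<Rightarrow> real) \<Rightarrow> 'a \<times> 'a \<Rightarrow> real" where
  "jump g z = bounce_rate U z * g (bounce U z) + r * refresh_mean g z"

definition rate :: "'a \<times> 'a \<Rightarrow> real" where
  "rate z = bounce_rate U z + r"

definition hazard :: "real \<Rightarrow> 'a \<times> 'a \<Rightarrow> real" where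
  "hazard t z = integral {0..t} (\<lambda>s. bounce_rate U (flow s z))"

definition surv :: "real \<Rightarrow> 'a \<times> 'a \<Rightarrow> real" where
  "surv t z = exp (- (hazard t z + r * t))"

abbreviation renewal_integral :: "(real \<Rightarrow> 'a \<times> 'a \<Rightarrow> real) \<Rightarrow> real \<Rightarrow> 'a \<times> 'a \<Rightarrow> real" where
  "renewal_integral u t z \<equiv> integral {0..t} (\<lambda>s. surv s z * jump (u (t - s)) (flow s z))"

definition renewal :: "('a \<times> 'a \<Rightarrow> real) \<Rightarrow> (real \<Rightarrow> 'a \<times> 'a \<Rightarrow> real) \<Rightarrow> real \<Rightarrow> 'a \<times> 'a \<Rightarrow> real" where
  "renewal f u t z = surv t z * f (flow t z) + renewal_integral u t z"

lemma refresh_eq: "refresh \<alpha> x z = (fst z, \<alpha> *\<^sub>R snd z + \<beta> *\<^sub>R x)"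
  by (simp add: refresh_def split: prod.split)

lemma continuous_on_refresh [continuous_intros]:
  "continuous_on S g \<Longrightarrow> continuous_on S h \<Longrightarrow> continuous_on S (\<lambda>y. refresh \<alpha> (g y) (h y))"
  unfolding refresh_eq by (intro continuous_intros)

lemma refresh_measurable:
  assumes "continuous_on UNIV g" shows "(\<lambda>x. g (refresh \<alpha> x z)) \<in> borel_measurable \<gamma>"
proof -
  have "continuous_on UNIV (\<lambda>x. g (refresh \<alpha> x z))"
    by (rule continuous_on_compose2[OF assms continuous_on_refresh[OF continuous_on_id continuous_on_const] subset_UNIV])
  from borel_measurable_continuous_onI[OF this] show ?thesis
    by (simp only: measurable_cong_sets[OF sets_\<gamma> refl])
qed

lemma refresh_integrable:
  assumes "bc (\<lambda>_. g)" shows "integrable \<gamma> (\<lambda>x. g (refresh \<alpha> x z))"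
proof -
  obtain M where "\<And>z. \<bar>g z\<bar> \<le> M" using assms by (rule bc_bounded) blast
  moreover have "continuous_on UNIV g" using assms by (simp add: bc_fun)
  ultimately show ?thesis
    by (intro G.integrable_const_bound[where B=M] AE_I2 refresh_measurable) auto
qed

lemma refresh_mean_add:
  "bc (\<lambda>_. f) \<Longrightarrow> bc (\<lambda>_. g) \<Longrightarrow> refresh_mean (\<lambda>z. f z + g z) z = refresh_mean f z + refresh_mean g z"
  unfolding refresh_mean_def by (intro Bochner_Integration.integral_add refresh_integrable)

lemma refresh_mean_cmult: "refresh_mean (\<lambda>z. c * f z) z = c * refresh_mean f z"
  unfolding refresh_mean_def by simp

lemma refresh_mean_const: "refresh_mean (\<lambda>z. c) z = c"
  unfolding refresh_mean_def by (simp add: G.prob_space)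

lemma refresh_mean_mono:
  "bc (\<lambda>_. f) \<Longrightarrow> bc (\<lambda>_. g) \<Longrightarrow> (\<And>z. f z \<le> g z) \<Longrightarrow> refresh_mean f z \<le> refresh_mean g z"
  unfolding refresh_mean_def by (intro integral_mono refresh_integrable)

lemma refresh_mean_abs_le:
  assumes "bc (\<lambda>_. f)" "\<And>z. \<bar>f z\<bar> \<le> M" shows "\<bar>refresh_mean f z\<bar> \<le> M"
proof -
  have "refresh_mean f z \<le> refresh_mean (\<lambda>_. M) z"
    using assms(2) by (intro refresh_mean_mono assms bc_const) (simp add: abs_le_iff)
  moreover have "refresh_mean (\<lambda>_. - M) z \<le> refresh_mean f z"
    using assms(2) by (intro refresh_mean_mono assms bc_const) (smt (verit))
  ultimately show ?thesis by (simp add: refresh_mean_const)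
qed

lemma continuous_on_refresh_mean:
  assumes "bc u" shows "continuous_on UNIV (\<lambda>(t, z). refresh_mean (u t) z)"
proof -
  obtain M where M: "\<And>t z. \<bar>u t z\<bar> \<le> M" using assms by (rule bc_bounded) blast
  show ?thesis unfolding split_def
  proof (rule continuous_on_sequentiallyI)
    fix X :: "nat \<Rightarrow> real \<times> ('a \<times> 'a)" and a assume X: "X \<longlonglongrightarrow> a"
    show "(\<lambda>n. refresh_mean (u (fst (X n))) (snd (X n))) \<longlonglongrightarrow> refresh_mean (u (fst a)) (snd a)"
      unfolding refresh_mean_def
    proof (rule integral_dominated_convergence[where w="\<lambda>_. M"])
      have "continuous_on UNIV (\<lambda>y. u (fst y) (refresh \<alpha> x (snd y)))" for x
        by (intro bc_compose[OF assms] continuous_intros)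
      from continuous_on_tendsto_compose[OF this X]
      show "AE x in \<gamma>. (\<lambda>n. u (fst (X n)) (refresh \<alpha> x (snd (X n)))) \<longlonglongrightarrow> u (fst a) (refresh \<alpha> x (snd a))"
        by simp
    qed (auto intro!: refresh_measurable bc_slice[OF assms] M)
  qed
qed

lemma continuous_on_jump:
  assumes "bc u" shows "continuous_on UNIV (\<lambda>(t, z). jump (u t) z)"
proof -
  obtain M where M: "\<And>t z. \<bar>u t z\<bar> \<le> M" using assms by (rule bc_bounded) blast
  show ?thesis
    using continuous_on_add[OF continuous_on_bounce_term[OF bc_continuous[OF assms] M]
        continuous_on_mult[OF continuous_on_const[of _ r] continuous_on_refresh_mean[OF assms]]]
    by (simp add: split_def jump_def)
qed

lemma continuous_on_jump_compose:
  assumes "bc u" "continuous_on S g" "continuous_on S h"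
  shows "continuous_on S (\<lambda>x. jump (u (g x)) (h x))"
  using continuous_on_compose2[OF continuous_on_jump[OF assms(1)] continuous_on_Pair[OF assms(2,3)]]
  by simp

lemma jump_add: "bc (\<lambda>_. f) \<Longrightarrow> bc (\<lambda>_. g) \<Longrightarrow> jump (\<lambda>z. f z + g z) z = jump f z + jump g z"
  by (simp add: jump_def refresh_mean_add algebra_simps)

lemma jump_cmult: "jump (\<lambda>z. c * f z) z = c * jump f z"
  by (simp add: jump_def refresh_mean_cmult algebra_simps)

lemma jump_diff: "bc (\<lambda>_. f) \<Longrightarrow> bc (\<lambda>_. g) \<Longrightarrow> jump (\<lambda>z. f z - g z) z = jump f z - jump g z"
  using jump_add[of f "\<lambda>z. -1 * g z" z] bc_cmult[of "\<lambda>_. g" "-1"] jump_cmult[of "-1" g z] by simp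

lemma jump_const: "jump (\<lambda>z. c) z = c * rate z"
  by (simp add: jump_def rate_def refresh_mean_const algebra_simps)

lemma jump_mono:
  "bc (\<lambda>_. f) \<Longrightarrow> bc (\<lambda>_. g) \<Longrightarrow> (\<And>z. f z \<le> g z) \<Longrightarrow> jump f z \<le> jump g z"
  unfolding jump_def using r_pos bounce_rate_nonneg[of z]
  by (intro add_mono mult_left_mono refresh_mean_mono) auto

lemma jump_abs_le:
  assumes "bc (\<lambda>_. f)" "bc (\<lambda>_. g)" "\<And>z. \<bar>f z\<bar> \<le> g z" shows "\<bar>jump f z\<bar> \<le> jump g z"
proof -
  have "jump f z \<le> jump g z" using assms(3) by (intro jump_mono assms) (simp add: abs_le_iff)
  moreover have "jump (\<lambda>z. -1 * f z) z \<le> jump g z"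
    using assms(3) by (intro jump_mono bc_cmult assms) (simp add: abs_le_iff)
  ultimately show ?thesis unfolding jump_cmult by simp
qed

lemma continuous_on_total_rate [continuous_intros]:
  "continuous_on S g \<Longrightarrow> continuous_on S (\<lambda>x. rate (g x))"
  unfolding rate_def by (intro continuous_intros)

lemma hazard_max: "hazard t z = integral {0..max 0 t} (\<lambda>s. bounce_rate U (flow s z))"
  by (cases "0 \<le> t") (simp_all add: hazard_def)

lemma hazard_nonneg: "0 \<le> hazard t z"
  unfolding hazard_def
  by (intro Henstock_Kurzweil_Integration.integral_nonneg integrable_continuous_interval
      continuous_intros bounce_rate_nonneg)

lemma continuous_on_hazard: "continuous_on UNIV (\<lambda>(t, z). hazard t z)"
  unfolding hazard_max split_def
  by (intro continuous_on_integral_upto) (auto simp: split_def intro!: continuous_intros)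

lemma continuous_on_surv [continuous_intros]:
  assumes "continuous_on S g" "continuous_on S h"
  shows "continuous_on S (\<lambda>x. surv (g x) (h x))"
proof -
  have "continuous_on S (\<lambda>x. hazard (g x) (h x))"
    using continuous_on_compose2[OF continuous_on_hazard continuous_on_Pair[OF assms]] by simp
  then show ?thesis unfolding surv_def by (intro continuous_intros assms)
qed

lemma surv_pos: "0 < surv t z" and surv_0 [simp]: "surv 0 z = 1"
  by (simp_all add: surv_def hazard_def)

lemma surv_le_1: "0 \<le> t \<Longrightarrow> surv t z \<le> 1"
  using hazard_nonneg[of t z] mult_nonneg_nonneg[OF less_imp_le[OF r_pos], of t] by (simp add: surv_def)

lemma surv_derivative:
  assumes "s \<in> {0..t}"
  shows "((\<lambda>s. surv s z) has_real_derivative - rate (flow s z) * surv s z) (at s within {0..t})"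
proof -
  have "((\<lambda>s. hazard s z) has_real_derivative bounce_rate U (flow s z)) (at s within {0..t})"
    unfolding hazard_def using assms
    by (intro integral_has_real_derivative continuous_intros)
  then show ?thesis unfolding surv_def
    by (auto intro!: derivative_eq_intros simp: rate_def)
qed

text \<open>
  Integration by parts against the survival function. With \<open>g = 1\<close> it says that the stage either
  survives or ends; exponential \<open>g\<close> gives the mass available to Lyapunov functions, and
  \<open>g = f \<circ> flow\<close> the boundary terms in Dynkin's formula.
\<close>

lemma surv_parts:
  assumes "0 \<le> t" "\<And>s. s \<in> {0..t} \<Longrightarrow> (g has_real_derivative g' s) (at s within {0..t})"
  shows "((\<lambda>s. surv s z * (rate (flow s z) * g s - g' s)) has_integral g 0 - surv t z * g t) {0..t}"
proof -
  have "((\<lambda>s. - (surv s z * (rate (flow s z) * g s - g' s))) has_integral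
      surv t z * g t - surv 0 z * g 0) {0..t}"
    using assms
    by (intro fundamental_theorem_of_calculus)
      (auto intro!: derivative_eq_intros surv_derivative
        simp: has_real_derivative_iff_has_vector_derivative[symmetric] algebra_simps)
  from has_integral_neg[OF this] show ?thesis by simp
qed

lemma surv_rate_integral:
  assumes "0 \<le> t"
  shows "((\<lambda>s. surv s z * rate (flow s z)) has_integral 1 - surv t z) {0..t}"
  using surv_parts[OF assms, of "\<lambda>_. 1" "\<lambda>_. 0" z] by simp

lemma continuous_on_renewal_integrand:
  "bc u \<Longrightarrow> continuous_on S (\<lambda>s. surv s z * jump (u (t - s)) (flow s z))"
  by (intro continuous_intros continuous_on_jump_compose)

lemma renewal_integrable:
  "bc u \<Longrightarrow> (\<lambda>s. surv s z * jump (u (t - s)) (flow s z)) integrable_on {0..t}"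
  by (intro integrable_continuous_interval continuous_on_renewal_integrand)

lemma renewal_integral_mono:
  assumes "bc u" "bc v" "\<And>s z. 0 \<le> s \<Longrightarrow> s \<le> t \<Longrightarrow> u s z \<le> v s z"
  shows "renewal_integral u t z \<le>
    renewal_integral v t z"
  using assms(3)
  by (intro integral_le renewal_integrable[OF assms(1)] renewal_integrable[OF assms(2)] mult_left_mono
      jump_mono[OF bc_at[OF assms(1)] bc_at[OF assms(2)]] less_imp_le[OF surv_pos]) auto

lemma renewal_add:
  assumes "bc u" "bc v"
  shows "renewal (\<lambda>z. f z + g z) (\<lambda>t z. u t z + v t z) t z = renewal f u t z + renewal g v t z"
  unfolding renewal_def
  by (simp add: jump_add[OF bc_at[OF assms(1)] bc_at[OF assms(2)]] distrib_left
      Henstock_Kurzweil_Integration.integral_add[OF renewal_integrable[OF assms(1)] renewal_integrable[OF assms(2)]])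

lemma renewal_cmult: "renewal (\<lambda>z. c * f z) (\<lambda>t z. c * u t z) t z = c * renewal f u t z"
proof -
  have "integral {0..t} (\<lambda>s. surv s z * (c * jump (u (t - s)) (flow s z))) =
      c * renewal_integral u t z"
    by (subst integral_mult_right[symmetric]) (simp add: algebra_simps)
  then show ?thesis by (simp add: renewal_def jump_cmult algebra_simps)
qed

lemma renewal_one: "0 \<le> t \<Longrightarrow> renewal (\<lambda>_. c) (\<lambda>_ _. c) t z = c"
  using integral_unique[OF has_integral_mult_right[OF surv_rate_integral[of t z], of c]]
  by (simp add: renewal_def jump_const algebra_simps)

lemma renewal_mono:
  assumes "bc u" "bc v" "\<And>z. f z \<le> g z" "\<And>s z. 0 \<le> s \<Longrightarrow> s \<le> t \<Longrightarrow> u s z \<le> v s z"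
  shows "renewal f u t z \<le> renewal g v t z"
  unfolding renewal_def
  by (intro add_mono mult_left_mono renewal_integral_mono assms less_imp_le[OF surv_pos])

lemma renewal_abs_le:
  assumes "bc u" "\<And>z. \<bar>f z\<bar> \<le> M" "\<And>t z. \<bar>u t z\<bar> \<le> M" "0 \<le> t"
  shows "\<bar>renewal f u t z\<bar> \<le> M"
proof -
  have "renewal f u t z \<le> renewal (\<lambda>_. M) (\<lambda>_ _. M) t z"
    using assms(2,3) by (intro renewal_mono assms(1) bc_const) (auto simp: abs_le_iff)
  moreover have "renewal (\<lambda>_. - M) (\<lambda>_ _. - M) t z \<le> renewal f u t z"
    using assms(2,3) by (intro renewal_mono assms(1) bc_const) (auto simp: abs_le_iff minus_le_iff)
  ultimately show ?thesis by (simp add: renewal_one assms(4))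
qed

lemma bc_renewal:
  assumes u: "bc u" and f: "bc (\<lambda>_. f)" shows "bc (\<lambda>t. renewal f u (max 0 t))"
proof -
  obtain M where M: "0 \<le> M" "\<And>t z. \<bar>u t z\<bar> \<le> M" using u by (rule bc_bounded) blast
  obtain M' where M': "0 \<le> M'" "\<And>z. \<bar>f z\<bar> \<le> M'" using f by (rule bc_bounded) blast
  show ?thesis
  proof (rule bcI)
    have "\<bar>f z\<bar> \<le> M + M'" "\<bar>u t z\<bar> \<le> M + M'" for t z
      using M(1) M(2)[of t z] M'(1) M'(2)[of z] by auto
    then show "\<bar>renewal f u (max 0 t) z\<bar> \<le> M + M'" for t z
      by (intro renewal_abs_le u) auto
    have "continuous_on UNIV f" using f by (simp add: bc_fun)
    note cf = continuous_on_compose2[OF this _ subset_UNIV]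
    have "continuous_on UNIV (\<lambda>x::real \<times> ('a \<times> 'a). integral {0..max 0 (fst x)}
        (\<lambda>s. surv s (snd x) * jump (u (max 0 (fst x) - s)) (flow s (snd x))))"
    proof (rule continuous_on_integral_upto)
      show "continuous_on UNIV (\<lambda>(x, s). surv s (snd x) * jump (u (max 0 (fst x) - s)) (flow s (snd x)))"
        unfolding split_def by (intro continuous_intros continuous_on_jump_compose[OF u])
    qed (auto intro!: continuous_intros)
    then show "continuous_on UNIV (\<lambda>(t, z). renewal f u (max 0 t) z)"
      unfolding renewal_def split_def by (intro continuous_intros cf)
  qed
qed

text \<open>
  Started from zero, so that the \<open>n\<close>-th iterate collects the paths with fewer than \<open>n\<close> jumps.
\<close>

primrec iter :: "('a \<times> 'a \<Rightarrow> real) \<Rightarrow> nat \<Rightarrow> real \<Rightarrow> 'a \<times> 'a \<Rightarrow> real" where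
  "iter f 0 = (\<lambda>t z. 0)"
| "iter f (Suc n) = (\<lambda>t. renewal f (iter f n) (max 0 t))"

lemma bc_iter: "bc (\<lambda>_. f) \<Longrightarrow> bc (iter f n)"
  by (induction n) (auto intro: bc_const bc_renewal)

lemma iter_max: "iter f n (max 0 t) = iter f n t"
  by (cases n) auto

lemma iter_lin:
  assumes "bc (\<lambda>_. f)" "bc (\<lambda>_. g)"
  shows "iter (\<lambda>z. a * f z + b * g z) n t z = a * iter f n t z + b * iter g n t z"
proof (induction n arbitrary: t z)
  case (Suc n)
  then have "iter (\<lambda>z. a * f z + b * g z) n = (\<lambda>t z. a * iter f n t z + b * iter g n t z)" by blast
  then show ?case using assms
    by (simp add: renewal_add[OF bc_cmult bc_cmult] bc_iter renewal_cmult)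
qed simp

lemma iter_mono: "bc (\<lambda>_. f) \<Longrightarrow> bc (\<lambda>_. g) \<Longrightarrow> (\<And>z. f z \<le> g z) \<Longrightarrow> iter f n t z \<le> iter g n t z"
  by (induction n arbitrary: t z) (auto intro!: renewal_mono bc_iter)

lemma iter_const_0: "iter (\<lambda>_. 0) n t z = 0"
  using iter_lin[of "\<lambda>_. 0" "\<lambda>_. 0" 0 0 n t z] by (simp add: bc_const)

lemma iter_one_bounds: "0 \<le> iter (\<lambda>_. 1) n t z" "iter (\<lambda>_. 1) n t z \<le> 1"
proof -
  show "0 \<le> iter (\<lambda>_. 1) n t z"
    using iter_mono[of "\<lambda>_. 0" "\<lambda>_. 1" n t z] by (simp add: iter_const_0 bc_const)
  show "iter (\<lambda>_. 1) n t z \<le> 1"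
  proof (induction n arbitrary: t z)
    case (Suc n)
    have "renewal (\<lambda>_. 1) (iter (\<lambda>_. 1) n) (max 0 t) z \<le> renewal (\<lambda>_. 1) (\<lambda>_ _. 1) (max 0 t) z"
      by (intro renewal_mono bc_iter bc_const Suc.IH) auto
    then show ?case by (simp add: renewal_one)
  qed simp
qed

text \<open>For the process this is the probability that the \<open>n\<close>-th jump happens by time \<open>t\<close>.\<close>

definition tail :: "nat \<Rightarrow> real \<Rightarrow> 'a \<times> 'a \<Rightarrow> real" where
  "tail n t z = 1 - iter (\<lambda>_. 1) n t z"

lemma tail_bounds: "0 \<le> tail n t z" "tail n t z \<le> 1"
  using iter_one_bounds[of n t z] by (auto simp: tail_def)

lemma bc_tail: "bc (tail n)"
  unfolding tail_def[abs_def] by (intro bc_diff bc_const bc_iter)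

lemma tail_max: "tail n (max 0 t) = tail n t"
  by (simp add: tail_def fun_eq_iff iter_max)

lemma tail_0: "tail 0 t z = 1"
  by (simp add: tail_def)

lemma tail_Suc:
  assumes "0 \<le> t"
  shows "tail (Suc n) t z = renewal_integral (tail n) t z"
proof -
  have "tail (Suc n) t z = renewal (\<lambda>_. 1) (\<lambda>_ _. 1) t z - renewal (\<lambda>_. 1) (iter (\<lambda>_. 1) n) t z"
    using assms by (simp add: tail_def renewal_one)
  also have "\<dots> = integral {0..t} (\<lambda>s. surv s z * jump (\<lambda>_. 1) (flow s z))
      - renewal_integral (iter (\<lambda>_. 1) n) t z"
    by (simp add: renewal_def)
  also have "\<dots> = integral {0..t} (\<lambda>s. surv s z * jump (\<lambda>_. 1) (flow s z)
      - surv s z * jump (iter (\<lambda>_. 1) n (t - s)) (flow s z))"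
    by (intro Henstock_Kurzweil_Integration.integral_diff[symmetric]
        renewal_integrable[where u="\<lambda>_ _. 1"] renewal_integrable bc_iter bc_const)
  also have "\<dots> = renewal_integral (tail n) t z"
    unfolding tail_def[abs_def]
    by (simp add: jump_diff bc_const bc_at[OF bc_iter] right_diff_distrib)
  finally show ?thesis .
qed

section \<open>Lyapunov weights: no explosion and no mass coming from infinity\<close>

text \<open>
  Under the flow up to time \<open>s\<close> and under a refreshment in the mean, the weight and its inverse
  grow at most by the factors \<open>exp s\<close> and \<open>growth\<close>. One constant serves both.
\<close>

definition weight :: "'a \<times> 'a \<Rightarrow> real" where
  "weight z = 1 + norm (fst z) + norm (snd z)"

definition growth :: real where
  "growth = (1 + (\<integral>x. norm x \<partial>\<gamma>)) / \<alpha>"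

lemma weight_ge_1: "1 \<le> weight z" and weight_pos: "0 < weight z"
  by (simp_all add: weight_def add_nonneg_nonneg add_pos_nonneg)

lemma norm_le_weight: "norm z \<le> weight z" "weight z \<le> 1 + 2 * norm z"
  using norm_Pair_le[of "fst z" "snd z"] norm_fst_le[of "fst z" "snd z"] norm_snd_le[of "snd z" "fst z"]
  by (auto simp: weight_def)

lemma weight_bounce: "weight (bounce U z) = weight z"
  by (simp add: weight_def)

lemma weight_flow_le:
  assumes "0 \<le> s" shows "weight (flow s z) \<le> exp s * weight z" "weight z \<le> exp s * weight (flow s z)"
proof -
  have "norm (fst z + s *\<^sub>R snd z) \<le> norm (fst z) + s * norm (snd z)"
    using norm_triangle_ineq[of "fst z" "s *\<^sub>R snd z"] assms by simp
  then have "weight (flow s z) \<le> (1 + s) * weight z"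
    using assms mult_nonneg_nonneg[OF assms norm_ge_zero[of "fst z"]]
    unfolding weight_def fst_flow snd_flow distrib_left distrib_right mult_1 mult_1_right by linarith
  also have "\<dots> \<le> exp s * weight z"
    using assms weight_pos[of z] exp_ge_add_one_self[of s] by (intro mult_right_mono) auto
  finally show "weight (flow s z) \<le> exp s * weight z" .
  have "norm (fst z) \<le> norm (fst z + s *\<^sub>R snd z) + s * norm (snd z)"
    using norm_triangle_ineq4[of "fst z + s *\<^sub>R snd z" "s *\<^sub>R snd z"] assms by simp
  then have "weight z \<le> (1 + s) * weight (flow s z)"
    using assms mult_nonneg_nonneg[OF assms norm_ge_zero[of "fst z + s *\<^sub>R snd z"]]
    unfolding weight_def fst_flow snd_flow distrib_left distrib_right mult_1 mult_1_right by linarith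
  also have "\<dots> \<le> exp s * weight (flow s z)"
    using assms weight_pos[of "flow s z"] exp_ge_add_one_self[of s] by (intro mult_right_mono) auto
  finally show "weight z \<le> exp s * weight (flow s z)" .
qed

lemma growth_ge_1: "1 \<le> growth" and growth_pos: "0 < growth"
proof -
  have "0 \<le> (\<integral>x. norm x \<partial>\<gamma>)" by (rule integral_nonneg_AE) simp
  with \<alpha> have "\<alpha> \<le> 1 + (\<integral>x. norm x \<partial>\<gamma>)" by linarith
  then show "1 \<le> growth" using \<alpha> by (simp add: growth_def field_simps)
  then show "0 < growth" by simp
qed

lemma weight_refresh_le: "weight (refresh \<alpha> x z) \<le> (1 + norm x) * weight z"
proof -
  have "norm (\<alpha> *\<^sub>R snd z + \<beta> *\<^sub>R x) \<le> \<alpha> * norm (snd z) + \<beta> * norm x"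
    using norm_triangle_ineq[of "\<alpha> *\<^sub>R snd z" "\<beta> *\<^sub>R x"] \<alpha> \<beta> by simp
  also have "\<dots> \<le> 1 * norm (snd z) + 1 * norm x"
    using \<alpha> \<beta> by (intro add_mono mult_right_mono) auto
  finally have "weight (refresh \<alpha> x z) \<le> weight z + norm x"
    by (simp add: weight_def refresh_eq)
  also have "norm x \<le> norm x * weight z"
    using weight_ge_1[of z] by (simp add: mult_le_cancel_left1)
  finally show ?thesis by (simp add: algebra_simps)
qed

text \<open>
  A large velocity stays large under a refreshment, unless the fresh velocity is large too: this
  is the role of \<open>\<alpha> > 0\<close>.
\<close>

lemma weight_le_refresh: "weight z \<le> (1 + norm x) / \<alpha> * weight (refresh \<alpha> x z)"
proof -
  let ?w = "weight (refresh \<alpha> x z)"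
  have "norm (\<alpha> *\<^sub>R snd z) \<le> norm (\<alpha> *\<^sub>R snd z + \<beta> *\<^sub>R x) + norm (\<beta> *\<^sub>R x)"
    using norm_triangle_ineq4[of "\<alpha> *\<^sub>R snd z + \<beta> *\<^sub>R x" "\<beta> *\<^sub>R x"] by simp
  moreover have "norm (\<beta> *\<^sub>R x) \<le> norm x"
    using \<beta> mult_right_mono[OF \<beta>(2), of "norm x"] by simp
  ultimately have "\<alpha> * norm (snd z) \<le> norm (\<alpha> *\<^sub>R snd z + \<beta> *\<^sub>R x) + norm x"
    using \<alpha> by simp
  moreover have "\<alpha> * (1 + norm (fst z)) \<le> 1 * (1 + norm (fst z))"
    using \<alpha> by (intro mult_right_mono) auto
  ultimately have "\<alpha> * weight z \<le> ?w + norm x"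
    by (simp add: weight_def refresh_eq algebra_simps)
  also have "norm x \<le> norm x * ?w"
    using weight_ge_1[of "refresh \<alpha> x z"] by (simp add: mult_le_cancel_left1)
  finally have "\<alpha> * weight z \<le> (1 + norm x) * ?w" by (simp add: algebra_simps)
  then show ?thesis using \<alpha> by (simp add: field_simps)
qed

lemma continuous_on_weight: "continuous_on UNIV weight"
  unfolding weight_def by (intro continuous_intros)

lemma
  shows refresh_mean_weight: "refresh_mean weight z \<le> growth * weight z"
    and integrable_refresh_weight: "integrable \<gamma> (\<lambda>x. weight (refresh \<alpha> x z))"
proof -
  have i: "integrable \<gamma> (\<lambda>x. (1 + norm x) * weight z)"
    using moment by (intro integrable_mult_left Bochner_Integration.integrable_add) auto
  show j: "integrable \<gamma> (\<lambda>x. weight (refresh \<alpha> x z))"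
  proof (rule Bochner_Integration.integrable_bound[OF i refresh_measurable[OF continuous_on_weight]])
    show "AE x in \<gamma>. norm (weight (refresh \<alpha> x z)) \<le> norm ((1 + norm x) * weight z)"
    proof (intro AE_I2)
      fix x
      show "norm (weight (refresh \<alpha> x z)) \<le> norm ((1 + norm x) * weight z)"
        using weight_refresh_le[of x z] weight_pos[of "refresh \<alpha> x z"] by simp
    qed
  qed
  have "refresh_mean weight z \<le> (\<integral>x. (1 + norm x) * weight z \<partial>\<gamma>)"
    unfolding refresh_mean_def by (intro integral_mono j i weight_refresh_le)
  also have "\<dots> = (1 + (\<integral>x. norm x \<partial>\<gamma>)) * weight z"
    using moment by (simp add: G.prob_space)
  also have "\<dots> \<le> growth * weight z"
  proof (intro mult_right_mono)
    have "0 \<le> (\<integral>x. norm x \<partial>\<gamma>)" by simp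
    then have "(1 + (\<integral>x. norm x \<partial>\<gamma>)) * \<alpha> \<le> 1 + (\<integral>x. norm x \<partial>\<gamma>)"
      using mult_left_mono[OF \<alpha>(2), of "1 + (\<integral>x. norm x \<partial>\<gamma>)"] by simp
    then show "1 + (\<integral>x. norm x \<partial>\<gamma>) \<le> growth"
      using \<alpha> by (simp add: growth_def field_simps)
    show "0 \<le> weight z" by (rule less_imp_le[OF weight_pos])
  qed
  finally show "refresh_mean weight z \<le> growth * weight z" .
qed

lemma bc_inverse_weight: "bc (\<lambda>_ z. 1 / weight z)"
  unfolding bc_fun
proof (intro conjI exI[of _ 1] allI)
  show "continuous_on UNIV (\<lambda>z. 1 / weight z)"
    using weight_pos by (intro continuous_intros continuous_on_weight) (metis less_irrefl)
  show "\<bar>1 / weight z\<bar> \<le> 1" for z using weight_ge_1[of z] by simp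
qed

lemma refresh_mean_inverse_weight: "refresh_mean (\<lambda>z. 1 / weight z) z \<le> growth * (1 / weight z)"
proof -
  have i: "integrable \<gamma> (\<lambda>x. (1 + norm x) / \<alpha> * (1 / weight z))"
    using moment by (intro integrable_mult_left integrable_divide Bochner_Integration.integrable_add) auto
  have "1 / weight (refresh \<alpha> x z) \<le> (1 + norm x) / \<alpha> * (1 / weight z)" for x
  proof -
    have "1 = weight z * (1 / weight z)" using weight_pos[of z] by simp
    also have "\<dots> \<le> (1 + norm x) / \<alpha> * weight (refresh \<alpha> x z) * (1 / weight z)"
      using weight_le_refresh[of z x] weight_pos[of z] by (intro mult_right_mono) auto
    finally have "1 \<le> ((1 + norm x) / \<alpha> * (1 / weight z)) * weight (refresh \<alpha> x z)"
      by (simp add: mult_ac)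
    then show ?thesis using weight_pos[of "refresh \<alpha> x z"] by (simp only: pos_divide_le_eq)
  qed
  then have "refresh_mean (\<lambda>z. 1 / weight z) z \<le> (\<integral>x. (1 + norm x) / \<alpha> * (1 / weight z) \<partial>\<gamma>)"
    unfolding refresh_mean_def by (intro integral_mono refresh_integrable[OF bc_inverse_weight] i)
  also have "\<dots> = growth * (1 / weight z)"
    using moment by (simp add: G.prob_space growth_def)
  finally show ?thesis .
qed

text \<open>
  The discount \<open>exp (- r growth s)\<close> pays for the growth in the mean at refreshments, so that the
  total mass, including the surviving part, stays at \<open>1\<close>.
\<close>

lemma weighted_rate_integral:
  assumes "0 \<le> t"
  shows "((\<lambda>s. surv s z * (exp (- r * growth * s) * (rate (flow s z) + r * growth))) has_integral
      1 - surv t z * exp (- r * growth * t)) {0..t}"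
proof -
  have "((\<lambda>s. exp (- r * growth * s)) has_real_derivative - r * growth * exp (- r * growth * s)) (at s within {0..t})" for s
    by (auto intro!: derivative_eq_intros)
  from surv_parts[OF assms this, of z] show ?thesis by (simp add: algebra_simps)
qed

text \<open>
  Before the process leaves \<open>{weight < m}\<close> its jump rate is at most \<open>\<Lambda> + r\<close>, which accounts
  for the Poisson-like term; the other term bounds the probability of leaving.
\<close>

lemma tail_le:
  assumes m: "0 < m" and \<Lambda>: "0 \<le> \<Lambda>" "\<And>y. weight y < m \<Longrightarrow> bounce_rate U y \<le> \<Lambda>" and t: "0 \<le> t"
  shows "tail n t z \<le> exp ((1 + r * growth) * t) * weight z / m + ((\<Lambda> + r) * t) ^ n / fact n"
  using t
proof (induction n arbitrary: t z)
  case 0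
  then show ?case using weight_pos[of z] m tail_bounds(2)[of 0 t z] by (simp add: add_increasing)
next
  case (Suc n)
  let ?c = "1 + r * growth"
  define K where "K = \<Lambda> + r"
  have K: "0 \<le> K" using \<Lambda> r_pos by (simp add: K_def)
  have step: "surv s z * jump (tail n (t - s)) (flow s z) \<le>
      exp (?c * t) * weight z / m * (surv s z * (exp (- r * growth * s) * (rate (flow s z) + r * growth)))
      + K * (K * (t - s)) ^ n / fact n" if s: "s \<in> {0..t}" for s
  proof -
    define y where "y = flow s z"
    define e where "e = exp (?c * (t - s)) / m"
    define k where "k = (K * (t - s)) ^ n / fact n"
    have e0: "0 \<le> e" and k0: "0 \<le> k" using m K s by (auto simp: e_def k_def)
    have IH: "tail n (t - s) x \<le> e * weight x + k" for x
      using Suc.IH[of "t - s" x] s by (simp add: e_def k_def K_def)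
    have "bounce_rate U y * tail n (t - s) (bounce U y) \<le> bounce_rate U y * (e * weight y) + \<Lambda> * k"
      \<comment> \<open>where the rate may exceed \<open>\<Lambda>\<close>, already \<open>e * weight y\<close> is at least \<open>1\<close>\<close>
    proof (cases "weight y < m")
      case True
      have "bounce_rate U y * tail n (t - s) (bounce U y) \<le> bounce_rate U y * (e * weight y + k)"
        using IH[of "bounce U y"] by (intro mult_left_mono bounce_rate_nonneg) (simp add: weight_bounce)
      also have "bounce_rate U y * k \<le> \<Lambda> * k" using \<Lambda>(2)[OF True] k0 by (rule mult_right_mono)
      then have "bounce_rate U y * (e * weight y + k) \<le> bounce_rate U y * (e * weight y) + \<Lambda> * k"
        by (simp add: algebra_simps)
      finally show ?thesis .
    next
      case False
      have "0 \<le> ?c * (t - s)" using s r_pos growth_pos by auto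
      then have "1 / m \<le> e" using m by (simp add: e_def divide_right_mono)
      then have "1 / m * m \<le> e * weight y" using False m e0 by (intro mult_mono) auto
      then have "tail n (t - s) (bounce U y) \<le> e * weight y"
        using tail_bounds(2)[of n "t - s" "bounce U y"] m by simp
      then have "bounce_rate U y * tail n (t - s) (bounce U y) \<le> bounce_rate U y * (e * weight y)"
        by (intro mult_left_mono bounce_rate_nonneg)
      then show ?thesis using \<Lambda>(1) k0 by (simp add: add_increasing2)
    qed
    moreover have "refresh_mean (tail n (t - s)) y \<le> e * (growth * weight y) + k"
    proof -
      have "refresh_mean (tail n (t - s)) y \<le> (\<integral>x. e * weight (refresh \<alpha> x y) + k \<partial>\<gamma>)"
        unfolding refresh_mean_def
        by (intro integral_mono refresh_integrable[OF bc_at[OF bc_tail]] Bochner_Integration.integrable_add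
            integrable_mult_right integrable_refresh_weight IH) auto
      also have "\<dots> = e * refresh_mean weight y + k"
        using integrable_refresh_weight[of y] by (simp add: refresh_mean_def G.prob_space)
      also have "\<dots> \<le> e * (growth * weight y) + k"
        using e0 refresh_mean_weight by (intro add_mono mult_left_mono) auto
      finally show ?thesis .
    qed
    then have "r * refresh_mean (tail n (t - s)) y \<le> r * (e * (growth * weight y) + k)"
      using r_pos by (intro mult_left_mono) auto
    ultimately have "jump (tail n (t - s)) y \<le> e * weight y * (bounce_rate U y + r * growth) + K * k"
      by (simp add: jump_def K_def algebra_simps)
    also have "e * weight y * (bounce_rate U y + r * growth) \<le> e * (exp s * weight z) * (rate y + r * growth)"
      using weight_flow_le(1)[of s z] s e0 bounce_rate_nonneg[of y] r_pos growth_pos weight_pos[of z]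
      by (intro mult_mono mult_left_mono) (auto simp: y_def rate_def)
    finally have j: "jump (tail n (t - s)) y \<le> e * (exp s * weight z) * (rate y + r * growth) + K * k" by simp
    have "surv s z * jump (tail n (t - s)) y \<le> surv s z * (e * (exp s * weight z) * (rate y + r * growth)) + 1 * (K * k)"
      using mult_left_mono[OF j less_imp_le[OF surv_pos[of s z]]] s K k0
        mult_right_mono[OF surv_le_1[of s z], of "K * k"]
      by (simp add: distrib_left)
    also have "exp (?c * (t - s)) * exp s = exp (?c * t) * exp (- r * growth * s)"
      by (simp add: exp_add[symmetric] algebra_simps)
    then have "e * (exp s * weight z) = exp (?c * t) * weight z / m * exp (- r * growth * s)"
      by (simp add: e_def)
    finally show ?thesis by (simp add: y_def k_def algebra_simps add_divide_distrib)
  qed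
  have "((\<lambda>s. - ((K * (t - s)) ^ Suc n / fact (Suc n))) has_vector_derivative (K * (K * (t - s)) ^ n / fact n))
      (at s within {0..t})" for s
  proof -
    have "((\<lambda>s. - ((K * (t - s)) ^ Suc n / fact (Suc n))) has_real_derivative
        (- (real (Suc n) * (K * (t - s)) ^ n * (- K)) / fact (Suc n))) (at s within {0..t})"
      by (auto intro!: derivative_eq_intros simp del: power_Suc fact_Suc)
    moreover have "- (real (Suc n) * (K * (t - s)) ^ n * (- K)) / fact (Suc n) = K * (K * (t - s)) ^ n / fact n"
      by (simp del: of_nat_Suc)
    ultimately show ?thesis by (simp only: has_real_derivative_iff_has_vector_derivative)
  qed
  from fundamental_theorem_of_calculus[OF Suc.prems this]
  have "((\<lambda>s. K * (K * (t - s)) ^ n / fact n) has_integral (K * t) ^ Suc n / fact (Suc n)) {0..t}"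
    by simp
  from has_integral_add[OF has_integral_mult_right[OF weighted_rate_integral[OF Suc.prems, of z],
      of "exp (?c * t) * weight z / m"] this]
  have "renewal_integral (tail n) t z \<le>
      exp (?c * t) * weight z / m * (1 - surv t z * exp (- r * growth * t)) + (K * t) ^ Suc n / fact (Suc n)"
    using step
    by (intro has_integral_le[OF integrable_integral[OF renewal_integrable[OF bc_tail]]]) auto
  also have "\<dots> \<le> exp (?c * t) * weight z / m * 1 + (K * t) ^ Suc n / fact (Suc n)"
    using m weight_pos[of z] surv_pos[of t z] by (intro add_mono mult_left_mono) auto
  finally show ?case using tail_Suc[OF Suc.prems] by (simp add: K_def)
qed

lemma tail_tendsto_0: "(\<lambda>n. tail n t z) \<longlonglongrightarrow> 0"
proof (rule LIMSEQ_I)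
  fix \<epsilon> :: real assume \<epsilon>: "0 < \<epsilon>"
  define t' where "t' = max 0 t"
  define A where "A = exp ((1 + r * growth) * t') * weight z"
  define m where "m = 2 * A / \<epsilon>"
  have A: "0 < A" using weight_pos by (simp add: A_def)
  then have m: "0 < m" using \<epsilon> by (simp add: m_def)
  have "continuous_on (cball 0 m) (bounce_rate U)" by (intro continuous_on_rate continuous_on_id)
  then obtain \<Lambda> where "\<And>y. y \<in> cball 0 m \<Longrightarrow> \<bar>bounce_rate U y\<bar> \<le> \<Lambda>"
    using compact_continuous_bounded[OF compact_cball] by blast
  then have \<Lambda>: "norm y \<le> m \<Longrightarrow> \<bar>bounce_rate U y\<bar> \<le> \<Lambda>" for y by simp
  have \<Lambda>0: "0 \<le> \<Lambda>" using \<Lambda>[of 0] m by simp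
  have \<Lambda>': "bounce_rate U y \<le> \<Lambda>" if "weight y < m" for y
    using \<Lambda>[of y] norm_le_weight(1)[of y] that by simp
  have "(\<lambda>n. inverse (fact n) * ((\<Lambda> + r) * t') ^ n) \<longlonglongrightarrow> 0"
    by (rule summable_LIMSEQ_zero[OF summable_exp])
  then have "\<forall>\<^sub>F n in sequentially. inverse (fact n) * ((\<Lambda> + r) * t') ^ n < \<epsilon> / 2"
    using \<epsilon> by (intro order_tendstoD(2)) auto
  then obtain n0 where n0: "\<And>n. n \<ge> n0 \<Longrightarrow> inverse (fact n) * ((\<Lambda> + r) * t') ^ n < \<epsilon> / 2"
    by (auto simp: eventually_sequentially)
  show "\<exists>no. \<forall>n\<ge>no. norm (tail n t z - 0) < \<epsilon>"
  proof (intro exI allI impI)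
    fix n assume "n \<ge> n0"
    have "tail n t z = tail n t' z" by (simp add: t'_def tail_max)
    also have "\<dots> \<le> A / m + ((\<Lambda> + r) * t') ^ n / fact n"
      unfolding A_def using m \<Lambda>0 \<Lambda>' by (intro tail_le) (auto simp: t'_def)
    also have "A / m = \<epsilon> / 2" using A by (simp add: m_def)
    also have "((\<Lambda> + r) * t') ^ n / fact n < \<epsilon> / 2"
      using n0[OF \<open>n \<ge> n0\<close>] by (simp add: field_simps)
    finally show "norm (tail n t z - 0) < \<epsilon>" using tail_bounds(1)[of n t z] by simp
  qed
qed

text \<open>
  The right-hand side is a supersolution: the renewal operator with initial value \<open>\<bar>f\<bar>\<close> maps it to
  something smaller.
\<close>

lemma iter_decay:
  assumes f: "bc (\<lambda>_. f)" and M: "\<And>z. \<bar>f z\<bar> \<le> M * (1 / weight z)" and t: "0 \<le> t"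
  shows "\<bar>iter f n t z\<bar> \<le> M * exp ((1 + r * growth) * t) * (1 / weight z)"
  using t
proof (induction n arbitrary: t z)
  have "0 \<le> M * (1 / weight z)" for z using order_trans[OF abs_ge_zero M] .
  from this[of 0] have M0: "0 \<le> M"
    using weight_pos[of 0] by (metis divide_pos_pos mult_less_0_iff not_le zero_less_one)
  {
    case 0
    then show ?case using M0 weight_pos[of z] by simp
  next
    case (Suc n)
    let ?c = "1 + r * growth"
    let ?E = "M * exp (?c * t) * (1 / weight z)"
    have flow_w: "1 / weight (flow s z) \<le> exp s * (1 / weight z)" if "0 \<le> s" for s
      using weight_flow_le(2)[OF that, of z] weight_pos[of z] weight_pos[of "flow s z"]
      by (simp add: field_simps)
    have step: "\<bar>surv s z * jump (iter f n (t - s)) (flow s z)\<bar> \<le>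
        ?E * (surv s z * (exp (- r * growth * s) * (rate (flow s z) + r * growth)))" if s: "s \<in> {0..t}" for s
    proof -
      define y where "y = flow s z"
      define e where "e = M * exp (?c * (t - s))"
      have e0: "0 \<le> e" using M0 by (simp add: e_def)
      have "\<bar>jump (iter f n (t - s)) y\<bar> \<le> jump (\<lambda>x. e * (1 / weight x)) y"
        using Suc.IH[of "t - s"] s
        by (intro jump_abs_le bc_at[OF bc_iter] bc_cmult f bc_inverse_weight) (auto simp: e_def)
      also have "\<dots> = e * (bounce_rate U y * (1 / weight y) + r * refresh_mean (\<lambda>x. 1 / weight x) y)"
        by (simp only: jump_cmult) (simp add: jump_def weight_bounce)
      also have "\<dots> \<le> e * (bounce_rate U y * (1 / weight y) + r * (growth * (1 / weight y)))"
        using e0 r_pos refresh_mean_inverse_weight[of y] by (intro mult_left_mono add_left_mono) auto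
      also have "\<dots> = e * ((bounce_rate U y + r * growth) * (1 / weight y))"
        by (simp add: algebra_simps)
      also have "\<dots> \<le> e * ((rate y + r * growth) * (exp s * (1 / weight z)))"
        using e0 bounce_rate_nonneg[of y] r_pos growth_pos flow_w[of s] s weight_pos[of y]
        by (intro mult_left_mono mult_mono) (auto simp: rate_def y_def)
      also have "exp (?c * (t - s)) * exp s = exp (?c * t) * exp (- r * growth * s)"
        by (simp add: exp_add[symmetric] algebra_simps)
      then have "e * ((rate y + r * growth) * (exp s * (1 / weight z))) =
          ?E * (exp (- r * growth * s) * (rate y + r * growth))"
        by (simp add: e_def)
      finally have "surv s z * \<bar>jump (iter f n (t - s)) y\<bar> \<le>
          surv s z * (?E * (exp (- r * growth * s) * (rate y + r * growth)))"
        by (intro mult_left_mono less_imp_le[OF surv_pos])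
      then show ?thesis using surv_pos[of s z] by (simp add: abs_mult y_def algebra_simps)
    qed
    have "\<bar>renewal_integral (iter f n) t z\<bar> \<le>
        ?E * (1 - surv t z * exp (- r * growth * t))"
    proof -
      note I = has_integral_mult_right[OF weighted_rate_integral[OF Suc.prems, of z], of ?E]
      show ?thesis
        using integral_norm_bound_integral[OF renewal_integrable[OF bc_iter[OF f]] has_integral_integrable[OF I]]
          step unfolding integral_unique[OF I] real_norm_def by blast
    qed
    moreover have "\<bar>surv t z * f (flow t z)\<bar> \<le> surv t z * (?E * exp (- r * growth * t))"
    proof -
      have "\<bar>f (flow t z)\<bar> \<le> M * (exp t * (1 / weight z))"
        using M[of "flow t z"] mult_left_mono[OF flow_w[OF Suc.prems] M0] by linarith
      also have "\<dots> = ?E * exp (- r * growth * t)"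
        by (simp add: exp_add[symmetric] algebra_simps)
      finally show ?thesis
        unfolding abs_mult using surv_pos[of t z] by (simp only: abs_of_pos mult_left_mono less_imp_le)
    qed
    moreover have "iter f (Suc n) t z = surv t z * f (flow t z)
        + renewal_integral (iter f n) t z"
      using Suc.prems by (simp add: renewal_def)
    ultimately have "\<bar>iter f (Suc n) t z\<bar> \<le> surv t z * (?E * exp (- r * growth * t)) +
        ?E * (1 - surv t z * exp (- r * growth * t))" by linarith
    also have "\<dots> = ?E" by (simp add: algebra_simps)
    finally show ?case .
  }
qed

end

section \<open>The semigroup as the limit of the renewal iteration\<close>

text \<open>
  The interface between the analysis and the process: \<open>P\<close> agrees with the contribution of the paths
  with fewer than \<open>n\<close> jumps up to the mass of the other paths.
\<close>

locale bps_approximation = bps_kernel U \<gamma> r \<alpha>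
  for U :: "'a::euclidean_space \<Rightarrow> real" and \<gamma> r \<alpha> +
  fixes P :: "real \<Rightarrow> ('a \<times> 'a \<Rightarrow> real) \<Rightarrow> 'a \<times> 'a \<Rightarrow> real"
  assumes approx: "0 \<le> t \<Longrightarrow> bc (\<lambda>_. f) \<Longrightarrow> (\<And>z. \<bar>f z\<bar> \<le> M) \<Longrightarrow> \<bar>P t f z - iter f n t z\<bar> \<le> M * tail n t z"
begin

lemma iter_abs_le:
  assumes "bc (\<lambda>_. f)" "\<And>z. \<bar>f z\<bar> \<le> M" shows "\<bar>iter f n t z\<bar> \<le> M"
proof (induction n arbitrary: t z)
  case 0
  show ?case using order_trans[OF abs_ge_zero assms(2)] by simp
next
  case (Suc n)
  show ?case using renewal_abs_le[OF bc_iter[OF assms(1)] assms(2) Suc.IH, of "max 0 t"] by simp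
qed

lemma P_limit:
  assumes "0 \<le> t" "bc (\<lambda>_. f)" shows "(\<lambda>n. iter f n t z) \<longlonglongrightarrow> P t f z"
proof -
  obtain M where M: "\<And>z. \<bar>f z\<bar> \<le> M" using assms(2) by (rule bc_bounded) blast
  have "(\<lambda>n. M * tail n t z) \<longlonglongrightarrow> 0" using tendsto_mult_right_zero[OF tail_tendsto_0] .
  then have "(\<lambda>n. iter f n t z - P t f z) \<longlonglongrightarrow> 0"
    by (rule Lim_null_comparison[rotated])
      (use approx[OF assms M] in \<open>auto simp: abs_minus_commute\<close>)
  then show ?thesis by (simp add: LIM_zero_iff)
qed

lemma P_abs_le:
  assumes "0 \<le> t" "bc (\<lambda>_. f)" "\<And>z. \<bar>f z\<bar> \<le> M" shows "\<bar>P t f z\<bar> \<le> M"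
  by (rule LIMSEQ_le_const2[OF tendsto_rabs[OF P_limit[OF assms(1,2)]]])
    (use iter_abs_le[OF assms(2,3)] in auto)

lemma P_lin:
  assumes "0 \<le> t" "bc (\<lambda>_. f)" "bc (\<lambda>_. g)"
  shows "P t (\<lambda>z. a * f z + b * g z) z = a * P t f z + b * P t g z"
proof (rule LIMSEQ_unique)
  show "(\<lambda>n. iter (\<lambda>z. a * f z + b * g z) n t z) \<longlonglongrightarrow> P t (\<lambda>z. a * f z + b * g z) z"
    by (intro P_limit assms bc_add[OF bc_cmult[OF assms(2)] bc_cmult[OF assms(3)]])
  show "(\<lambda>n. iter (\<lambda>z. a * f z + b * g z) n t z) \<longlonglongrightarrow> a * P t f z + b * P t g z"
    unfolding iter_lin[OF assms(2,3)] by (intro tendsto_intros P_limit assms)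
qed

lemma P_diff:
  assumes "0 \<le> t" "bc (\<lambda>_. f)" "bc (\<lambda>_. g)"
  shows "P t (\<lambda>z. f z - g z) z = P t f z - P t g z"
  using P_lin[OF assms, of 1 "-1"] by simp

lemma P_diff_abs_le:
  assumes "0 \<le> t" "bc (\<lambda>_. f)" "bc (\<lambda>_. g)" "\<And>z. \<bar>f z - g z\<bar> \<le> M"
  shows "\<bar>P t f z - P t g z\<bar> \<le> M"
  using P_abs_le[OF assms(1) bc_diff[OF assms(2,3)] assms(4)] P_diff[OF assms(1-3)] by simp

definition path :: "('a \<times> 'a \<Rightarrow> real) \<Rightarrow> real \<Rightarrow> 'a \<times> 'a \<Rightarrow> real" where
  "path f t = P (max 0 t) f"

lemma path_eq: "0 \<le> t \<Longrightarrow> path f t = P t f"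
  by (simp add: path_def)

text \<open>
  The approximation error \<open>tail n\<close> is a continuous function that tends to zero at each point;
  so it is small on a whole neighbourhood.
\<close>

lemma bc_path:
  assumes f: "bc (\<lambda>_. f)" shows "bc (path f)"
proof -
  obtain M where M0: "0 \<le> M" and M: "\<And>z. \<bar>f z\<bar> \<le> M" using f by (rule bc_bounded) blast
  have close: "\<bar>path f t z - iter f n t z\<bar> \<le> M * tail n t z" for n t z
    using approx[OF _ f M, of "max 0 t" z n] by (simp add: path_def iter_max tail_max)
  have "isCont (\<lambda>(t, z). path f t z) x0" for x0
  proof -
    obtain t0 z0 where x0: "x0 = (t0, z0)" by (cases x0)
    have cont: "isCont (\<lambda>x. iter f n (fst x) (snd x)) x0" "isCont (\<lambda>x. tail n (fst x) (snd x)) x0" for n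
      using bc_continuous[OF bc_iter[OF f]] bc_continuous[OF bc_tail]
        continuous_on_eq_continuous_at[OF open_UNIV] by (auto simp: split_def)
    have "((\<lambda>(t, z). path f t z) \<longlongrightarrow> path f t0 z0) (at x0)"
    proof (rule tendstoI)
      fix e :: real assume e: "0 < e"
      define \<delta> where "\<delta> = e / (4 * (M + 1))"
      have \<delta>: "0 < \<delta>" using e M0 by (simp add: \<delta>_def)
      have M\<delta>: "M * \<delta> < e / 4" using e M0 by (simp add: \<delta>_def field_simps)
      have "\<forall>\<^sub>F n in sequentially. tail n t0 z0 < \<delta>"
        by (rule order_tendstoD(2)[OF tail_tendsto_0 \<delta>])
      then obtain n where n: "tail n t0 z0 < \<delta>" by (auto simp: eventually_sequentially)
      have "\<forall>\<^sub>F x in at x0. tail n (fst x) (snd x) < \<delta>"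
        using cont(2)[of n] n unfolding isCont_def x0 by (intro order_tendstoD(2)) auto
      moreover have "\<forall>\<^sub>F x in at x0. dist (iter f n (fst x) (snd x)) (iter f n t0 z0) < e / 4"
        using cont(1)[of n] e unfolding isCont_def x0 by (intro tendstoD) auto
      ultimately show "\<forall>\<^sub>F x in at x0. dist (case x of (t, z) \<Rightarrow> path f t z) (path f t0 z0) < e"
      proof eventually_elim
        case (elim x)
        have "M * tail n (fst x) (snd x) \<le> M * \<delta>" "M * tail n t0 z0 \<le> M * \<delta>"
          using elim(1) n M0 by (auto intro!: mult_left_mono)
        then show ?case
          using elim(2) close[of "fst x" "snd x" n] close[of t0 z0 n] M\<delta>
          unfolding dist_real_def split_def by linarith
      qed
    qed
    then show ?thesis by (simp add: isCont_def x0)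
  qed
  then have "continuous_on UNIV (\<lambda>(t, z). path f t z)"
    by (simp add: continuous_on_eq_continuous_at)
  moreover have "\<bar>path f t z\<bar> \<le> M" for t z
    unfolding path_def by (rule P_abs_le[OF _ f M]) simp
  ultimately show ?thesis by (rule bcI)
qed

lemma renewal_diff_abs_le:
  assumes "bc u" "bc v" "bc w" "\<And>s z. 0 \<le> s \<Longrightarrow> s \<le> t \<Longrightarrow> \<bar>u s z - v s z\<bar> \<le> w s z"
  shows "\<bar>renewal f u t z - renewal f v t z\<bar> \<le> renewal_integral w t z"
proof -
  have "renewal f u t z - renewal f v t z =
      integral {0..t} (\<lambda>s. surv s z * jump (u (t - s)) (flow s z) - surv s z * jump (v (t - s)) (flow s z))"
    unfolding renewal_def
    by (simp add: Henstock_Kurzweil_Integration.integral_diff renewal_integrable assms)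
  also have "\<dots> = renewal_integral (\<lambda>t y. u t y - v t y) t z"
    by (simp add: jump_diff bc_at[OF assms(1)] bc_at[OF assms(2)] right_diff_distrib)
  finally have eq: "renewal f u t z - renewal f v t z =
      renewal_integral (\<lambda>t y. u t y - v t y) t z" .
  have "\<bar>renewal_integral (\<lambda>t y. u t y - v t y) t z\<bar>
      \<le> renewal_integral w t z"
  proof -
    have "\<bar>surv s z * jump (\<lambda>y. u (t - s) y - v (t - s) y) (flow s z)\<bar> \<le> surv s z * jump (w (t - s)) (flow s z)"
      if "s \<in> {0..t}" for s
      unfolding abs_mult abs_of_pos[OF surv_pos] using that assms(4)
      by (intro mult_left_mono less_imp_le[OF surv_pos] jump_abs_le
          bc_diff[OF bc_at[OF assms(1)] bc_at[OF assms(2)]] bc_at[OF assms(3)]) auto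
    then show ?thesis
      using integral_norm_bound_integral[OF renewal_integrable[OF bc_diff[OF assms(1,2)]]
          renewal_integrable[OF assms(3)]] unfolding real_norm_def by blast
  qed
  then show ?thesis unfolding eq .
qed

text \<open>
  One more renewal step maps the error bound \<open>tail n\<close> to \<open>tail (n + 1)\<close>, so the equation passes to the
  limit.
\<close>

lemma path_renewal:
  assumes f: "bc (\<lambda>_. f)" and t: "0 \<le> t"
  shows "path f t z = renewal f (path f) t z"
proof -
  obtain M where M0: "0 \<le> M" and M: "\<And>z. \<bar>f z\<bar> \<le> M" using f by (rule bc_bounded) blast
  have close: "\<bar>path f t z - iter f n t z\<bar> \<le> M * tail n t z" for n t z
    using approx[OF _ f M, of "max 0 t" z n] by (simp add: path_def iter_max tail_max)
  have scaled: "renewal_integral (\<lambda>t y. M * tail n t y) t z = M * tail (Suc n) t z" for n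
  proof -
    have "(\<lambda>s. surv s z * jump (\<lambda>y. M * tail n (t - s) y) (flow s z)) =
        (\<lambda>s. M * (surv s z * jump (tail n (t - s)) (flow s z)))"
      unfolding jump_cmult by (simp add: mult_ac)
    then show ?thesis using tail_Suc[OF t] by simp
  qed
  have "\<bar>path f t z - renewal f (path f) t z\<bar> \<le> 2 * M * tail (Suc n) t z" for n
  proof -
    have "\<bar>renewal f (iter f n) t z - renewal f (path f) t z\<bar> \<le> M * tail (Suc n) t z"
      using renewal_diff_abs_le[OF bc_iter[OF f] bc_path[OF f] bc_cmult[OF bc_tail], of t n M n f z] close
      unfolding scaled by (simp add: abs_minus_commute)
    moreover have "iter f (Suc n) t z = renewal f (iter f n) t z" using t by simp
    ultimately show ?thesis using close[of t z "Suc n"] by linarith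
  qed
  moreover have "(\<lambda>n. 2 * M * tail (Suc n) t z) \<longlonglongrightarrow> 0"
    by (rule tendsto_mult_right_zero[OF LIMSEQ_Suc[OF tail_tendsto_0]])
  ultimately have "\<bar>path f t z - renewal f (path f) t z\<bar> \<le> 0"
    by (intro LIMSEQ_le_const[of "\<lambda>n. 2 * M * tail (Suc n) t z" 0]) auto
  then show ?thesis by simp
qed

text \<open>
  Uniqueness for the renewal equation: inserting the inequality into itself \<open>n\<close> times bounds \<open>d\<close> by
  its supremum times the probability of \<open>n\<close> jumps.
\<close>

lemma subsolution_zero:
  assumes d: "bc d" and D: "\<And>t z. \<bar>d t z\<bar> \<le> D"
    and sub: "\<And>t z. 0 \<le> t \<Longrightarrow> t \<le> T \<Longrightarrow>
      \<bar>d t z\<bar> \<le> renewal_integral (\<lambda>t y. \<bar>d t y\<bar>) t z"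
    and t: "0 \<le> t" "t \<le> T"
  shows "d t z = 0"
proof -
  have "\<bar>d t z\<bar> \<le> D * tail n t z" for n
    using t
  proof (induction n arbitrary: t z)
    case 0
    then show ?case using D by (simp add: tail_0)
  next
    case (Suc n)
    have "\<bar>d t z\<bar> \<le> renewal_integral (\<lambda>t y. \<bar>d t y\<bar>) t z"
      by (rule sub[OF Suc.prems])
    also have "\<dots> \<le> renewal_integral (\<lambda>t y. D * tail n t y) t z"
      using Suc.IH Suc.prems by (intro renewal_integral_mono bc_abs d bc_cmult bc_tail) auto
    also have "(\<lambda>s. surv s z * jump (\<lambda>y. D * tail n (t - s) y) (flow s z)) =
        (\<lambda>s. D * (surv s z * jump (tail n (t - s)) (flow s z)))"
      unfolding jump_cmult by (simp add: mult_ac)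
    then have "renewal_integral (\<lambda>t y. D * tail n t y) t z = D * tail (Suc n) t z"
      using tail_Suc[OF Suc.prems(1)] by simp
    finally show ?case .
  qed
  moreover have "(\<lambda>n. D * tail n t z) \<longlonglongrightarrow> 0"
    by (rule tendsto_mult_right_zero[OF tail_tendsto_0])
  ultimately have "\<bar>d t z\<bar> \<le> 0"
    by (intro LIMSEQ_le_const[of "\<lambda>n. D * tail n t z" 0]) auto
  then show ?thesis by simp
qed

section \<open>Dynkin's formula\<close>

lemma jump_integral:
  assumes u: "bc u" and x: "0 \<le> x"
  shows "jump (\<lambda>y. integral {0..x} (\<lambda>\<sigma>. u \<sigma> y)) z = integral {0..x} (\<lambda>\<sigma>. jump (u \<sigma>) z)"
proof -
  obtain M where M: "\<And>t z. \<bar>u t z\<bar> \<le> M" using u by (rule bc_bounded) blast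
  have u': "continuous_on UNIV (\<lambda>\<sigma>. u \<sigma> y)" for y
    by (intro bc_compose[OF u] continuous_on_id continuous_on_const)
  have rm: "continuous_on UNIV (\<lambda>\<sigma>. refresh_mean (u \<sigma>) z)"
    using continuous_on_compose2[OF continuous_on_refresh_mean[OF u]
        continuous_on_Pair[OF continuous_on_id continuous_on_const[of _ z]]] by simp
  interpret GL: pair_sigma_finite \<gamma> lborel ..
  let ?f = "\<lambda>y \<sigma>. indicator (UNIV \<times> {0..x}) (y, \<sigma>) *\<^sub>R u \<sigma> (refresh \<alpha> y z)"
  have sp: "space \<gamma> = UNIV" using sets_eq_imp_space_eq[OF sets_\<gamma>] by simp
  have "integrable (\<gamma> \<Otimes>\<^sub>M lborel) (\<lambda>p. indicator (UNIV \<times> {0..x}) p *\<^sub>R (\<lambda>(y, \<sigma>). u \<sigma> (refresh \<alpha> y z)) p)"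
  proof (rule integrableI_bounded_set_indicator[where B=M])
    show "UNIV \<times> {0..x} \<in> sets (\<gamma> \<Otimes>\<^sub>M lborel)"
      using sets.top[of \<gamma>] by (intro pair_measureI) (auto simp: sp)
    have "emeasure (\<gamma> \<Otimes>\<^sub>M lborel) (space \<gamma> \<times> {0..x}) = emeasure \<gamma> (space \<gamma>) * emeasure lborel {0..x}"
      by (rule lborel.emeasure_pair_measure_Times) auto
    then show "emeasure (\<gamma> \<Otimes>\<^sub>M lborel) (UNIV \<times> {0..x}) < \<infinity>"
      using x by (simp add: sp[symmetric] G.emeasure_space_1)
    have "sets (\<gamma> \<Otimes>\<^sub>M lborel) = sets (borel :: ('a \<times> real) measure)"
      using sets_pair_measure_cong[OF sets_\<gamma> sets_lborel] unfolding borel_prod .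
    moreover have "continuous_on UNIV (\<lambda>(y, \<sigma>). u \<sigma> (refresh \<alpha> y z))"
      unfolding split_def by (intro bc_compose[OF u] continuous_intros)
    ultimately show "(\<lambda>(y, \<sigma>). u \<sigma> (refresh \<alpha> y z)) \<in> borel_measurable (\<gamma> \<Otimes>\<^sub>M lborel)"
      using borel_measurable_continuous_onI measurable_cong_sets[OF _ refl] by blast
    show "AE p in \<gamma> \<Otimes>\<^sub>M lborel. p \<in> UNIV \<times> {0..x} \<longrightarrow> norm ((\<lambda>(y, \<sigma>). u \<sigma> (refresh \<alpha> y z)) p) \<le> M"
      using M by (intro AE_I2) (auto simp: split_def)
  qed
  then have "integrable (\<gamma> \<Otimes>\<^sub>M lborel) (\<lambda>(y, \<sigma>). ?f y \<sigma>)" by (simp add: split_def)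
  from GL.Fubini_integral[OF this]
  have "(\<integral>y. (\<integral>\<sigma>. indicator {0..x} \<sigma> *\<^sub>R u \<sigma> (refresh \<alpha> y z) \<partial>lborel) \<partial>\<gamma>) =
      (\<integral>\<sigma>. (\<integral>y. indicator {0..x} \<sigma> *\<^sub>R u \<sigma> (refresh \<alpha> y z) \<partial>\<gamma>) \<partial>lborel)"
    by (simp add: indicator_def)
  then have "refresh_mean (\<lambda>y. integral {0..x} (\<lambda>\<sigma>. u \<sigma> y)) z = integral {0..x} (\<lambda>\<sigma>. refresh_mean (u \<sigma>) z)"
    unfolding integral_eq_lborel[OF rm] unfolding refresh_mean_def integral_eq_lborel[OF u'] by simp
  then show ?thesis
    unfolding jump_def
    by (subst Henstock_Kurzweil_Integration.integral_add)
      (auto intro!: integrable_continuous_interval continuous_on_mult continuous_on_const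
        continuous_on_subset[OF u'] continuous_on_subset[OF rm])
qed

definition gen :: "('a \<times> 'a \<Rightarrow> real) \<Rightarrow> 'a \<times> 'a \<Rightarrow> real" where
  "gen f z = transport f z + bounce_part f z + r * (refresh_mean f z - f z)"

lemma gen_eq: "gen f z = transport f z + jump f z - rate z * f z"
  by (simp add: gen_def bounce_part_def jump_def rate_def algebra_simps)

lemma C0_dominated_weight:
  assumes "continuous_on UNIV f" "\<And>z. \<bar>f z\<bar> \<le> M * (1 / weight z)" shows "f \<in> C0"
proof -
  have w: "((\<lambda>z. M * (1 / weight z)) \<longlongrightarrow> M * 0) at_infinity"
  proof (intro tendsto_intros)
    have "filterlim weight at_top at_infinity"
      by (rule filterlim_at_top_mono[OF filterlim_norm_at_top always_eventually]) (simp add: norm_le_weight)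
    then have "((\<lambda>z. inverse (weight z)) \<longlongrightarrow> 0) at_infinity"
      by (rule tendsto_inverse_0_at_top)
    then show "((\<lambda>z. 1 / weight z) \<longlongrightarrow> 0) at_infinity" by (simp add: divide_inverse)
  qed
  have "(f \<longlongrightarrow> 0) at_infinity"
    by (rule Lim_null_comparison[OF always_eventually]) (use assms(2) w in auto)
  then show ?thesis using assms(1) by (simp add: C0_def)
qed

lemma Cc_infinity_dominated_weight:
  assumes "f \<in> Cc_infinity" obtains M where "0 \<le> M" "\<And>z. \<bar>f z\<bar> \<le> M * (1 / weight z)"
proof -
  obtain R where R: "0 < R" "\<And>x. R \<le> norm x \<Longrightarrow> f x = 0" using assms by (rule Cc_infinity_support) blast
  obtain B where B: "0 < B" "\<And>x. \<bar>f x\<bar> \<le> B" using Cc_infinity_C0[OF assms] by (rule C0_bounded) blast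
  have "\<bar>f z\<bar> \<le> (B * (1 + 2 * R)) * (1 / weight z)" for z
  proof (cases "R \<le> norm z")
    case True
    then show ?thesis using R B weight_pos[of z] by simp
  next
    case False
    then have "weight z \<le> 1 + 2 * R" using norm_le_weight(2)[of z] by simp
    then have "\<bar>f z\<bar> * weight z \<le> B * (1 + 2 * R)"
      using B weight_pos[of z] by (intro mult_mono) auto
    then show ?thesis using weight_pos[of z] by (simp add: field_simps)
  qed
  moreover have "0 \<le> B * (1 + 2 * R)" using B(1) R(1) by simp
  ultimately show thesis by (rule that[rotated])
qed

lemma refresh_mean_C0:
  assumes "f \<in> Cc_infinity" shows "refresh_mean f \<in> C0"
proof -
  note f = bc_C0[OF Cc_infinity_C0[OF assms]]
  obtain M where M: "0 \<le> M" "\<And>z. \<bar>f z\<bar> \<le> M * (1 / weight z)"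
    using assms by (rule Cc_infinity_dominated_weight) blast
  show ?thesis
  proof (rule C0_dominated_weight)
    show "continuous_on UNIV (refresh_mean f)"
      using continuous_on_compose2[OF continuous_on_refresh_mean[OF f]
          continuous_on_Pair[OF continuous_on_const[of _ 0] continuous_on_id]] by simp
    fix z
    have "\<bar>refresh_mean f z\<bar> \<le> refresh_mean (\<lambda>z. M * (1 / weight z)) z"
    proof -
      have "refresh_mean f z \<le> refresh_mean (\<lambda>z. M * (1 / weight z)) z"
        by (intro refresh_mean_mono f bc_cmult bc_inverse_weight) (use M abs_le_D1 in blast)
      moreover have "refresh_mean (\<lambda>z. -1 * f z) z \<le> refresh_mean (\<lambda>z. M * (1 / weight z)) z"
        by (intro refresh_mean_mono bc_cmult f bc_inverse_weight) (use M abs_le_D2 in fastforce)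
      ultimately show ?thesis unfolding refresh_mean_cmult by simp
    qed
    also have "\<dots> \<le> M * (growth * (1 / weight z))"
      unfolding refresh_mean_cmult by (intro mult_left_mono refresh_mean_inverse_weight M)
    finally show "\<bar>refresh_mean f z\<bar> \<le> (M * growth) * (1 / weight z)" by simp
  qed
qed

lemma gen_C0: "f \<in> Cc_infinity \<Longrightarrow> gen f \<in> C0"
  unfolding gen_def[abs_def]
  by (intro C0_add C0_cmult C0_diff transport_C0 bounce_part_C0 refresh_mean_C0 Cc_infinity_C0)

text \<open>
  The right-hand side solves the same renewal equation as the left-hand side: integrating the
  renewal equation of \<open>P\<^sub>s (gen f)\<close> over time and exchanging the integrals leaves the boundary terms
  of an integration by parts along the flow, which are those of \<open>f\<close>.
\<close>

lemma dynkin: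
  assumes f: "f \<in> Cc_infinity" and t: "0 \<le> t"
  shows "P t f z = f z + integral {0..t} (\<lambda>s. path (gen f) s z)"
proof -
  note bf = bc_C0[OF Cc_infinity_C0[OF f]]
  note bg = bc_C0[OF gen_C0[OF f]]
  note u = bc_path[OF bg]
  have f1: "Ck 1 f" by (rule Cc_infinity_Ck[OF f])
  have cf: "continuous_on S (\<lambda>x. f (h x))" if "continuous_on S h" for h :: "real \<Rightarrow> 'a \<times> 'a" and S
    using continuous_on_compose2[OF Ck_continuous[OF f1] that] by simp
  have ctf: "continuous_on S (\<lambda>x. transport f (h x))" if "continuous_on S h" for h :: "real \<Rightarrow> 'a \<times> 'a" and S
    using continuous_on_compose2[OF continuous_on_transport[OF f1] that] by simp
  have cjf: "continuous_on S (\<lambda>x. jump f (h x))" if "continuous_on S h" for h :: "real \<Rightarrow> 'a \<times> 'a" and S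
    using continuous_on_jump_compose[OF bf continuous_on_const that] by simp
  define W where "W x z = integral {0..x} (\<lambda>s. path (gen f) s z)" for x z
  \<comment> \<open>frozen after time \<open>t\<close>, to be bounded\<close>
  define v where "v x z = f z + W (max 0 (min t x)) z" for x z
  obtain M where M0: "0 \<le> M" and M: "\<And>x z. \<bar>path (gen f) x z\<bar> \<le> M" using u by (rule bc_bounded) blast
  have bW: "bc (\<lambda>x z. W (max 0 (min t x)) z)"
  proof (rule bcI)
    show "continuous_on UNIV (\<lambda>(x, z). W (max 0 (min t x)) z)"
      unfolding W_def split_def
    proof (rule continuous_on_integral_upto)
      show "continuous_on UNIV (\<lambda>(x::real \<times> ('a \<times> 'a), s). path (gen f) s (snd x))"
        unfolding split_def by (intro bc_compose[OF u] continuous_intros)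
    qed (auto intro!: continuous_intros)
    fix x z
    have "norm (integral {0..max 0 (min t x)} (\<lambda>s. path (gen f) s z)) \<le> M * (max 0 (min t x) - 0)"
      by (rule integral_bound) (auto intro!: M bc_compose[OF u] continuous_intros)
    also have "\<dots> \<le> M * t" using t M0 by (intro mult_left_mono) auto
    finally show "\<bar>W (max 0 (min t x)) z\<bar> \<le> M * t" by (simp add: W_def)
  qed
  then have bv: "bc v" unfolding v_def[abs_def] by (intro bc_add bf)
  have v_renewal: "v x z = renewal f v x z" if x: "0 \<le> x" "x \<le> t" for x z
  proof -
    have "W x z = integral {0..x} (\<lambda>\<tau>. surv \<tau> z * gen f (flow \<tau> z)
        + integral {0..\<tau>} (\<lambda>s. surv s z * jump (path (gen f) (\<tau> - s)) (flow s z)))"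
      unfolding W_def using path_renewal[OF bg] by (intro integral_cong) (auto simp: renewal_def)
    also have "\<dots> = integral {0..x} (\<lambda>\<tau>. surv \<tau> z * gen f (flow \<tau> z))
        + integral {0..x} (\<lambda>\<tau>. integral {0..\<tau>} (\<lambda>s. surv s z * jump (path (gen f) (\<tau> - s)) (flow s z)))"
    proof (rule Henstock_Kurzweil_Integration.integral_add)
      show "(\<lambda>\<tau>. surv \<tau> z * gen f (flow \<tau> z)) integrable_on {0..x}"
        unfolding gen_eq by (intro integrable_continuous_interval continuous_intros cf ctf cjf)
      have "continuous_on UNIV (\<lambda>\<tau>. integral {0..max 0 \<tau>} (\<lambda>s. surv s z * jump (path (gen f) (\<tau> - s)) (flow s z)))"
      proof (rule continuous_on_integral_upto)
        show "continuous_on UNIV (\<lambda>(\<tau>, s). surv s z * jump (path (gen f) (\<tau> - s)) (flow s z))"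
          unfolding split_def by (intro continuous_intros continuous_on_jump_compose[OF u])
      qed (auto intro!: continuous_intros)
      from integrable_continuous_interval[OF continuous_on_subset[OF this subset_UNIV]]
      show "(\<lambda>\<tau>. integral {0..\<tau>} (\<lambda>s. surv s z * jump (path (gen f) (\<tau> - s)) (flow s z))) integrable_on {0..x}"
        by (rule integrable_eq) auto
    qed
    also have "integral {0..x} (\<lambda>\<tau>. integral {0..\<tau>} (\<lambda>s. surv s z * jump (path (gen f) (\<tau> - s)) (flow s z))) =
        integral {0..x} (\<lambda>s. integral {0..x - s} (\<lambda>\<sigma>. surv s z * jump (path (gen f) \<sigma>) (flow s z)))"
      by (rule integral_triangle_swap[OF _ x(1)])
        (unfold split_def, intro continuous_intros continuous_on_jump_compose[OF u])
    also have "\<dots> = renewal_integral W x z"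
    proof (intro integral_cong)
      fix s assume "s \<in> {0..x}"
      then show "integral {0..x - s} (\<lambda>\<sigma>. surv s z * jump (path (gen f) \<sigma>) (flow s z)) =
          surv s z * jump (W (x - s)) (flow s z)"
        using jump_integral[OF u, of "x - s" "flow s z"] by (simp add: W_def[abs_def])
    qed
    finally have Wx: "W x z = integral {0..x} (\<lambda>\<tau>. surv \<tau> z * gen f (flow \<tau> z))
        + renewal_integral W x z" .
    have parts: "((\<lambda>s. surv s z * (rate (flow s z) * f (flow s z) - transport f (flow s z))) has_integral
        f z - surv x z * f (flow x z)) {0..x}"
      using surv_parts[OF x(1) has_field_derivative_at_within[OF DERIV_along_flow[OF f1]], of z] by simp
    have jW: "continuous_on {0..x} (\<lambda>s. surv s z * jump (W (x - s)) (flow s z))"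
    proof -
      have "continuous_on {0..x} (\<lambda>s. surv s z * jump (\<lambda>y. W (max 0 (min t (x - s))) y) (flow s z))"
        by (intro continuous_intros continuous_on_jump_compose[OF bW])
      then show ?thesis
        by (rule continuous_on_eq) (use x in auto)
    qed
    have "renewal f v x z = surv x z * f (flow x z) + integral {0..x} (\<lambda>s. surv s z * jump f (flow s z)
        + surv s z * jump (W (x - s)) (flow s z))"
    proof -
      have "jump (v (x - s)) y = jump f y + jump (W (x - s)) y" if "s \<in> {0..x}" for s y
      proof -
        have eq: "max 0 (min t (x - s)) = x - s" using that x by auto
        have "v (x - s) = (\<lambda>z. f z + W (max 0 (min t (x - s))) z)" by (simp add: v_def fun_eq_iff)
        moreover have "jump (\<lambda>z. f z + W (max 0 (min t (x - s))) z) y =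
            jump f y + jump (\<lambda>z. W (max 0 (min t (x - s))) z) y"
          by (rule jump_add[OF bf bc_at[OF bW]])
        ultimately show ?thesis by (simp add: eq)
      qed
      then show ?thesis unfolding renewal_def
        by (intro arg_cong2[where f="(+)"] refl integral_cong) (simp add: distrib_left)
    qed
    also have "\<dots> = surv x z * f (flow x z) + integral {0..x} (\<lambda>s. surv s z * jump f (flow s z))
        + renewal_integral W x z"
      by (subst Henstock_Kurzweil_Integration.integral_add)
        (auto intro!: integrable_continuous_interval continuous_on_mult continuous_intros cjf jW)
    also have "integral {0..x} (\<lambda>s. surv s z * jump f (flow s z)) =
        integral {0..x} (\<lambda>\<tau>. surv \<tau> z * gen f (flow \<tau> z)) + (f z - surv x z * f (flow x z))"
    proof -
      have "(\<lambda>\<tau>. surv \<tau> z * gen f (flow \<tau> z)) integrable_on {0..x}"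
        unfolding gen_eq by (intro integrable_continuous_interval continuous_intros cf ctf cjf)
      from integral_unique[OF has_integral_add[OF integrable_integral[OF this] parts]]
      show ?thesis by (simp add: gen_eq algebra_simps)
    qed
    finally have "renewal f v x z = f z + W x z" using Wx by simp
    then show ?thesis using x by (simp add: v_def)
  qed
  define d where "d x z = v x z - path f x z" for x z
  have bd: "bc d" unfolding d_def[abs_def] by (rule bc_diff[OF bv bc_path[OF bf]])
  obtain D where D: "\<And>x z. \<bar>d x z\<bar> \<le> D" using bd by (rule bc_bounded) blast
  have "d t z = 0"
  proof (rule subsolution_zero[OF bd D _ t order_refl])
    fix x z assume x: "0 \<le> x" "x \<le> t"
    show "\<bar>d x z\<bar> \<le> renewal_integral (\<lambda>t y. \<bar>d t y\<bar>) x z"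
      using renewal_diff_abs_le[OF bv bc_path[OF bf] bc_abs[OF bd], of x f z] v_renewal[OF x, of z]
        path_renewal[OF bf x(1), of z] by (simp add: d_def)
  qed
  then show ?thesis using t by (simp add: d_def v_def W_def path_eq)
qed

section \<open>The Feller property\<close>

lemma continuous_on_P: "0 \<le> t \<Longrightarrow> bc (\<lambda>_. f) \<Longrightarrow> continuous_on UNIV (P t f)"
  using bc_slice[OF bc_path, of f t] by (simp add: path_eq)

text \<open>
  Test functions are dominated by a multiple of the inverse weight, hence so are their images
  under \<open>P\<^sub>t\<close>; the rest is density.
\<close>

lemma P_C0:
  assumes t: "0 \<le> t" and f: "f \<in> C0" shows "P t f \<in> C0"
proof (rule C0_closed)
  fix \<epsilon> :: real assume "0 < \<epsilon>"
  then obtain g where g: "g \<in> Cc_infinity" "\<And>x. \<bar>g x - f x\<bar> \<le> \<epsilon>" using Cc_infinity_dense[OF f] by blast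
  note bg = bc_C0[OF Cc_infinity_C0[OF g(1)]]
  obtain M where M: "\<And>z. \<bar>g z\<bar> \<le> M * (1 / weight z)"
    using g(1) by (rule Cc_infinity_dominated_weight) blast
  have "\<bar>P t g z\<bar> \<le> M * exp ((1 + r * growth) * t) * (1 / weight z)" for z
    by (rule LIMSEQ_le_const2[OF tendsto_rabs[OF P_limit[OF t bg]]]) (use iter_decay[OF bg M t] in auto)
  then have "P t g \<in> C0" by (rule C0_dominated_weight[OF continuous_on_P[OF t bg]])
  moreover have "\<bar>P t f z - P t g z\<bar> \<le> \<epsilon>" for z
    using g(2) by (intro P_diff_abs_le t bc_C0 f bg) (simp add: abs_minus_commute)
  ultimately show "\<exists>h\<in>C0. \<forall>z. \<bar>P t f z - h z\<bar> \<le> \<epsilon>" by blast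
qed

lemma integral_average_bound:
  fixes h :: "real \<Rightarrow> real"
  assumes "continuous_on UNIV h" "0 < t" "\<And>s. s \<in> {0..t} \<Longrightarrow> \<bar>h s - c\<bar> \<le> \<epsilon>"
  shows "\<bar>integral {0..t} h / t - c\<bar> \<le> \<epsilon>"
proof -
  have i: "h integrable_on {0..t}"
    by (intro integrable_continuous_interval continuous_on_subset[OF assms(1)]) simp
  have "norm (integral {0..t} (\<lambda>s. h s - c)) \<le> \<epsilon> * (t - 0)"
    using assms by (intro integral_bound continuous_intros continuous_on_subset[OF assms(1)]) auto
  moreover have "integral {0..t} (\<lambda>s. h s - c) = integral {0..t} h - t * c"
    using assms(2) by (subst Henstock_Kurzweil_Integration.integral_diff[OF i]) auto
  moreover have "integral {0..t} h / t - c = (integral {0..t} h - t * c) / t"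
    using assms(2) by (simp add: field_simps)
  ultimately show ?thesis using assms(2) by (simp add: abs_divide field_simps)
qed

lemma strong_continuity:
  assumes f: "f \<in> C0" shows "uniform_limit UNIV (\<lambda>t. P t f) f (at_right 0)"
proof (rule uniform_limitI)
  fix e :: real assume e: "0 < e"
  then obtain g where g: "g \<in> Cc_infinity" "\<And>x. \<bar>g x - f x\<bar> \<le> e / 4"
    using Cc_infinity_dense[OF f, of "e / 4"] by auto
  note bg = bc_C0[OF Cc_infinity_C0[OF g(1)]]
  obtain M where M: "0 < M" "\<And>x. \<bar>gen g x\<bar> \<le> M" using gen_C0[OF g(1)] by (rule C0_bounded) blast
  have "dist (P t f z) (f z) < e" if t: "0 < t" "t < e / (4 * M)" for t z
  proof -
    have "\<bar>path (gen g) s z\<bar> \<le> M" for s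
      unfolding path_def by (intro P_abs_le bc_C0 gen_C0 g M) simp
    moreover have "continuous_on {0..t} (\<lambda>s. path (gen g) s z)"
      by (intro bc_compose[OF bc_path[OF bc_C0[OF gen_C0[OF g(1)]]]] continuous_intros)
    ultimately have "norm (integral {0..t} (\<lambda>s. path (gen g) s z)) \<le> M * (t - 0)"
      using t by (intro integral_bound) auto
    moreover have "M * t < e / 4" using t M by (simp add: field_simps)
    ultimately have "\<bar>P t g z - g z\<bar> < e / 4" using dynkin[OF g(1), of t z] t by simp
    moreover have "\<bar>P t f z - P t g z\<bar> \<le> e / 4"
      using g(2) t by (intro P_diff_abs_le bc_C0 f bg) (auto simp: abs_minus_commute)
    ultimately show ?thesis using g(2)[of z] unfolding dist_real_def by linarith
  qed
  then show "\<forall>\<^sub>F t in at_right 0. \<forall>z\<in>UNIV. dist (P t f z) (f z) < e"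
    using e M(1) by (intro eventually_at_rightI[of 0 "e / (4 * M)"]) auto
qed

theorem semigroup_feller: "feller P"
  unfolding feller_def using P_C0 strong_continuity by blast

section \<open>The generator and its core\<close>

lemma generator_on_test_functions:
  assumes f: "f \<in> Cc_infinity" shows "has_generator_value P f (gen f)"
  unfolding has_generator_value_def
proof (rule uniform_limitI)
  fix e :: real assume e: "0 < e"
  note bg = bc_C0[OF gen_C0[OF f]]
  have "\<forall>\<^sub>F t in at_right 0. \<forall>z\<in>UNIV. dist (P t (gen f) z) (gen f z) < e / 2"
    using uniform_limitD[OF strong_continuity[OF gen_C0[OF f]], of "e / 2"] e by simp
  then obtain b where b: "0 < b" "\<And>t z. 0 < t \<Longrightarrow> t < b \<Longrightarrow> \<bar>P t (gen f) z - gen f z\<bar> < e / 2"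
    unfolding eventually_at_right_field by (auto simp: dist_real_def)
  have "dist ((P t f z - f z) / t) (gen f z) < e" if t: "0 < t" "t < b" for t z
  proof -
    have c: "continuous_on UNIV (\<lambda>s. path (gen f) s z)"
      by (intro bc_compose[OF bc_path[OF bg]] continuous_intros)
    have "\<bar>path (gen f) s z - gen f z\<bar> \<le> e / 2" if "s \<in> {0..t}" for s
    proof -
      have p: "\<bar>path (gen f) s z - gen f z\<bar> \<le> e / 2" if "s \<in> {0<..<b}" for s
        using b(2)[of s z] that by (simp add: path_eq)
      \<comment> \<open>at \<open>s = 0\<close> the bound follows by continuity\<close>
      show ?thesis
      proof (rule continuous_le_on_closure[where S="{0<..<b}" and f="\<lambda>s. \<bar>path (gen f) s z - gen f z\<bar>"])
        show "continuous_on (closure {0<..<b}) (\<lambda>s. \<bar>path (gen f) s z - gen f z\<bar>)"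
          by (intro continuous_intros continuous_on_subset[OF c]) simp
        show "s \<in> closure {0<..<b}" using that \<open>s \<in> {0..t}\<close> t b by simp
      qed (rule p)
    qed
    then have "\<bar>integral {0..t} (\<lambda>s. path (gen f) s z) / t - gen f z\<bar> \<le> e / 2"
      using c t by (intro integral_average_bound)
    then show ?thesis using dynkin[OF f, of t z] t e by (simp add: dist_real_def)
  qed
  then show "\<forall>\<^sub>F t in at_right 0. \<forall>z\<in>UNIV. dist ((P t f z - f z) / t) (gen f z) < e"
    using b(1) by (intro eventually_at_rightI[of 0 b]) auto
qed

lemma generator_unique: "has_generator_value P f g \<Longrightarrow> generator P f = g"
  unfolding generator_def
proof (rule the_equality)
  fix h assume "has_generator_value P f g" "has_generator_value P f h"
  then show "h = g" unfolding has_generator_value_def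
    by (intro ext tendsto_unique[OF _ tendsto_uniform_limitI tendsto_uniform_limitI]) auto
qed

lemma generator_value_C0:
  assumes "f \<in> C0" "has_generator_value P f g" shows "g \<in> C0"
proof (rule C0_closed)
  fix \<epsilon> :: real assume "0 < \<epsilon>"
  from uniform_limitD[OF assms(2)[unfolded has_generator_value_def] this]
  have "\<forall>\<^sub>F t in at_right 0. \<forall>z\<in>UNIV. dist ((P t f z - f z) / t) (g z) < \<epsilon>" .
  then have "\<forall>\<^sub>F t in at_right 0. 0 < t \<and> (\<forall>z\<in>UNIV. dist ((P t f z - f z) / t) (g z) < \<epsilon>)"
    using eventually_at_right_less[of "0::real"] by eventually_elim simp
  then obtain t where t: "0 < t" "\<And>z. dist ((P t f z - f z) / t) (g z) < \<epsilon>"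
    using eventually_happens'[OF trivial_limit_at_right_real] by blast
  have "(\<lambda>z. inverse t * (P t f z - f z)) \<in> C0"
    using t by (intro C0_cmult C0_diff P_C0 assms) simp
  moreover have "\<bar>g z - inverse t * (P t f z - f z)\<bar> \<le> \<epsilon>" for z
    using t(2)[of z] by (simp add: dist_real_def divide_inverse mult.commute abs_minus_commute)
  ultimately show "\<exists>h\<in>C0. \<forall>z. \<bar>g z - h z\<bar> \<le> \<epsilon>"
    by (intro bexI[of _ "\<lambda>z. inverse t * (P t f z - f z)"] allI)
qed

text \<open>
  With the difference quotient in place of \<open>g\<close> this is a consequence of the contraction property,
  \<open>\<bar>(\<mu> + 1/t) f - P\<^sub>t f / t\<bar> \<ge> (\<mu> + 1/t) \<bar>f\<bar> - \<bar>f\<bar> / t\<close> in the supremum norm.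
\<close>

lemma dissipative:
  assumes f: "f \<in> C0" and g: "has_generator_value P f g" and \<mu>: "0 < \<mu>"
    and G: "\<And>z. \<bar>\<mu> * f z - g z\<bar> \<le> G"
  shows "\<bar>f z\<bar> \<le> G / \<mu>"
proof -
  obtain B where B: "0 < B" "\<And>x. \<bar>f x\<bar> \<le> B" using f by (rule C0_bounded) blast
  define S where "S = (SUP z. \<bar>f z\<bar>)"
  have bdd: "bdd_above (range (\<lambda>z. \<bar>f z\<bar>))" using B(2) by (auto simp: bdd_above_def)
  have S: "\<bar>f z\<bar> \<le> S" for z unfolding S_def by (rule cSUP_upper[OF _ bdd]) simp
  have "\<mu> * S \<le> G + e" if e: "0 < e" for e
  proof -
    have "\<forall>\<^sub>F t in at_right 0. 0 < t \<and> (\<forall>z\<in>UNIV. dist ((P t f z - f z) / t) (g z) < e)"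
      using uniform_limitD[OF g[unfolded has_generator_value_def] e] eventually_at_right_less[of "0::real"]
      by eventually_elim simp
    then obtain t where t: "0 < t" "\<And>z. dist ((P t f z - f z) / t) (g z) < e"
      using eventually_happens'[OF trivial_limit_at_right_real] by blast
    have "(\<mu> * t + 1) * \<bar>f z\<bar> \<le> t * (G + e) + S" for z
    proof -
      have "\<bar>\<mu> * f z - (P t f z - f z) / t\<bar> \<le> G + e"
        using G[of z] t(2)[of z] unfolding dist_real_def by linarith
      then have le: "t * \<bar>\<mu> * f z - (P t f z - f z) / t\<bar> \<le> t * (G + e)"
        using t(1) by (intro mult_left_mono) auto
      have eq: "t * \<bar>\<mu> * f z - (P t f z - f z) / t\<bar> = \<bar>(\<mu> * t + 1) * f z - P t f z\<bar>"
      proof -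
        have "t * (\<mu> * f z - (P t f z - f z) / t) = (\<mu> * t + 1) * f z - P t f z"
          using t(1) by (simp add: field_simps)
        then show ?thesis using t(1) by (metis abs_mult abs_of_pos)
      qed
      have "(\<mu> * t + 1) * \<bar>f z\<bar> = \<bar>(\<mu> * t + 1) * f z\<bar>"
        using \<mu> t(1) by (simp add: abs_mult)
      also have "\<dots> \<le> \<bar>(\<mu> * t + 1) * f z - P t f z\<bar> + \<bar>P t f z\<bar>"
        using abs_triangle_ineq2[of "(\<mu> * t + 1) * f z" "P t f z"] by (simp only: diff_le_eq)
      also have "\<dots> \<le> t * (G + e) + S"
        using t(1) by (intro add_mono le[unfolded eq] P_abs_le bc_C0 f S) simp
      finally show ?thesis .
    qed
    then have "\<bar>f z\<bar> \<le> (t * (G + e) + S) / (\<mu> * t + 1)" for z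
      using \<mu> t(1) by (simp add: pos_le_divide_eq add_pos_pos mult.commute)
    then have "S \<le> (t * (G + e) + S) / (\<mu> * t + 1)"
      unfolding S_def by (intro cSUP_least) auto
    then have "S * (\<mu> * t + 1) \<le> t * (G + e) + S"
      using \<mu> t(1) by (simp add: pos_le_divide_eq add_pos_pos)
    then have "t * (\<mu> * S) \<le> t * (G + e)" by (simp add: algebra_simps)
    then show ?thesis using t(1) by simp
  qed
  then have "\<mu> * S \<le> G" by (rule field_le_epsilon)
  then have "S \<le> G / \<mu>" using \<mu> by (simp add: field_simps)
  then show ?thesis using S[of z] by linarith
qed

text \<open>
  The term \<open>- r f\<close> of \<open>gen f\<close> raises the constant from \<open>\<mu>\<close> to \<open>\<mu> + r\<close>; what remains of the refreshments
  is \<open>r\<close> times an average, a perturbation of norm at most \<open>r < \<mu> + r\<close>.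
\<close>

lemma gen_range_dense:
  assumes "0 < \<mu>" "g \<in> C0" "0 < \<epsilon>"
  shows "\<exists>f\<in>Cc_infinity. \<forall>z. \<bar>\<mu> * f z - gen f z - g z\<bar> \<le> \<epsilon>"
proof -
  let ?A = "\<lambda>f z. (\<mu> + r) * f z - transport f z - bounce_part f z"
  let ?K = "\<lambda>f z. r * refresh_mean f z"
  have pos: "0 < \<mu> + r" using assms(1) r_pos by simp
  have "\<exists>f\<in>Cc_infinity. \<forall>z. \<bar>?A f z - ?K f z - g z\<bar> \<le> \<epsilon>"
  proof (rule dense_range_perturbation[where \<nu>="\<mu> + r" and k=r])
    show "(\<lambda>x. 0) \<in> Cc_infinity" by (rule Cc_infinityI[of _ 0]) (auto intro: Ck_const)
    show "Cc_infinity \<subseteq> C0" using Cc_infinity_C0 by blast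
    show "?A (\<lambda>x. f x + g x) x = ?A f x + ?A g x" if "f \<in> Cc_infinity" "g \<in> Cc_infinity" for f g x
      using transport_add[OF Cc_infinity_Ck[OF that(1)] Cc_infinity_Ck[OF that(2)], of x]
      by (simp add: bounce_part_def algebra_simps)
    show "?K (\<lambda>x. f x + g x) x = ?K f x + ?K g x" if "f \<in> Cc_infinity" "g \<in> Cc_infinity" for f g x
      using refresh_mean_add[OF bc_C0[OF Cc_infinity_C0[OF that(1)]] bc_C0[OF Cc_infinity_C0[OF that(2)]], of x]
      by (simp add: algebra_simps)
    show "?A f \<in> C0" "?K f \<in> C0" if "f \<in> Cc_infinity" for f
      by (intro C0_diff C0_cmult transport_C0 bounce_part_C0 refresh_mean_C0 Cc_infinity_C0 that)+
    show "\<exists>f\<in>Cc_infinity. \<forall>x. \<bar>?A f x - g x\<bar> \<le> \<epsilon>" if "g \<in> C0" "0 < \<epsilon>" for g \<epsilon>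
      using bounce_range_dense[OF pos that] .
    show "\<bar>f x\<bar> \<le> G / (\<mu> + r)" if f: "f \<in> Cc_infinity" and G: "\<And>x. \<bar>?A f x\<bar> \<le> G" for f G x
      by (rule maximum_principle[OF f pos, where \<eta>="bounce_rate U" and B="bounce U"])
        (use G in \<open>auto simp: bounce_part_def bounce_rate_nonneg\<close>)
    show "\<bar>?K f x\<bar> \<le> r * G" if "f \<in> Cc_infinity" "\<And>x. \<bar>f x\<bar> \<le> G" for f G x
      using refresh_mean_abs_le[OF bc_C0[OF Cc_infinity_C0[OF that(1)]] that(2)] r_pos
      by (simp add: abs_mult)
    show "0 \<le> r" "r < \<mu> + r" using assms(1) r_pos by auto
  qed (use assms in \<open>auto intro: Cc_infinity_add\<close>)
  moreover have "?A f z - ?K f z = \<mu> * f z - gen f z" for f z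
    by (simp add: gen_def algebra_simps)
  ultimately show ?thesis by simp
qed

text \<open>
  For \<open>f\<close> in the domain with value \<open>g\<close>, dense range provides test functions \<open>F\<^sub>n\<close> with
  \<open>(1 - gen) F\<^sub>n \<rightarrow> f - g\<close>; dissipativity of the difference turns this into \<open>F\<^sub>n \<rightarrow> f\<close>, and then
  \<open>gen F\<^sub>n \<rightarrow> g\<close> follows by subtraction.
\<close>

theorem test_functions_core: "is_core P Cc_infinity"
  unfolding is_core_def
proof (intro conjI ballI)
  show "Cc_infinity \<subseteq> generator_dom P"
    using generator_on_test_functions Cc_infinity_C0 by (auto simp: generator_dom_def)
  fix f assume "f \<in> generator_dom P"
  then obtain g where f: "f \<in> C0" and g: "has_generator_value P f g"
    by (auto simp: generator_dom_def)
  have "(\<lambda>z. 1 * f z - g z) \<in> C0" by (intro C0_diff C0_cmult f generator_value_C0[OF f g])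
  then have "\<exists>h\<in>Cc_infinity. \<forall>z. \<bar>1 * h z - gen h z - (1 * f z - g z)\<bar> \<le> inverse (real (Suc n))" for n
    by (intro gen_range_dense) auto
  then obtain F where F: "\<And>n. F n \<in> Cc_infinity"
    "\<And>n z. \<bar>1 * F n z - gen (F n) z - (1 * f z - g z)\<bar> \<le> inverse (real (Suc n))"
    by metis
  have genF: "generator P (F n) = gen (F n)" for n
    by (rule generator_unique[OF generator_on_test_functions[OF F(1)]])
  have genf: "generator P f = g" by (rule generator_unique[OF g])
  have close: "\<bar>F n z - f z\<bar> \<le> inverse (real (Suc n))" for n z
  proof -
    have "has_generator_value P (\<lambda>z. F n z - f z) (\<lambda>z. gen (F n) z - g z)"
      unfolding has_generator_value_def
    proof (rule uniform_limit_cong[THEN iffD1, OF _ refl])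
      show "uniform_limit UNIV (\<lambda>t z. (P t (F n) z - F n z) / t - (P t f z - f z) / t)
          (\<lambda>z. gen (F n) z - g z) (at_right 0)"
        using generator_on_test_functions[OF F(1)] g unfolding has_generator_value_def
        by (rule uniform_limit_minus)
      have "(P t (F n) z - F n z) / t - (P t f z - f z) / t =
          (P t (\<lambda>z. F n z - f z) z - (F n z - f z)) / t" if "0 < t" for t z
        using P_diff[OF _ bc_C0[OF Cc_infinity_C0[OF F(1)]] bc_C0[OF f], of t n z] that
        by (simp add: diff_divide_distrib)
      then show "\<forall>\<^sub>F t in at_right 0. \<forall>z\<in>UNIV. (P t (F n) z - F n z) / t - (P t f z - f z) / t =
          (P t (\<lambda>z. F n z - f z) z - (F n z - f z)) / t"
        by (intro eventually_at_rightI[of 0 1]) auto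
    qed
    moreover have "\<bar>1 * (F n z - f z) - (gen (F n) z - g z)\<bar> \<le> inverse (real (Suc n))" for z
      using F(2)[of n z] by (simp add: algebra_simps)
    ultimately have "\<bar>F n z - f z\<bar> \<le> inverse (real (Suc n)) / 1"
      by (intro dissipative[where g="\<lambda>z. gen (F n) z - g z"] C0_diff Cc_infinity_C0 F(1) f) auto
    then show ?thesis by simp
  qed
  have "uniform_limit UNIV F f sequentially"
  proof (rule uniform_limitI)
    fix e :: real assume "0 < e"
    then have "\<forall>\<^sub>F n in sequentially. inverse (real (Suc n)) < e"
      by (rule order_tendstoD(2)[OF LIMSEQ_inverse_real_of_nat])
    then show "\<forall>\<^sub>F n in sequentially. \<forall>z\<in>UNIV. dist (F n z) (f z) < e"
      by eventually_elim (use close in \<open>auto simp: dist_real_def intro: le_less_trans\<close>)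
  qed
  moreover have "uniform_limit UNIV (\<lambda>n. generator P (F n)) (generator P f) sequentially"
    unfolding genF genf
  proof (rule uniform_limitI)
    fix e :: real assume "0 < e"
    then have "0 < e / 2" by simp
    then have "\<forall>\<^sub>F n in sequentially. inverse (real (Suc n)) < e / 2"
      by (rule order_tendstoD(2)[OF LIMSEQ_inverse_real_of_nat])
    then show "\<forall>\<^sub>F n in sequentially. \<forall>z\<in>UNIV. dist (gen (F n) z) (g z) < e"
    proof eventually_elim
      case (elim n)
      show ?case
      proof
        fix z
        show "dist (gen (F n) z) (g z) < e"
          using close[of n z] F(2)[of n z] elim unfolding dist_real_def by linarith
      qed
    qed
  qed
  ultimately show "\<exists>F. (\<forall>n. F n \<in> Cc_infinity) \<and> uniform_limit UNIV F f sequentially \<and>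
      uniform_limit UNIV (\<lambda>n. generator P (F n)) (generator P f) sequentially"
    using F(1) by blast
qed

end

section \<open>First moment of the Gaussian distribution\<close>

lemma gaussian_first_moment:
  fixes \<gamma> :: "'a::euclidean_space measure" and c :: real
  assumes \<gamma>: "prob_space \<gamma>" "\<gamma> = density lborel (\<lambda>x. ennreal (exp (- (norm x)\<^sup>2 / 2) / c))"
    and c: "0 < c"
  shows "integrable \<gamma> norm"
proof (rule integrableI_bounded)
  let ?D = "\<lambda>x::'a. exp (- (norm x)\<^sup>2 / 2) / c"
  have sets: "sets \<gamma> = sets borel" by (simp add: \<gamma>(2))
  show "norm \<in> borel_measurable \<gamma>" by (simp add: measurable_cong_sets[OF sets refl])
  have mass: "(\<integral>\<^sup>+x. ?D x \<partial>lborel) = 1"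
    using prob_space.emeasure_space_1[OF \<gamma>(1)] by (simp add: \<gamma>(2) emeasure_density)
  \<comment> \<open>a factor \<open>exp (- 3\<bar>x\<bar>\<^sup>2/8)\<close> absorbs \<open>\<bar>x\<bar>\<close>; what remains is a Gaussian of twice the width\<close>
  have bound: "norm x * ?D x \<le> 2 * ?D (x /\<^sub>R 2)" for x :: 'a
  proof -
    have "0 \<le> (norm x - 2/3)\<^sup>2" by simp
    then have "norm x \<le> 2 * (1 + 3 * (norm x)\<^sup>2 / 8)"
      by (simp add: power2_eq_square algebra_simps)
    also have "\<dots> \<le> 2 * exp (3 * (norm x)\<^sup>2 / 8)"
      by (intro mult_left_mono exp_ge_add_one_self) simp
    finally have "norm x * exp (- (norm x)\<^sup>2 / 2) \<le> 2 * exp (3 * (norm x)\<^sup>2 / 8) * exp (- (norm x)\<^sup>2 / 2)"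
      by (intro mult_right_mono) auto
    also have "\<dots> = 2 * exp (- (norm (x /\<^sub>R 2))\<^sup>2 / 2)"
      by (simp add: mult.assoc exp_add[symmetric] power_mult_distrib power_divide)
    finally show ?thesis using c by (simp add: field_simps)
  qed
  have "(\<integral>\<^sup>+x. ennreal (norm (norm x)) \<partial>\<gamma>) = (\<integral>\<^sup>+x. ennreal (norm x * ?D x) \<partial>lborel)"
    using c by (simp add: \<gamma>(2) nn_integral_density ennreal_mult'[symmetric] mult.commute)
  also have "\<dots> \<le> (\<integral>\<^sup>+x. ennreal (2 * ?D (x /\<^sub>R 2)) \<partial>lborel)"
    by (intro nn_integral_mono ennreal_leI bound)
  also have "\<dots> = 2 * (\<integral>\<^sup>+x. ennreal (?D (x /\<^sub>R 2)) \<partial>lborel)"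
  proof -
    have "ennreal (2 * ?D (x /\<^sub>R 2)) = 2 * ennreal (?D (x /\<^sub>R 2))" for x :: 'a
      by (subst ennreal_mult') auto
    then show ?thesis by (simp only:) (rule nn_integral_cmult, measurable)
  qed
  also have "(\<integral>\<^sup>+x. ennreal (?D (x /\<^sub>R 2)) \<partial>lborel) = ennreal (2 ^ DIM('a)) * (\<integral>\<^sup>+x. ennreal (?D x) \<partial>lborel)"
  proof -
    have "(\<integral>\<^sup>+x. ennreal (?D (x /\<^sub>R 2)) \<partial>lborel) =
        (\<integral>\<^sup>+x. ennreal (?D (x /\<^sub>R 2)) \<partial>density (distr lborel borel (\<lambda>x::'a. 0 + 2 *\<^sub>R x)) (\<lambda>_. ennreal (\<bar>2\<bar> ^ DIM('a))))"
      using lborel_affine[of 2 "0::'a"] by simp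
    also have "\<dots> = (\<integral>\<^sup>+x. ennreal (2 ^ DIM('a)) * ennreal (?D x) \<partial>lborel)"
      by (subst nn_integral_density) (auto simp: nn_integral_distr)
    finally show ?thesis by (simp add: nn_integral_cmult)
  qed
  also have "2 * (ennreal (2 ^ DIM('a)) * (\<integral>\<^sup>+x. ennreal (?D x) \<partial>lborel)) < \<infinity>"
    unfolding mass by (simp add: ennreal_mult_less_top)
  finally show "(\<integral>\<^sup>+x. ennreal (norm (norm x)) \<partial>\<gamma>) < \<infinity>" .
qed

section \<open>The law of one stage\<close>

locale bps_process = bps_stage N U r T1 T2 \<xi>
  for N :: "'w measure" and U :: "'a::euclidean_space \<Rightarrow> real" and r T1 T2 \<xi> +
  fixes \<alpha> :: real
  assumes U_C1: "Ck 1 U" and r: "0 < r" and \<alpha>01: "0 < \<alpha>" "\<alpha> \<le> 1"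
begin

lemma T2_measurable [measurable]: "T2 \<in> borel_measurable N"
  using distributed_measurable[OF T2_law] by simp

lemma \<xi>_measurable [measurable]: "\<xi> \<in> borel_measurable N"
  using distributed_measurable[OF \<xi>_law] by simp

lemma distr_\<xi>: "distr N borel \<xi> = density lborel (\<lambda>x. ennreal (exp (- (norm x)\<^sup>2 / 2) / sqrt (2 * pi) ^ DIM('a)))"
  using distributed_distr_eq_density[OF \<xi>_law] distr_cong[of N N borel lborel \<xi> \<xi>] by simp

lemma distr_T2: "distr N borel T2 = density lborel (\<lambda>x. ennreal (exponential_density r x))"
  using distributed_distr_eq_density[OF T2_law] distr_cong[of N N borel lborel T2 T2] by simp

end

sublocale bps_process \<subseteq> bps_kernel U "distr N borel \<xi>" r \<alpha>
proof -
  interpret \<xi>: prob_space "distr N borel \<xi>" by (rule prob_space_distr) simp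
  show "bps_kernel U (distr N borel \<xi>) r \<alpha>"
  proof
    show "Ck 1 U" by (rule U_C1)
    show "integrable (distr N borel \<xi>) norm"
      by (rule gaussian_first_moment[OF \<xi>.prob_space_axioms distr_\<xi>]) simp
  qed (auto simp: U_C1 r \<alpha>01)
qed

context bps_process
begin

abbreviation "\<gamma> \<equiv> distr N borel \<xi>"

abbreviation "bounce_law z \<equiv> distr N borel (T1 z)"

lemma T1_measurable1 [measurable]: "T1 z \<in> borel_measurable N"
proof -
  have "(\<lambda>w. (\<lambda>(z, w). T1 z w) (z, w)) \<in> borel_measurable N"
    by (rule measurable_compose[OF measurable_Pair1' T1_measurable]) simp
  then show ?thesis by simp
qed

lemma prob_bounce_law: "prob_space (bounce_law z)"
  by (rule prob_space_distr) simp

lemma bounce_law_atLeast: "0 \<le> t \<Longrightarrow> measure (bounce_law z) {ennreal t..} = exp (- hazard t z)"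
  using T1_law[of t z] by (subst measure_distr) (auto simp: hazard_def vimage_def Int_def conj_commute)

lemma continuous_on_hazard_slice: "continuous_on S (\<lambda>t. hazard t z)"
  using continuous_on_compose2[OF continuous_on_hazard continuous_on_Pair[OF continuous_on_id continuous_on_const[of _ z]]]
  by simp

lemma bounce_law_greaterThan:
  assumes x: "0 \<le> x" shows "measure (bounce_law z) {ennreal x<..} = exp (- hazard x z)"
proof -
  interpret B: prob_space "bounce_law z" by (rule prob_bounce_law)
  let ?y = "\<lambda>n. x + inverse (real (Suc n))"
  have U: "(\<Union>n. {ennreal (?y n)..}) = {ennreal x<..}"
  proof (intro set_eqI iffI)
    fix a assume "a \<in> (\<Union>n. {ennreal (?y n)..})"
    then obtain n where "ennreal (?y n) \<le> a" by auto
    moreover have "ennreal x < ennreal (?y n)" using x by (intro ennreal_lessI) (auto intro: add_nonneg_pos)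
    ultimately show "a \<in> {ennreal x<..}" by auto
  next
    fix a assume "a \<in> {ennreal x<..}"
    then have a: "ennreal x < a" by simp
    show "a \<in> (\<Union>n. {ennreal (?y n)..})"
    proof (cases a rule: ennreal_cases)
      case (real b)
      then have "0 < b - x" using a x by (simp add: ennreal_less_iff)
      then obtain n where "inverse (real (Suc n)) < b - x" using reals_Archimedean by blast
      then have "ennreal (?y n) \<le> a" using real by (auto intro!: ennreal_leI)
      then show ?thesis by blast
    qed auto
  qed
  have "(\<lambda>n. measure (bounce_law z) {ennreal (?y n)..}) \<longlonglongrightarrow> measure (bounce_law z) (\<Union>n. {ennreal (?y n)..})"
  proof (rule B.finite_Lim_measure_incseq)
    show "incseq (\<lambda>n. {ennreal (?y n)..})"
    proof (rule incseq_SucI)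
      fix n
      have "ennreal (?y (Suc n)) \<le> ennreal (?y n)" by (intro ennreal_leI add_left_mono le_imp_inverse_le) auto
      then show "{ennreal (?y n)..} \<subseteq> {ennreal (?y (Suc n))..}" by simp
    qed
  qed auto
  moreover have "(\<lambda>n. exp (- hazard (?y n) z)) \<longlonglongrightarrow> exp (- hazard x z)"
  proof -
    have "?y \<longlonglongrightarrow> x + 0" by (intro tendsto_add tendsto_const LIMSEQ_inverse_real_of_nat)
    then have "(\<lambda>n. hazard (?y n) z) \<longlonglongrightarrow> hazard x z"
      using continuous_on_tendsto_compose[OF continuous_on_hazard_slice[of UNIV z], of ?y x sequentially] by simp
    then show ?thesis by (intro tendsto_intros)
  qed
  moreover have "measure (bounce_law z) {ennreal (?y n)..} = exp (- hazard (?y n) z)" for n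
    using x by (intro bounce_law_atLeast) simp
  ultimately show ?thesis unfolding U using LIMSEQ_unique by simp
qed

definition bounce_density :: "'a \<times> 'a \<Rightarrow> real \<Rightarrow> real" where
  "bounce_density z s = bounce_rate U (flow s z) * exp (- hazard s z)"

lemma bounce_density_nonneg: "0 \<le> bounce_density z s"
  by (simp add: bounce_density_def bounce_rate_nonneg)

lemma continuous_on_bounce_density: "continuous_on S (bounce_density z)"
  unfolding bounce_density_def by (intro continuous_intros continuous_on_hazard_slice)

lemma bounce_density_measurable [measurable]: "bounce_density z \<in> borel_measurable borel"
  by (rule borel_measurable_continuous_onI[OF continuous_on_bounce_density])

lemma bounce_density_integral:
  assumes "0 \<le> x" "x \<le> t"
  shows "(\<integral>\<^sup>+s. ennreal (indicator {x..t} s * bounce_density z s) \<partial>lborel) = ennreal (exp (- hazard x z) - exp (- hazard t z))"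
proof -
  have "((\<lambda>s. - exp (- hazard s z)) has_real_derivative bounce_density z s) (at s within {x..t})" if s: "s \<in> {x..t}" for s
  proof -
    have "((\<lambda>s. hazard s z) has_real_derivative bounce_rate U (flow s z)) (at s within {0..t})"
      unfolding hazard_def using s assms by (intro integral_has_real_derivative continuous_intros) auto
    then have "((\<lambda>s. hazard s z) has_real_derivative bounce_rate U (flow s z)) (at s within {x..t})"
      by (rule DERIV_subset) (use assms in auto)
    then show ?thesis by (auto intro!: derivative_eq_intros simp: bounce_density_def)
  qed
  then have "(bounce_density z has_integral - exp (- hazard t z) - - exp (- hazard x z)) {x..t}"
    using assms by (intro fundamental_theorem_of_calculus)
      (auto simp: has_real_derivative_iff_has_vector_derivative[symmetric])
  from nn_integral_has_integral_lebesgue[OF bounce_density_nonneg this]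
  show ?thesis by simp
qed

text \<open>
  The bounce time may be infinite with positive probability, hence the finite horizon \<open>t\<close>. Both
  sides integrate \<open>h\<close> against measures on the real line that agree on all half-lines.
\<close>

lemma bounce_law_density:
  assumes t: "0 \<le> t" and [measurable]: "h \<in> borel_measurable borel"
  shows "(\<integral>\<^sup>+a. h (enn2real a) * indicator {..ennreal t} a \<partial>bounce_law z) =
    (\<integral>\<^sup>+s. ennreal (indicator {0..t} s * bounce_density z s) * h s \<partial>lborel)"
proof -
  interpret B: prob_space "bounce_law z" by (rule prob_bounce_law)
  let ?\<nu> = "distr (density (bounce_law z) (indicator {..ennreal t})) borel enn2real"
  let ?\<kappa> = "density lborel (\<lambda>s. ennreal (indicator {0..t} s * bounce_density z s))"
  have "?\<nu> = ?\<kappa>"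
  proof (rule measure_eqI_lessThan)
    have \<nu>: "emeasure ?\<nu> {x<..} = emeasure (bounce_law z) {a. a \<le> ennreal t \<and> x < enn2real a}" for x
    proof -
      have A: "enn2real -` {x<..} \<in> sets borel"
        using measurable_sets[of enn2real borel borel "{x<..}"] by simp
      have "emeasure ?\<nu> {x<..} = emeasure (density (bounce_law z) (indicator {..ennreal t})) (enn2real -` {x<..})"
        by (subst emeasure_distr) auto
      also have "\<dots> = (\<integral>\<^sup>+a. indicator {..ennreal t} a * indicator (enn2real -` {x<..}) a \<partial>bounce_law z)"
        using A by (intro emeasure_density) auto
      also have "\<dots> = (\<integral>\<^sup>+a. indicator {a. a \<le> ennreal t \<and> x < enn2real a} a \<partial>bounce_law z)"
        by (intro nn_integral_cong) (auto simp: indicator_def)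
      also have "\<dots> = emeasure (bounce_law z) {a. a \<le> ennreal t \<and> x < enn2real a}"
        by (rule nn_integral_indicator) measurable
      finally show ?thesis .
    qed
    show "emeasure ?\<nu> {x<..} < \<infinity>" for x
      unfolding \<nu> by (simp add: B.emeasure_eq_measure)
    fix x :: real
    have pos: "emeasure ?\<nu> {y<..} = ennreal (exp (- hazard y z) - exp (- hazard t z))" if y: "0 \<le> y" "y \<le> t" for y
    proof -
      have "{a. a \<le> ennreal t \<and> y < enn2real a} = {ennreal y<..} - {ennreal t<..}"
      proof (intro set_eqI)
        fix a show "a \<in> {a. a \<le> ennreal t \<and> y < enn2real a} \<longleftrightarrow> a \<in> {ennreal y<..} - {ennreal t<..}"
          using y by (cases a rule: ennreal_cases) (auto simp: ennreal_less_iff not_less top_unique)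
      qed
      then have "measure (bounce_law z) {a. a \<le> ennreal t \<and> y < enn2real a} =
          measure (bounce_law z) {ennreal y<..} - measure (bounce_law z) {ennreal t<..}"
        using y by (simp only:) (rule B.finite_measure_Diff; auto intro: less_le_trans simp: ennreal_leI le_less_trans)
      then show ?thesis
        unfolding \<nu> B.emeasure_eq_measure using bounce_law_greaterThan y t by simp
    qed
    show "emeasure ?\<nu> {x<..} = emeasure ?\<kappa> {x<..}"
    proof -
      have \<kappa>: "emeasure ?\<kappa> {x<..} = (\<integral>\<^sup>+s. ennreal (indicator {max 0 x..t} s * bounce_density z s) \<partial>lborel)"
      proof -
        have "AE s in lborel. s \<noteq> x" by (rule AE_lborel_singleton)
        then show ?thesis
          by (subst emeasure_density) (auto intro!: nn_integral_cong_AE simp: indicator_def elim!: AE_mp)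
      qed
      consider "x < 0" | "0 \<le> x" "x \<le> t" | "t < x" by linarith
      then show ?thesis
      proof cases
        case 1
        have "emeasure ?\<nu> {x<..} = emeasure ?\<nu> {0<..}"
        proof -
          have "{a. a \<le> ennreal t \<and> x < enn2real a} = {a. a \<le> ennreal t}"
            using 1 by (auto intro: less_le_trans[OF _ enn2real_nonneg])
          moreover have "emeasure (bounce_law z) {a. a \<le> ennreal t} = ennreal (1 - exp (- hazard t z))"
          proof -
            have "{a. a \<le> ennreal t} = space (bounce_law z) - {ennreal t<..}" by auto
            then have "measure (bounce_law z) {a. a \<le> ennreal t} = 1 - measure (bounce_law z) {ennreal t<..}"
              by (simp only:) (rule B.prob_compl, simp)
            then show ?thesis unfolding B.emeasure_eq_measure using bounce_law_greaterThan[OF t] by simp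
          qed
          ultimately show ?thesis using pos[of 0] t unfolding \<nu> by (simp add: hazard_def)
        qed
        then show ?thesis using pos[of 0] bounce_density_integral[of 0 t z] t 1 unfolding \<kappa> by (simp add: max_def)
      next
        case 2
        then show ?thesis using pos[of x] bounce_density_integral[of x t z] unfolding \<kappa> by (simp add: max_def)
      next
        case 3
        have "a \<le> ennreal t \<Longrightarrow> \<not> x < enn2real a" for a
          using 3 t enn2real_mono[of a "ennreal t"] by auto
        then have empty: "{a. a \<le> ennreal t \<and> x < enn2real a} = {}" by blast
        have "emeasure ?\<nu> {x<..} = 0" unfolding \<nu> empty by simp
        moreover have "emeasure ?\<kappa> {x<..} = 0" unfolding \<kappa> using 3 t by simp
        ultimately show ?thesis by simp
      qed
    qed
  qed auto
  then have "(\<integral>\<^sup>+s. h s \<partial>?\<nu>) = (\<integral>\<^sup>+s. h s \<partial>?\<kappa>)" by simp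
  moreover have "(\<integral>\<^sup>+s. h s \<partial>?\<nu>) = (\<integral>\<^sup>+a. h (enn2real a) * indicator {..ennreal t} a \<partial>bounce_law z)"
    by (simp add: nn_integral_distr nn_integral_density mult.commute)
  moreover have "(\<integral>\<^sup>+s. h s \<partial>?\<kappa>) = (\<integral>\<^sup>+s. ennreal (indicator {0..t} s * bounce_density z s) * h s \<partial>lborel)"
    by (simp add: nn_integral_density)
  ultimately show ?thesis by simp
qed

lemma prob_T2_ge:
  "emeasure (distr N borel T2) {b. a \<le> ennreal b} = (if a = \<infinity> then 0 else ennreal (exp (- r * enn2real a)))"
proof (cases a rule: ennreal_cases)
  case (real s)
  interpret X: prob_space "distr N borel T2" by (rule prob_space_distr) simp
  show ?thesis
  proof (cases "s = 0")
    case True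
    then have "{b. a \<le> ennreal b} = space (distr N borel T2)" using real by auto
    then show ?thesis using real True X.emeasure_space_1 by (simp add: top_unique)
  next
    case False
    with real have s: "0 < s" by simp
    have "{b. a \<le> ennreal b} = {s..}" using s real by (auto simp: ennreal_le_iff2)
    moreover have "emeasure (distr N borel T2) {s..} = emeasure (distr N borel T2) {s<..}"
    proof (rule emeasure_eq_AE)
      show "AE x in distr N borel T2. (x \<in> {s..}) = (x \<in> {s<..})"
        unfolding distr_T2 using AE_lborel_singleton[of s]
        by (subst AE_density) (auto elim!: AE_mp)
    qed auto
    moreover have "measure (distr N borel T2) {s<..} = exp (- s * r)"
      using exponential_distributedD_gt[OF T2_law, of s] s r
      by (subst measure_distr) (auto simp: vimage_def Int_def conj_commute)
    ultimately show ?thesis using real by (simp add: X.emeasure_eq_measure mult.commute)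
  qed
qed (simp add: top_unique)

abbreviation "len \<equiv> stage_length T1 T2"

text \<open>
  A payoff at the end of the stage, provided that this is no later than \<open>t\<close>: \<open>g1\<close> is paid at a bounce
  and \<open>g2\<close>, which sees the fresh velocity, at a refreshment. Payoffs receive the time only, since the
  state before the jump is a function of it. \<open>stage_density\<close> is the density of the expected payoff in
  time.
\<close>

abbreviation stage_value ::
    "real \<Rightarrow> 'a \<times> 'a \<Rightarrow> (real \<Rightarrow> ennreal) \<Rightarrow> (real \<times> 'a \<Rightarrow> ennreal) \<Rightarrow> 'w \<Rightarrow> ennreal" where
  "stage_value t z g1 g2 w \<equiv>
    (if T1 z w \<le> ennreal (T2 w) then (if len z w \<le> t then g1 (len z w) else 0)
     else (if len z w \<le> t then g2 (len z w, \<xi> w) else 0))"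

abbreviation stage_density ::
    "'a \<times> 'a \<Rightarrow> (real \<Rightarrow> ennreal) \<Rightarrow> (real \<times> 'a \<Rightarrow> ennreal) \<Rightarrow> real \<Rightarrow> ennreal" where
  "stage_density z g1 g2 s \<equiv> ennreal (surv s z * bounce_rate U (flow s z)) * g1 s
    + ennreal (surv s z * r) * (\<integral>\<^sup>+x. g2 (s, x) \<partial>\<gamma>)"

text \<open>
  Independence turns the law of the triple \<open>(T1, T2, \<xi>)\<close> into a product. On the event that the
  bounce comes first, \<open>T2\<close> only contributes its survival function, and vice versa.
\<close>

lemma stage_law:
  assumes t: "0 \<le> t" and [measurable]: "g1 \<in> borel_measurable borel" "g2 \<in> borel_measurable (borel \<Otimes>\<^sub>M borel)"
  shows "(\<integral>\<^sup>+w. stage_value t z g1 g2 w \<partial>N) =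
    (\<integral>\<^sup>+s. indicator {0..t} s * stage_density z g1 g2 s \<partial>lborel)"
proof -
  let ?X = "distr N borel T2"
  interpret B: prob_space "bounce_law z" by (rule prob_bounce_law)
  interpret X: prob_space ?X by (rule prob_space_distr) simp
  interpret X\<gamma>: pair_prob_space ?X \<gamma> ..
  interpret BX\<gamma>: pair_prob_space "bounce_law z" "?X \<Otimes>\<^sub>M \<gamma>" ..
  let ?M = "borel \<Otimes>\<^sub>M borel \<Otimes>\<^sub>M borel :: (ennreal \<times> real \<times> 'a) measure"
  define F1 where "F1 y = (if fst y \<le> ennreal (fst (snd y)) \<and> fst y \<le> ennreal t then g1 (enn2real (fst y)) else 0)"
    for y :: "ennreal \<times> real \<times> 'a"
  \<comment> \<open>\<open>T2\<close> may be negative on a null set, where the length of the stage is \<open>0\<close>; hence \<open>max 0\<close>\<close>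
  define F2 where "F2 y = (if \<not> fst y \<le> ennreal (fst (snd y)) \<and> fst (snd y) \<le> t
      then g2 (max 0 (fst (snd y)), snd (snd y)) else 0)" for y :: "ennreal \<times> real \<times> 'a"
  have sets: "sets (bounce_law z \<Otimes>\<^sub>M ?X \<Otimes>\<^sub>M \<gamma>) = sets ?M"
    by (intro sets_pair_measure_cong) auto
  have F1m [measurable]: "F1 \<in> borel_measurable ?M"
    unfolding F1_def[abs_def] by measurable
  have F2m [measurable]: "F2 \<in> borel_measurable ?M"
    unfolding F2_def[abs_def] by measurable
  have F12m: "F1 \<in> borel_measurable (bounce_law z \<Otimes>\<^sub>M ?X \<Otimes>\<^sub>M \<gamma>)" "F2 \<in> borel_measurable (bounce_law z \<Otimes>\<^sub>M ?X \<Otimes>\<^sub>M \<gamma>)"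
    unfolding measurable_cong_sets[OF sets refl] by (rule F1m, rule F2m)
  have point: "stage_value t z g1 g2 w =
      F1 (T1 z w, T2 w, \<xi> w) + F2 (T1 z w, T2 w, \<xi> w)" for w
  proof (cases "T1 z w \<le> ennreal (T2 w)")
    case True
    then have "T1 z w < \<infinity>" by (rule le_less_trans) (simp add: ennreal_less_top)
    then have "enn2real (T1 z w) \<le> t \<longleftrightarrow> T1 z w \<le> ennreal t"
      using t by (cases "T1 z w" rule: ennreal_cases) (auto simp: ennreal_le_iff)
    then show ?thesis using True by (simp add: F1_def F2_def stage_length_def min_def)
  next
    case False
    then have "stage_length T1 T2 z w = enn2real (ennreal (T2 w))"
      by (simp add: stage_length_def min_def)
    also have "\<dots> = max 0 (T2 w)" by (cases "0 \<le> T2 w") (auto simp: ennreal_neg max_def)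
    finally show ?thesis using False t by (simp add: F1_def F2_def)
  qed
  have tripm: "(\<lambda>w. (T1 z w, T2 w, \<xi> w)) \<in> N \<rightarrow>\<^sub>M ?M" by measurable
  have "(\<integral>\<^sup>+w. F1 (T1 z w, T2 w, \<xi> w) + F2 (T1 z w, T2 w, \<xi> w) \<partial>N) =
      (\<integral>\<^sup>+y. F1 y + F2 y \<partial>distr N ?M (\<lambda>w. (T1 z w, T2 w, \<xi> w)))"
    by (subst nn_integral_distr[OF tripm]) auto
  also have "\<dots> = (\<integral>\<^sup>+y. F1 y \<partial>(bounce_law z \<Otimes>\<^sub>M ?X \<Otimes>\<^sub>M \<gamma>)) + (\<integral>\<^sup>+y. F2 y \<partial>(bounce_law z \<Otimes>\<^sub>M ?X \<Otimes>\<^sub>M \<gamma>))"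
    unfolding independent by (rule nn_integral_add[OF F12m])
  also have "(\<integral>\<^sup>+y. F1 y \<partial>(bounce_law z \<Otimes>\<^sub>M ?X \<Otimes>\<^sub>M \<gamma>)) =
      (\<integral>\<^sup>+s. ennreal (indicator {0..t} s * bounce_density z s) * (ennreal (exp (- r * s)) * g1 s) \<partial>lborel)"
  proof -
    define k where "k a b = (if a \<le> ennreal b \<and> a \<le> ennreal t then g1 (enn2real a) else 0)" for a b
    have km: "(\<lambda>p. k a (fst p)) \<in> borel_measurable (?X \<Otimes>\<^sub>M \<gamma>)" for a
      unfolding k_def by measurable
    have "(\<integral>\<^sup>+y. F1 y \<partial>(bounce_law z \<Otimes>\<^sub>M ?X \<Otimes>\<^sub>M \<gamma>)) =
        (\<integral>\<^sup>+a. (\<integral>\<^sup>+p. F1 (a, p) \<partial>(?X \<Otimes>\<^sub>M \<gamma>)) \<partial>bounce_law z)"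
      by (rule X\<gamma>.P.nn_integral_fst[OF F12m(1), symmetric])
    also have "\<dots> = (\<integral>\<^sup>+a. (\<integral>\<^sup>+b. k a b \<partial>?X) \<partial>bounce_law z)"
    proof (intro nn_integral_cong)
      fix a
      have "(\<integral>\<^sup>+p. F1 (a, p) \<partial>(?X \<Otimes>\<^sub>M \<gamma>)) = (\<integral>\<^sup>+p. k a (fst p) \<partial>(?X \<Otimes>\<^sub>M \<gamma>))"
        by (simp only: F1_def k_def fst_conv snd_conv)
      also have "\<dots> = (\<integral>\<^sup>+b. (\<integral>\<^sup>+x. k a (fst (b, x)) \<partial>\<gamma>) \<partial>?X)"
        by (rule G.nn_integral_fst[OF km, symmetric])
      also have "\<dots> = (\<integral>\<^sup>+b. k a b \<partial>?X)"
        by (simp only: fst_conv nn_integral_const G.emeasure_space_1 mult_1_right)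
      finally show "(\<integral>\<^sup>+p. F1 (a, p) \<partial>(?X \<Otimes>\<^sub>M \<gamma>)) = (\<integral>\<^sup>+b. k a b \<partial>?X)" .
    qed
    also have "\<dots> = (\<integral>\<^sup>+a. (ennreal (exp (- r * enn2real a)) * g1 (enn2real a)) * indicator {..ennreal t} a \<partial>bounce_law z)"
    proof (intro nn_integral_cong)
      fix a
      have "(\<integral>\<^sup>+b. k a b \<partial>?X) = (\<integral>\<^sup>+b. (g1 (enn2real a) * indicator {..ennreal t} a) * indicator {b. a \<le> ennreal b} b \<partial>?X)"
        by (intro nn_integral_cong) (auto simp: k_def indicator_def)
      also have "\<dots> = (g1 (enn2real a) * indicator {..ennreal t} a) * emeasure ?X {b. a \<le> ennreal b}"
        by (rule nn_integral_cmult_indicator) measurable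
      finally show "(\<integral>\<^sup>+b. k a b \<partial>?X) = (ennreal (exp (- r * enn2real a)) * g1 (enn2real a)) * indicator {..ennreal t} a"
        unfolding prob_T2_ge by (auto simp: indicator_def top_unique mult.commute)
    qed
    also have "\<dots> = (\<integral>\<^sup>+s. ennreal (indicator {0..t} s * bounce_density z s) * (ennreal (exp (- r * s)) * g1 s) \<partial>lborel)"
      by (rule bounce_law_density[OF t]) measurable
    finally show ?thesis .
  qed
  also have "(\<integral>\<^sup>+y. F2 y \<partial>(bounce_law z \<Otimes>\<^sub>M ?X \<Otimes>\<^sub>M \<gamma>)) =
      (\<integral>\<^sup>+s. indicator {0..t} s * (ennreal (surv s z * r) * (\<integral>\<^sup>+x. g2 (s, x) \<partial>\<gamma>)) \<partial>lborel)"
  proof -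
    have g2x [measurable]: "(\<lambda>b. \<integral>\<^sup>+x. g2 (b, x) \<partial>\<gamma>) \<in> borel_measurable borel"
      by (rule G.borel_measurable_nn_integral_fst) measurable
    have gt [measurable]: "(\<lambda>b. emeasure (bounce_law z) {ennreal b<..}) \<in> borel_measurable borel"
    proof -
      have "emeasure (bounce_law z) {ennreal b<..} = ennreal (exp (- hazard b z))" for b
        using bounce_law_greaterThan[of "max 0 b" z]
        by (cases "0 \<le> b") (auto simp: B.emeasure_eq_measure hazard_def ennreal_neg max_def)
      then show ?thesis
        by (simp only:) (intro measurable_compose[OF _ measurable_ennreal] borel_measurable_continuous_onI
          continuous_on_exp continuous_on_minus continuous_on_hazard_slice)
    qed
    define h where "h p = emeasure (bounce_law z) {ennreal (fst p)<..} * indicator {..t} (fst p) * g2 (max 0 (fst p), snd p)"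
      for p :: "real \<times> 'a"
    have hm: "h \<in> borel_measurable (?X \<Otimes>\<^sub>M \<gamma>)"
      unfolding h_def[abs_def] by measurable
    have "(\<integral>\<^sup>+y. F2 y \<partial>(bounce_law z \<Otimes>\<^sub>M ?X \<Otimes>\<^sub>M \<gamma>)) =
        (\<integral>\<^sup>+p. (\<integral>\<^sup>+a. F2 (a, p) \<partial>bounce_law z) \<partial>(?X \<Otimes>\<^sub>M \<gamma>))"
      by (rule BX\<gamma>.nn_integral_snd[symmetric]) (simp add: F12m)
    also have "\<dots> = (\<integral>\<^sup>+p. h p \<partial>(?X \<Otimes>\<^sub>M \<gamma>))"
    proof (intro nn_integral_cong)
      fix p :: "real \<times> 'a"
      let ?c = "indicator {..t} (fst p) * g2 (max 0 (fst p), snd p)"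
      have "(\<integral>\<^sup>+a. F2 (a, p) \<partial>bounce_law z) = (\<integral>\<^sup>+a. ?c * indicator {ennreal (fst p)<..} a \<partial>bounce_law z)"
        by (intro nn_integral_cong) (auto simp: F2_def indicator_def not_le)
      also have "\<dots> = ?c * emeasure (bounce_law z) {ennreal (fst p)<..}"
        by (rule nn_integral_cmult_indicator) simp
      finally show "(\<integral>\<^sup>+a. F2 (a, p) \<partial>bounce_law z) = h p"
        by (simp add: h_def mult_ac)
    qed
    also have "\<dots> = (\<integral>\<^sup>+b. (\<integral>\<^sup>+x. h (b, x) \<partial>\<gamma>) \<partial>?X)"
      by (rule G.nn_integral_fst[OF hm, symmetric])
    also have "\<dots> = (\<integral>\<^sup>+b. emeasure (bounce_law z) {ennreal b<..} * indicator {..t} b * (\<integral>\<^sup>+x. g2 (max 0 b, x) \<partial>\<gamma>) \<partial>?X)"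
      unfolding h_def fst_conv snd_conv by (intro nn_integral_cong nn_integral_cmult) measurable
    also have "\<dots> = (\<integral>\<^sup>+b. ennreal (exponential_density r b) *
        (emeasure (bounce_law z) {ennreal b<..} * indicator {..t} b * (\<integral>\<^sup>+x. g2 (max 0 b, x) \<partial>\<gamma>)) \<partial>lborel)"
      unfolding distr_T2 by (rule nn_integral_density) measurable
    also have "\<dots> = (\<integral>\<^sup>+s. indicator {0..t} s * (ennreal (surv s z * r) * (\<integral>\<^sup>+x. g2 (s, x) \<partial>\<gamma>)) \<partial>lborel)"
    proof (intro nn_integral_cong)
      fix b :: real
      show "ennreal (exponential_density r b) *
          (emeasure (bounce_law z) {ennreal b<..} * indicator {..t} b * (\<integral>\<^sup>+x. g2 (max 0 b, x) \<partial>\<gamma>)) =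
          indicator {0..t} b * (ennreal (surv b z * r) * (\<integral>\<^sup>+x. g2 (b, x) \<partial>\<gamma>))"
      proof (cases "b \<in> {0..t}")
        case True
        then have "emeasure (bounce_law z) {ennreal b<..} = ennreal (exp (- hazard b z))"
          by (simp add: B.emeasure_eq_measure bounce_law_greaterThan)
        moreover have "exponential_density r b * exp (- hazard b z) = surv b z * r"
          using True by (simp add: exponential_density_def surv_def exp_add[symmetric] mult_ac)
        then have "ennreal (exponential_density r b) * ennreal (exp (- hazard b z)) = ennreal (surv b z * r)"
          by (simp add: ennreal_mult''[symmetric])
        ultimately show ?thesis using True by (simp add: mult.assoc[symmetric] max_def)
      qed (auto simp: exponential_density_def)
    qed
    finally show ?thesis .
  qed
  also have "(\<integral>\<^sup>+s. ennreal (indicator {0..t} s * bounce_density z s) * (ennreal (exp (- r * s)) * g1 s) \<partial>lborel)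
      + (\<integral>\<^sup>+s. indicator {0..t} s * (ennreal (surv s z * r) * (\<integral>\<^sup>+x. g2 (s, x) \<partial>\<gamma>)) \<partial>lborel) =
    (\<integral>\<^sup>+s. indicator {0..t} s * stage_density z g1 g2 s \<partial>lborel)"
  proof (subst nn_integral_add[symmetric])
    have [measurable]: "(\<lambda>s. surv s z) \<in> borel_measurable borel"
      by (intro borel_measurable_continuous_onI continuous_intros)
    have [measurable]: "(\<lambda>b. \<integral>\<^sup>+x. g2 (b, x) \<partial>\<gamma>) \<in> borel_measurable borel"
      by (rule G.borel_measurable_nn_integral_fst) measurable
    show "(\<lambda>s. indicator {0..t} s * (ennreal (surv s z * r) * (\<integral>\<^sup>+x. g2 (s, x) \<partial>\<gamma>))) \<in> borel_measurable lborel"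
      by measurable
    show "(\<lambda>s. ennreal (indicator {0..t} s * bounce_density z s) * (ennreal (exp (- r * s)) * g1 s)) \<in> borel_measurable lborel"
      by measurable
    show "(\<integral>\<^sup>+s. ennreal (indicator {0..t} s * bounce_density z s) * (ennreal (exp (- r * s)) * g1 s)
        + indicator {0..t} s * (ennreal (surv s z * r) * (\<integral>\<^sup>+x. g2 (s, x) \<partial>\<gamma>)) \<partial>lborel) =
      (\<integral>\<^sup>+s. indicator {0..t} s * stage_density z g1 g2 s \<partial>lborel)"
    proof (intro nn_integral_cong)
      fix s
      have "bounce_density z s * exp (- r * s) = surv s z * bounce_rate U (flow s z)"
        by (simp add: bounce_density_def surv_def exp_add[symmetric] mult_ac)
      then have "ennreal (bounce_density z s) * ennreal (exp (- r * s)) = ennreal (surv s z * bounce_rate U (flow s z))"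
        by (simp add: ennreal_mult''[symmetric])
      then show "ennreal (indicator {0..t} s * bounce_density z s) * (ennreal (exp (- r * s)) * g1 s)
          + indicator {0..t} s * (ennreal (surv s z * r) * (\<integral>\<^sup>+x. g2 (s, x) \<partial>\<gamma>)) =
          indicator {0..t} s * stage_density z g1 g2 s"
        by (auto simp: indicator_def mult.assoc[symmetric])
    qed
  qed
  finally show ?thesis unfolding point .
qed

section \<open>The process and its renewal equation\<close>

abbreviation "chain \<equiv> jump_chain U \<alpha> T1 T2 \<xi>"
abbreviation "proc \<equiv> bps U \<alpha> T1 T2 \<xi>"
abbreviation "next_state \<equiv> stage_end U \<alpha> T1 T2 \<xi>"
abbreviation "SN \<equiv> stream_space N"

declare jump_chain.simps(2) [simp del]

lemma chain_Suc:
  "fst (chain z \<omega> (Suc n)) = fst (chain z \<omega> n) + len (snd (chain z \<omega> n)) (\<omega> !! n)"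
  "snd (chain z \<omega> (Suc n)) = next_state (snd (chain z \<omega> n)) (\<omega> !! n)"
  by (simp_all add: jump_chain.simps(2) split_def Let_def)

lemma chain_Stream:
  "fst (chain z (w ## \<omega>) (Suc n)) = len z w + fst (chain (next_state z w) \<omega> n)"
  "snd (chain z (w ## \<omega>) (Suc n)) = snd (chain (next_state z w) \<omega> n)"
proof (induction n)
  case (Suc n)
  {
    case 1
    show ?case unfolding chain_Suc(1)[of z _ "Suc n"] Suc.IH by (simp add: chain_Suc)
  next
    case 2
    show ?case unfolding chain_Suc(2)[of z _ "Suc n"] Suc.IH by (simp add: chain_Suc)
  }
qed (simp_all add: chain_Suc)

lemma proc_eq:
  "proc t z \<omega> = (if \<exists>n. t < fst (chain z \<omega> (Suc n))
    then (let n = (LEAST n. t < fst (chain z \<omega> (Suc n))) in flow (t - fst (chain z \<omega> n)) (snd (chain z \<omega> n)))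
    else z)"
  unfolding bps_def Let_def split_def by (rule refl)

lemma len_nonneg: "0 \<le> len z w"
  by (simp add: stage_length_def)

lemma chain_time_nonneg: "0 \<le> fst (chain z \<omega> n)"
  by (induction n) (auto simp: chain_Suc len_nonneg add_nonneg_nonneg)

lemma proc_before_first_jump:
  assumes "0 \<le> t" "t < len z w" shows "proc t z (w ## \<omega>) = flow t z"
proof -
  have 0: "t < fst (chain z (w ## \<omega>) (Suc 0))"
    using assms by (simp add: chain_Suc)
  then have "(LEAST n. t < fst (chain z (w ## \<omega>) (Suc n))) = 0" by (rule Least_eq_0)
  then show ?thesis using 0 unfolding proc_eq by auto
qed

lemma proc_after_first_jump:
  assumes "len z w \<le> t" and ex: "t - len z w < fst (chain (next_state z w) \<omega> n)"
  shows "proc t z (w ## \<omega>) = proc (t - len z w) (next_state z w) \<omega>"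
proof -
  let ?z = "next_state z w" and ?t = "t - len z w"
  let ?P = "\<lambda>n. t < fst (chain z (w ## \<omega>) (Suc n))" and ?Q = "\<lambda>n. ?t < fst (chain ?z \<omega> (Suc n))"
  have PQ: "?P (Suc n) \<longleftrightarrow> ?Q n" for n unfolding chain_Stream by auto
  have P0: "\<not> ?P 0" unfolding chain_Stream using assms(1) by simp
  obtain m where m: "?Q m" using ex assms(1) by (cases n) auto
  have "(LEAST n. ?P n) = Suc (LEAST n. ?P (Suc n))"
    by (rule Least_Suc[of ?P "Suc m"]) (use PQ m P0 in auto)
  then have L: "(LEAST n. ?P n) = Suc (LEAST n. ?Q n)" unfolding PQ .
  have "\<exists>n. ?P n" "\<exists>n. ?Q n" using PQ m by blast+
  then show ?thesis unfolding proc_eq L by (simp add: chain_Stream Let_def diff_diff_eq)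
qed

lemma len_measurable: "(\<lambda>(y, w). len y w) \<in> borel_measurable (borel \<Otimes>\<^sub>M N)"
proof -
  have [measurable]: "(\<lambda>x. T1 (fst x) (snd x)) \<in> borel_measurable (borel \<Otimes>\<^sub>M N)"
    using T1_measurable by (simp add: split_def)
  show ?thesis unfolding stage_length_def split_def by measurable
qed

lemma bounce_measurable: "bounce U \<in> borel_measurable borel"
proof -
  have [measurable]: "nabla U \<in> borel_measurable borel"
    by (rule borel_measurable_continuous_onI[OF continuous_on_nabla[OF U_C1]])
  have [measurable]: "(fst :: 'a \<times> 'a \<Rightarrow> 'a) \<in> borel_measurable borel" "(snd :: 'a \<times> 'a \<Rightarrow> 'a) \<in> borel_measurable borel"
    by (intro borel_measurable_continuous_onI continuous_intros)+
  show ?thesis unfolding bounce_eq[abs_def] by (intro borel_measurable_Pair) measurable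
qed

lemma measurable_continuous_pair:
  fixes F :: "'b::second_countable_topology \<Rightarrow> 'c::second_countable_topology \<Rightarrow> 'd::topological_space"
  assumes "continuous_on UNIV (\<lambda>p. F (fst p) (snd p))" "g \<in> borel_measurable M" "h \<in> borel_measurable M"
  shows "(\<lambda>x. F (g x) (h x)) \<in> borel_measurable M"
proof -
  have "(\<lambda>p. F (fst p) (snd p)) \<in> borel_measurable (borel \<Otimes>\<^sub>M borel)"
    unfolding borel_prod by (rule borel_measurable_continuous_onI[OF assms(1)])
  from measurable_compose[OF measurable_Pair[OF assms(2,3)] this] show ?thesis by simp
qed

lemma flow_measurable:
  "g \<in> borel_measurable M \<Longrightarrow> h \<in> borel_measurable M \<Longrightarrow> (\<lambda>x. flow (g x) (h x)) \<in> borel_measurable M"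
  by (rule measurable_continuous_pair) (intro continuous_intros)

lemma refresh_map_measurable:
  "g \<in> borel_measurable M \<Longrightarrow> h \<in> borel_measurable M \<Longrightarrow> (\<lambda>x. refresh \<alpha> (g x) (h x)) \<in> borel_measurable M"
  by (rule measurable_continuous_pair) (intro continuous_intros)

lemma next_state_measurable: "(\<lambda>(y, w). next_state y w) \<in> borel_measurable (borel \<Otimes>\<^sub>M N)"
proof -
  have [measurable]: "(\<lambda>x. T1 (fst x) (snd x)) \<in> borel_measurable (borel \<Otimes>\<^sub>M N)"
    using T1_measurable by (simp add: split_def)
  have [measurable]: "(\<lambda>x. len (fst x) (snd x)) \<in> borel_measurable (borel \<Otimes>\<^sub>M N)"
    using len_measurable by (simp add: split_def)
  have fl: "(\<lambda>x. flow (len (fst x) (snd x)) (fst x)) \<in> borel_measurable (borel \<Otimes>\<^sub>M N)"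
    by (intro flow_measurable) measurable
  show ?thesis unfolding stage_end_def split_def Let_def
    by (intro measurable_If measurable_compose[OF fl bounce_measurable] refresh_map_measurable fl) measurable
qed

lemma chain_measurable:
  "(\<lambda>\<omega>. fst (chain z \<omega> n)) \<in> borel_measurable SN" "(\<lambda>\<omega>. snd (chain z \<omega> n)) \<in> borel_measurable SN"
proof (induction n)
  case (Suc n)
  have p: "(\<lambda>\<omega>. (snd (chain z \<omega> n), \<omega> !! n)) \<in> SN \<rightarrow>\<^sub>M borel \<Otimes>\<^sub>M N"
    by (intro measurable_Pair Suc.IH(2) measurable_snth)
  have l: "(\<lambda>\<omega>. len (snd (chain z \<omega> n)) (\<omega> !! n)) \<in> borel_measurable SN"
    using measurable_compose[OF p len_measurable] by simp
  {
    case 1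
    have "(\<lambda>\<omega>. fst (chain z \<omega> n) + len (snd (chain z \<omega> n)) (\<omega> !! n)) \<in> borel_measurable SN"
      by (intro borel_measurable_add Suc.IH(1) l)
    then show ?case by (simp add: chain_Suc)
  next
    case 2
    show ?case using measurable_compose[OF p next_state_measurable] by (simp add: chain_Suc)
  }
qed simp_all

lemma proc_measurable: "proc t z \<in> borel_measurable SN"
proof -
  note [measurable] = chain_measurable
  let ?P = "\<lambda>n \<omega>. t < fst (chain z \<omega> (Suc n))"
  have P [measurable]: "Measurable.pred SN (?P n)" for n
    using chain_measurable(1)[of z "Suc n"] by measurable
  have L: "(\<lambda>\<omega>. LEAST n. ?P n \<omega>) \<in> SN \<rightarrow>\<^sub>M count_space UNIV" by measurable
  have ex: "Measurable.pred SN (\<lambda>\<omega>. \<exists>n. ?P n \<omega>)" by measurable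
  have "(\<lambda>\<omega>. (\<lambda>n \<omega>. flow (t - fst (chain z \<omega> n)) (snd (chain z \<omega> n))) (LEAST n. ?P n \<omega>) \<omega>) \<in> borel_measurable SN"
  proof (rule measurable_compose_countable[OF _ L])
    show "(\<lambda>\<omega>. flow (t - fst (chain z \<omega> n)) (snd (chain z \<omega> n))) \<in> borel_measurable SN" for n
      by (intro flow_measurable borel_measurable_diff borel_measurable_const chain_measurable)
  qed
  then have "(\<lambda>\<omega>. if \<exists>n. ?P n \<omega> then flow (t - fst (chain z \<omega> (LEAST n. ?P n \<omega>))) (snd (chain z \<omega> (LEAST n. ?P n \<omega>))) else z)
      \<in> borel_measurable SN"
    using ex by (intro measurable_If) (auto simp: pred_def)
  then show ?thesis unfolding proc_eq[abs_def] Let_def .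
qed

text \<open>
  The paths with fewer than \<open>n\<close> jumps up to time \<open>t\<close>. Restricted to them, conditioning on the first
  stage is an exact recursion, whatever value a path is given after an explosion.
\<close>

definition few_jumps :: "nat \<Rightarrow> real \<Rightarrow> 'a \<times> 'a \<Rightarrow> 'w stream set" where
  "few_jumps n t z = {\<omega> \<in> space SN. t < fst (chain z \<omega> n)}"

lemma few_jumps_sets [measurable]: "few_jumps n t z \<in> sets SN"
proof -
  note [measurable] = chain_measurable
  show ?thesis unfolding few_jumps_def by measurable
qed

lemma space_SN_Stream: "w \<in> space N \<Longrightarrow> \<omega> \<in> space SN \<Longrightarrow> w ## \<omega> \<in> space SN"
  by (auto simp: space_stream_space streams_Stream)

lemma expectation_few_jumps:
  assumes f: "bc (\<lambda>_. f)" and f0: "\<And>z. 0 \<le> f z" and t: "0 \<le> t"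
  shows "(\<integral>\<^sup>+\<omega>. ennreal (f (proc t z \<omega>)) * indicator (few_jumps n t z) \<omega> \<partial>SN) = ennreal (iter f n t z)"
  using t
proof (induction n arbitrary: t z)
  case 0
  then have "few_jumps 0 t z = {}" by (auto simp: few_jumps_def)
  then show ?case by simp
next
  case (Suc n)
  interpret SNp: prob_space SN by (rule prob_space_stream_space)
  have cf: "continuous_on UNIV f" using f by (simp add: bc_fun)
  have fm [measurable]: "f \<in> borel_measurable borel" by (rule borel_measurable_continuous_onI[OF cf])
  have it0: "0 \<le> iter f n s y" for s y
    using iter_mono[OF bc_const[of 0] f f0, of n s y] by (simp add: iter_const_0)
  have itc: "continuous_on UNIV (\<lambda>s. iter f n (g s) (h s))"
    if "continuous_on UNIV g" "continuous_on UNIV h" for g and h :: "'x::topological_space \<Rightarrow> 'a \<times> 'a"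
    by (rule bc_compose[OF bc_iter[OF f] that])
  let ?F = "\<lambda>n t z \<omega>. ennreal (f (proc t z \<omega>)) * indicator (few_jumps n t z) \<omega>"
  have Fm: "?F n t z \<in> borel_measurable SN" for n t z
    using measurable_compose[OF proc_measurable fm] by measurable
  define g1 where "g1 u s = ennreal (u (t - s) (bounce U (flow s z)))" for u s
  define g2 where "g2 u p = ennreal (u (t - fst p) (refresh \<alpha> (snd p) (flow (fst p) z)))" for u p
  have inner: "(\<integral>\<^sup>+\<omega>. ?F (Suc n) t z (w ## \<omega>) \<partial>SN) =
      (if len z w \<le> t then 0 else ennreal (f (flow t z))) +
      stage_value t z (g1 (iter f n)) (g2 (iter f n)) w" if w: "w \<in> space N" for w
  proof (cases "len z w \<le> t")
    case False
    have "?F (Suc n) t z (w ## \<omega>) = ennreal (f (flow t z))" if "\<omega> \<in> space SN" for \<omega>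
    proof -
      have "w ## \<omega> \<in> few_jumps (Suc n) t z"
        using False chain_time_nonneg[of "next_state z w" \<omega> n] space_SN_Stream[OF w that]
        by (simp add: few_jumps_def chain_Stream)
      then show ?thesis using False proc_before_first_jump[OF Suc.prems] by simp
    qed
    then have "(\<integral>\<^sup>+\<omega>. ?F (Suc n) t z (w ## \<omega>) \<partial>SN) = (\<integral>\<^sup>+\<omega>. ennreal (f (flow t z)) \<partial>SN)"
      by (intro nn_integral_cong)
    then show ?thesis using False by (simp add: SNp.emeasure_space_1)
  next
    case True
    have "?F (Suc n) t z (w ## \<omega>) = ?F n (t - len z w) (next_state z w) \<omega>" if \<omega>: "\<omega> \<in> space SN" for \<omega>
    proof (cases "t - len z w < fst (chain (next_state z w) \<omega> n)")
      case inside: True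
      then have "w ## \<omega> \<in> few_jumps (Suc n) t z" "\<omega> \<in> few_jumps n (t - len z w) (next_state z w)"
        using space_SN_Stream[OF w \<omega>] \<omega> by (auto simp: few_jumps_def chain_Stream)
      then show ?thesis using proc_after_first_jump[OF True inside] by simp
    next
      case False
      then have "w ## \<omega> \<notin> few_jumps (Suc n) t z" "\<omega> \<notin> few_jumps n (t - len z w) (next_state z w)"
        by (auto simp: few_jumps_def chain_Stream)
      then show ?thesis by simp
    qed
    then have "(\<integral>\<^sup>+\<omega>. ?F (Suc n) t z (w ## \<omega>) \<partial>SN) = (\<integral>\<^sup>+\<omega>. ?F n (t - len z w) (next_state z w) \<omega> \<partial>SN)"
      by (intro nn_integral_cong)
    also have "\<dots> = ennreal (iter f n (t - len z w) (next_state z w))"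
      using True by (intro Suc.IH) simp
    finally show ?thesis using True by (simp add: g1_def g2_def stage_end_def Let_def)
  qed
  have g1m: "g1 (iter f n) \<in> borel_measurable borel"
  proof -
    have p: "(\<lambda>s. (t - s, bounce U (flow s z))) \<in> borel \<rightarrow>\<^sub>M borel \<Otimes>\<^sub>M borel"
      by (intro measurable_Pair measurable_compose[OF flow_measurable bounce_measurable]) auto
    have i: "(\<lambda>(u, y). iter f n u y) \<in> borel_measurable (borel \<Otimes>\<^sub>M borel)"
      unfolding borel_prod by (rule borel_measurable_continuous_onI[OF bc_continuous[OF bc_iter[OF f]]])
    show ?thesis
      using measurable_compose[OF measurable_compose[OF p i] measurable_ennreal] by (simp add: g1_def[abs_def])
  qed
  have g2m: "g2 (iter f n) \<in> borel_measurable (borel \<Otimes>\<^sub>M borel)"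
    unfolding g2_def[abs_def] borel_prod
    by (intro measurable_compose[OF _ measurable_ennreal] borel_measurable_continuous_onI itc continuous_intros)
  have lm [measurable]: "len z \<in> borel_measurable N"
    using measurable_compose[OF measurable_Pair1' len_measurable, of z] by simp
  have stage_m: "stage_value t z h1 h2 \<in> borel_measurable N"
    if [measurable]: "h1 \<in> borel_measurable borel" "h2 \<in> borel_measurable (borel \<Otimes>\<^sub>M borel)" for h1 h2
    by measurable
  have renewal_int: "(\<integral>\<^sup>+s. indicator {0..t} s * stage_density z (g1 u) (g2 u) s \<partial>lborel) = ennreal (renewal_integral u t z)"
    if u: "bc u" and u0: "\<And>s y. 0 \<le> u s y" for u
  proof -
    have rm: "(\<integral>\<^sup>+x. g2 u (s, x) \<partial>\<gamma>) = ennreal (refresh_mean (u (t - s)) (flow s z))" for s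
      unfolding refresh_mean_def g2_def fst_conv snd_conv
      by (intro nn_integral_eq_integral refresh_integrable bc_at[OF u]) (simp add: u0)
    have rm0: "0 \<le> refresh_mean (u s) y" for s y
      unfolding refresh_mean_def by (intro Bochner_Integration.integral_nonneg u0)
    have j0: "0 \<le> surv s z * jump (u (t - s)) (flow s z)" for s
      unfolding jump_def using surv_pos[of s z] bounce_rate_nonneg r u0 rm0
      by (intro mult_nonneg_nonneg add_nonneg_nonneg) (auto intro: less_imp_le)
    have "stage_density z (g1 u) (g2 u) s = ennreal (surv s z * jump (u (t - s)) (flow s z))" for s
      unfolding rm g1_def using surv_pos[of s z] bounce_rate_nonneg[of "flow s z"] r u0 rm0
      by (simp add: jump_def distrib_left mult.assoc ennreal_mult[symmetric] ennreal_plus[symmetric]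
          less_imp_le del: ennreal_plus)
    then have "(\<integral>\<^sup>+s. indicator {0..t} s * stage_density z (g1 u) (g2 u) s \<partial>lborel) =
        (\<integral>\<^sup>+s. ennreal (indicator {0..t} s * (surv s z * jump (u (t - s)) (flow s z))) \<partial>lborel)"
      by (intro nn_integral_cong) (simp add: indicator_def)
    also have "\<dots> = ennreal (renewal_integral u t z)"
      using nn_integral_has_integral_lebesgue[OF j0 integrable_integral[OF renewal_integrable[OF u]]] by simp
    finally show ?thesis .
  qed
  have no_jump: "emeasure N {w \<in> space N. \<not> len z w \<le> t} = ennreal (surv t z)"
  proof -
    have "(\<integral>\<^sup>+w. indicator {w \<in> space N. len z w \<le> t} w \<partial>N) = (\<integral>\<^sup>+w. stage_value t z (\<lambda>_. ennreal 1) (\<lambda>_. ennreal 1) w \<partial>N)"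
      by (intro nn_integral_cong) (auto simp: indicator_def)
    also have "\<dots> = (\<integral>\<^sup>+s. indicator {0..t} s * stage_density z (\<lambda>_. ennreal 1) (\<lambda>_. ennreal 1) s \<partial>lborel)"
      by (rule stage_law[OF Suc.prems]) (rule measurable_const, simp)+
    also have "\<dots> = ennreal (renewal_integral (\<lambda>_ _. 1) t z)"
      by (rule renewal_int[of "\<lambda>_ _. 1", unfolded g1_def g2_def, OF bc_const]) simp
    also have "\<dots> = ennreal (1 - surv t z)"
      using integral_unique[OF surv_rate_integral[OF Suc.prems, of z]] by (simp add: jump_const)
    finally have "measure N {w \<in> space N. len z w \<le> t} = 1 - surv t z"
      using surv_le_1[OF Suc.prems, of z] by (simp add: emeasure_eq_measure)
    moreover have "{w \<in> space N. \<not> len z w \<le> t} = space N - {w \<in> space N. len z w \<le> t}" by auto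
    ultimately have "measure N {w \<in> space N. \<not> len z w \<le> t} = surv t z"
      by (simp add: prob_compl)
    then show ?thesis by (simp add: emeasure_eq_measure)
  qed
  have "(\<integral>\<^sup>+\<omega>. ?F (Suc n) t z \<omega> \<partial>SN) = (\<integral>\<^sup>+w. (\<integral>\<^sup>+\<omega>. ?F (Suc n) t z (w ## \<omega>) \<partial>SN) \<partial>N)"
    by (rule nn_integral_stream_space[OF Fm])
  also have "\<dots> = (\<integral>\<^sup>+w. (if len z w \<le> t then 0 else ennreal (f (flow t z))) + stage_value t z (g1 (iter f n)) (g2 (iter f n)) w \<partial>N)"
    by (intro nn_integral_cong inner)
  also have "\<dots> = (\<integral>\<^sup>+w. (if len z w \<le> t then 0 else ennreal (f (flow t z))) \<partial>N) + (\<integral>\<^sup>+w. stage_value t z (g1 (iter f n)) (g2 (iter f n)) w \<partial>N)"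
    by (intro nn_integral_add stage_m g1m g2m) measurable
  also have "(\<integral>\<^sup>+w. (if len z w \<le> t then 0 else ennreal (f (flow t z))) \<partial>N) = ennreal (surv t z * f (flow t z))"
  proof -
    have "(\<integral>\<^sup>+w. (if len z w \<le> t then 0 else ennreal (f (flow t z))) \<partial>N) =
        (\<integral>\<^sup>+w. ennreal (f (flow t z)) * indicator {w \<in> space N. \<not> len z w \<le> t} w \<partial>N)"
      by (intro nn_integral_cong) (auto simp: indicator_def)
    also have "\<dots> = ennreal (f (flow t z)) * emeasure N {w \<in> space N. \<not> len z w \<le> t}"
      by (rule nn_integral_cmult_indicator) measurable
    finally show ?thesis unfolding no_jump using f0 surv_pos[of t z]
      by (simp add: ennreal_mult[symmetric] mult.commute less_imp_le)
  qed
  also have "(\<integral>\<^sup>+w. stage_value t z (g1 (iter f n)) (g2 (iter f n)) w \<partial>N) = ennreal (renewal_integral (iter f n) t z)"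
    unfolding stage_law[OF Suc.prems g1m g2m, of z] by (rule renewal_int[OF bc_iter[OF f] it0])
  also have "ennreal (surv t z * f (flow t z)) + ennreal (renewal_integral (iter f n) t z) =
      ennreal (iter f (Suc n) t z)"
  proof -
    have "0 \<le> renewal_integral (iter f n) t z"
    proof -
      have "renewal_integral (\<lambda>_ _. 0) t z \<le>
          renewal_integral (iter f n) t z"
        by (rule renewal_integral_mono[OF bc_const[of 0] bc_iter[OF f] it0])
      then show ?thesis by (simp add: jump_const)
    qed
    moreover have "0 \<le> surv t z * f (flow t z)" using f0 surv_pos[of t z] by (simp add: less_imp_le)
    ultimately show ?thesis using Suc.prems by (simp add: renewal_def ennreal_plus[symmetric] del: ennreal_plus)
  qed
  finally show ?case .
qed

text \<open>
  Adding a constant reduces the signed case to nonnegative functions, by linearity of the iterates.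
\<close>

lemma integral_few_jumps:
  assumes f: "bc (\<lambda>_. f)" and t: "0 \<le> t"
  shows "(\<integral>\<omega>. f (proc t z \<omega>) * indicator (few_jumps n t z) \<omega> \<partial>SN) = iter f n t z"
proof -
  interpret SNp: prob_space SN by (rule prob_space_stream_space)
  have nonneg: "has_bochner_integral SN (\<lambda>\<omega>. g (proc t z \<omega>) * indicator (few_jumps n t z) \<omega>) (iter g n t z)"
    if g: "bc (\<lambda>_. g)" and g0: "\<And>z. 0 \<le> g z" for g
  proof (rule has_bochner_integral_nn_integral)
    have "g \<in> borel_measurable borel" using g by (auto simp: bc_fun intro: borel_measurable_continuous_onI)
    from measurable_compose[OF proc_measurable this]
    show "(\<lambda>\<omega>. g (proc t z \<omega>) * indicator (few_jumps n t z) \<omega>) \<in> borel_measurable SN" by measurable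
    show "0 \<le> iter g n t z"
      using iter_mono[OF bc_const[of 0] g g0, of n t z] by (simp add: iter_const_0)
    have "(\<integral>\<^sup>+\<omega>. ennreal (g (proc t z \<omega>) * indicator (few_jumps n t z) \<omega>) \<partial>SN) =
        (\<integral>\<^sup>+\<omega>. ennreal (g (proc t z \<omega>)) * indicator (few_jumps n t z) \<omega> \<partial>SN)"
      by (intro nn_integral_cong) (simp add: indicator_def)
    then show "(\<integral>\<^sup>+\<omega>. ennreal (g (proc t z \<omega>) * indicator (few_jumps n t z) \<omega>) \<partial>SN) = ennreal (iter g n t z)"
      using expectation_few_jumps[OF g g0 t] by simp
  qed (simp add: g0)
  obtain M where M0: "0 \<le> M" and M: "\<And>z. \<bar>f z\<bar> \<le> M" using f by (rule bc_bounded) blast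
  have bM: "bc (\<lambda>_ z. 1 * f z + M * 1)" by (intro bc_add bc_cmult f bc_const)
  have "0 \<le> 1 * f z + M * 1" for z using M[of z] by (simp add: abs_le_iff)
  from has_bochner_integral_diff[OF nonneg[OF bM this] has_bochner_integral_mult_right[OF nonneg[OF bc_const[of 1]], of M]]
  have "has_bochner_integral SN (\<lambda>\<omega>. (1 * f (proc t z \<omega>) + M * 1) * indicator (few_jumps n t z) \<omega>
      - M * (1 * indicator (few_jumps n t z) \<omega>)) (iter f n t z)"
    using iter_lin[OF f bc_const[of 1], of 1 M n t z] by simp
  then have "has_bochner_integral SN (\<lambda>\<omega>. f (proc t z \<omega>) * indicator (few_jumps n t z) \<omega>) (iter f n t z)"
    by (simp add: algebra_simps)
  then show ?thesis by (rule has_bochner_integral_integral_eq)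
qed

end

sublocale bps_process \<subseteq> bps_approximation U "distr N borel \<xi>" r \<alpha> "bps_semigroup U \<alpha> N T1 T2 \<xi>"
proof
  fix t :: real and f :: "'a \<times> 'a \<Rightarrow> real" and M n z
  assume t: "0 \<le> t" and f: "bc (\<lambda>_. f)" and M: "\<And>z. \<bar>f z\<bar> \<le> M"
  interpret SNp: prob_space SN by (rule prob_space_stream_space)
  let ?I = "indicator (few_jumps n t z) :: 'w stream \<Rightarrow> real"
  have M0: "0 \<le> M" using order_trans[OF abs_ge_zero M] .
  have fm: "(\<lambda>\<omega>. f (proc t z \<omega>)) \<in> borel_measurable SN"
    using f by (auto simp: bc_fun intro!: measurable_compose[OF proc_measurable] borel_measurable_continuous_onI)
  have i1: "integrable SN (\<lambda>\<omega>. f (proc t z \<omega>))"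
    using M by (intro SNp.integrable_const_bound[where B=M] AE_I2 fm) auto
  have i2: "integrable SN (\<lambda>\<omega>. f (proc t z \<omega>) * ?I \<omega>)"
    by (rule integrable_real_mult_indicator[OF few_jumps_sets i1])
  have i3: "integrable SN ?I" by (simp add: SNp.emeasure_finite less_top[symmetric])
  have "bps_semigroup U \<alpha> N T1 T2 \<xi> t f z - iter f n t z =
      (\<integral>\<omega>. f (proc t z \<omega>) - f (proc t z \<omega>) * ?I \<omega> \<partial>SN)"
    unfolding bps_semigroup_def using integral_few_jumps[OF f t] i1 i2 by simp
  also have "\<bar>\<dots>\<bar> \<le> (\<integral>\<omega>. M - M * ?I \<omega> \<partial>SN)"
  proof -
    have "norm (\<integral>\<omega>. f (proc t z \<omega>) - f (proc t z \<omega>) * ?I \<omega> \<partial>SN) \<le> (\<integral>\<omega>. M - M * ?I \<omega> \<partial>SN)"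
    proof (rule order_trans[OF integral_norm_bound])
      show "(\<integral>\<omega>. norm (f (proc t z \<omega>) - f (proc t z \<omega>) * ?I \<omega>) \<partial>SN) \<le> (\<integral>\<omega>. M - M * ?I \<omega> \<partial>SN)"
        by (intro integral_mono integrable_norm Bochner_Integration.integrable_diff integrable_mult_right i1 i2 i3)
          (use M M0 in \<open>auto simp: indicator_def\<close>)
    qed
    then show ?thesis by simp
  qed
  also have "(\<integral>\<omega>. M - M * ?I \<omega> \<partial>SN) = M * tail n t z"
    using integral_few_jumps[OF bc_const[of 1] t] i3
    by (simp add: tail_def SNp.prob_space right_diff_distrib)
  finally show "\<bar>bps_semigroup U \<alpha> N T1 T2 \<xi> t f z - iter f n t z\<bar> \<le> M * tail n t z" .
qed

theorem corollary6p4: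
  fixes U :: "'a::euclidean_space \<Rightarrow> real"
    and r \<alpha> :: real
    and N :: "'w measure"
    and T1 :: "'a \<times> 'a \<Rightarrow> 'w \<Rightarrow> ennreal"
    and T2 :: "'w \<Rightarrow> real"
    and \<xi> :: "'w \<Rightarrow> 'a"
  assumes "Ck 1 U"
    and "integrable lborel (\<lambda>q. exp (- U q))"
    and "r > 0"
    and "0 < \<alpha>" and "\<alpha> \<le> 1"
    and "bps_stage N U r T1 T2 \<xi>"
  shows "feller (bps_semigroup U \<alpha> N T1 T2 \<xi>) \<and>
         is_core (bps_semigroup U \<alpha> N T1 T2 \<xi>) Cc_infinity"
proof -
  interpret bps_process N U r T1 T2 \<xi> \<alpha>
    using assms(1,3-6) by (intro bps_process.intro bps_process_axioms.intro)
  show ?thesis using semigroup_feller test_functions_core by blast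
qed

end
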